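(* Let $G$ be a finitely generated group. Identify $S(\nu(G))$ with $S(\nu(G)/W_0)$ via the canonical projection $\nu(G) \to \nu(G)/W_0$, and identify $S(\nu(G)/W_0)$ with $S(\mathfrak{X}(G)/W)$ via the isomorphism $\nu(G)/W_0 \simeq \mathfrak{X}(G)/W$. Then $$\Sigma^1(\nu(G), \mathbb{Z}) = \Sigma^1(\mathfrak{X}(G)/W, \mathbb{Z}).$$
   Context: For a group $G$ let $\overline{G}$ be an isomorphic copy of $G$, with $\overline{g}$ the image of $g \in G$. Write $a^b = b^{-1}ab$ and $[a,b] = a^{-1}b^{-1}ab$. Define $\mathfrak{X}(G) = \langle G, \overline{G} \mid [g, \overline{g}] = 1 \text{ for } g \in G\rangle$ and $\nu(G) = \langle G, \overline{G} \mid [g_1, \overline{g_2}]^{g_3} = [g_1^{g_3}, \overline{g_2^{g_3}}] = [g_1, \overline{g_2}]^{\overline{g_3}} \text{ for } g_1,g_2,g_3 \in G\rangle$. In $\mathfrak{X}(G)$ let $L = \langle \overline{g}^{-1} g \mid g \in G\rangle$, $D = [G, \overline{G}]$ (both normal) and $W = W(G) = L \cap D$. There is an epimorphism $\nu(G) \to \mathfrak{X}(G)/W$ that sends $g$ and $\overline{g}$ (for $g \in G$) to the images of $g$ and $\overline{g}$ in $\mathfrak{X}(G)/W$; $W_0$ denotes its kernel, so that it induces the isomorphism $\nu(G)/W_0 \simeq \mathfrak{X}(G)/W$; moreover $W_0 \subseteq \nu(G)'$. A character of a group $H$ is a non-zero homomorphism $\chi : H \to \mathbb{R}$. Two characters are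 equivalent if one is a positive real multiple of the other; $[\chi]$ is the equivalence class and $S(H)$ is the set of equivalence classes (the character sphere). Put $H_\chi = \{h \in H \mid \chi(h) \geq 0\}$, a submonoid of $H$. A module over a ring is of type $FP_n$ if it has a projective resolution with finitely generated projectives in dimensions $\leq n$. $\Sigma^n(H, \mathbb{Z}) = \{[\chi] \in S(H) \mid \text{the trivial module } \mathbb{Z} \text{ is of type } FP_n \text{ as a left } \mathbb{Z}H_\chi\text{-module}\}$. For finitely generated $H$, $\Sigma^1(H,\mathbb{Z})$ coincides with the set $\Sigma^1(H)$ of those $[\chi]$ for which the subgraph spanned by $H_\chi$ in the Cayley graph of $H$ (vertices $H$, edges from $h$ to $hx$, $x$ in a finite generating set) is connected. *)

theory Defs
  imports "HOL-Algebra.Generated_Groups" "HOL-Algebra.Module" "HOL-Algebra.AbelCoset"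
    "HOL-Library.Poly_Mapping" Complex_Main
begin

section \<open>Groups given by generators and relators\<close>

text \<open>The letter \<open>(x, True)\<close> stands for the generator \<open>x\<close> and \<open>(x, False)\<close> for its inverse.\<close>

type_synonym 'x word = "('x \<times> bool) list"

definition words :: "'x set \<Rightarrow> 'x word set" where
  "words X = lists (X \<times> UNIV)"

definition winv :: "'x word \<Rightarrow> 'x word" where
  "winv w = rev (map (\<lambda>(x, b). (x, \<not> b)) w)"

definition wconj :: "'x word \<Rightarrow> 'x word \<Rightarrow> 'x word" where
  "wconj a b = winv b @ a @ b"

definition wcomm :: "'x word \<Rightarrow> 'x word \<Rightarrow> 'x word" where
  "wcomm a b = winv a @ winv b @ a @ b"

inductive_set pres_rel :: "'x set \<Rightarrow> 'x word set \<Rightarrow> ('x word \<times> 'x word) set"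
  for X :: "'x set" and R :: "'x word set" where
  refl: "w \<in> words X \<Longrightarrow> (w, w) \<in> pres_rel X R"
| sym: "(u, v) \<in> pres_rel X R \<Longrightarrow> (v, u) \<in> pres_rel X R"
| trans: "\<lbrakk>(u, v) \<in> pres_rel X R; (v, w) \<in> pres_rel X R\<rbrakk> \<Longrightarrow> (u, w) \<in> pres_rel X R"
| cancel: "\<lbrakk>u \<in> words X; v \<in> words X; x \<in> X\<rbrakk> \<Longrightarrow> (u @ [(x, b), (x, \<not> b)] @ v, u @ v) \<in> pres_rel X R"
| relator: "\<lbrakk>u \<in> words X; v \<in> words X; r \<in> R\<rbrakk> \<Longrightarrow> (u @ r @ v, u @ v) \<in> pres_rel X R"

definition presented_group :: "'x set \<Rightarrow> 'x word set \<Rightarrow> 'x word set monoid" where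
  "presented_group X R =
    \<lparr>carrier = words X // pres_rel X R,
     monoid.mult = (\<lambda>A B. \<Union>a\<in>A. \<Union>b\<in>B. pres_rel X R `` {a @ b}),
     one = pres_rel X R `` {[]}\<rparr>"

definition pres_gen :: "'x set \<Rightarrow> 'x word set \<Rightarrow> 'x \<Rightarrow> 'x word set" where
  "pres_gen X R x = pres_rel X R `` {[(x, True)]}"

definition word_eval :: "('k, 'm) monoid_scheme \<Rightarrow> ('x \<Rightarrow> 'k) \<Rightarrow> 'x word \<Rightarrow> 'k" where
  "word_eval K f w =
    foldr (\<lambda>(x, b) k. (if b then f x else inv\<^bsub>K\<^esub> (f x)) \<otimes>\<^bsub>K\<^esub> k) w \<one>\<^bsub>K\<^esub>"

text \<open>The homomorphism to \<open>K\<close> induced by an assignment \<open>f\<close> of the generators to elements of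
  \<open>K\<close> under which all relators evaluate to the identity.  An element of a presented group is
  a class of words, all of which then have the same value.\<close>

definition pres_hom :: "('k, 'm) monoid_scheme \<Rightarrow> ('x \<Rightarrow> 'k) \<Rightarrow> 'x word set \<Rightarrow> 'k" where
  "pres_hom K f c = the_elem (word_eval K f ` c)"


section \<open>The groups X(G) and nu(G)\<close>

text \<open>The generators are two copies of \<open>G\<close>: \<open>Inl g\<close> is \<open>g\<close> and \<open>Inr g\<close> is its image in the
  isomorphic copy of \<open>G\<close>.  The multiplication tables of both copies belong to the relators.\<close>

definition two_copies :: "('a, 'b) monoid_scheme \<Rightarrow> ('a + 'a) set" where
  "two_copies G = carrier G <+> carrier G"

abbreviation wl :: "'a \<Rightarrow> ('a + 'a) word" where
  "wl g \<equiv> [(Inl g, True)]"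

abbreviation wr :: "'a \<Rightarrow> ('a + 'a) word" where
  "wr g \<equiv> [(Inr g, True)]"

definition table_relators :: "('a, 'b) monoid_scheme \<Rightarrow> ('a + 'a) word set" where
  "table_relators G =
    {wl g @ wl h @ winv (wl (g \<otimes>\<^bsub>G\<^esub> h)) | g h. g \<in> carrier G \<and> h \<in> carrier G} \<union>
    {wr g @ wr h @ winv (wr (g \<otimes>\<^bsub>G\<^esub> h)) | g h. g \<in> carrier G \<and> h \<in> carrier G}"

definition conj_elem :: "('a, 'b) monoid_scheme \<Rightarrow> 'a \<Rightarrow> 'a \<Rightarrow> 'a" where
  "conj_elem G a b = inv\<^bsub>G\<^esub> b \<otimes>\<^bsub>G\<^esub> a \<otimes>\<^bsub>G\<^esub> b"

definition comm_elem :: "('a, 'b) monoid_scheme \<Rightarrow> 'a \<Rightarrow> 'a \<Rightarrow> 'a" where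
  "comm_elem G a b = inv\<^bsub>G\<^esub> a \<otimes>\<^bsub>G\<^esub> inv\<^bsub>G\<^esub> b \<otimes>\<^bsub>G\<^esub> a \<otimes>\<^bsub>G\<^esub> b"

definition X_relators :: "('a, 'b) monoid_scheme \<Rightarrow> ('a + 'a) word set" where
  "X_relators G = table_relators G \<union> {wcomm (wl g) (wr g) | g. g \<in> carrier G}"

definition nu_relators :: "('a, 'b) monoid_scheme \<Rightarrow> ('a + 'a) word set" where
  "nu_relators G = table_relators G \<union>
    {wconj (wcomm (wl g1) (wr g2)) (wl g3)
       @ winv (wcomm (wl (conj_elem G g1 g3)) (wr (conj_elem G g2 g3)))
     | g1 g2 g3. g1 \<in> carrier G \<and> g2 \<in> carrier G \<and> g3 \<in> carrier G} \<union>
    {wcomm (wl (conj_elem G g1 g3)) (wr (conj_elem G g2 g3))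
       @ winv (wconj (wcomm (wl g1) (wr g2)) (wr g3))
     | g1 g2 g3. g1 \<in> carrier G \<and> g2 \<in> carrier G \<and> g3 \<in> carrier G}"

definition X_group :: "('a, 'b) monoid_scheme \<Rightarrow> ('a + 'a) word set monoid" where
  "X_group G = presented_group (two_copies G) (X_relators G)"

definition nu_group :: "('a, 'b) monoid_scheme \<Rightarrow> ('a + 'a) word set monoid" where
  "nu_group G = presented_group (two_copies G) (nu_relators G)"

definition X_gen :: "('a, 'b) monoid_scheme \<Rightarrow> 'a + 'a \<Rightarrow> ('a + 'a) word set" where
  "X_gen G = pres_gen (two_copies G) (X_relators G)"

definition L_subgroup :: "('a, 'b) monoid_scheme \<Rightarrow> ('a + 'a) word set set" where
  "L_subgroup G = generate (X_group G)
     {inv\<^bsub>X_group G\<^esub> (X_gen G (Inr g)) \<otimes>\<^bsub>X_group G\<^esub> X_gen G (Inl g) | g. g \<in> carrier G}"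

definition D_subgroup :: "('a, 'b) monoid_scheme \<Rightarrow> ('a + 'a) word set set" where
  "D_subgroup G = generate (X_group G)
     {comm_elem (X_group G) (X_gen G (Inl g)) (X_gen G (Inr h)) | g h.
        g \<in> carrier G \<and> h \<in> carrier G}"

definition W_subgroup :: "('a, 'b) monoid_scheme \<Rightarrow> ('a + 'a) word set set" where
  "W_subgroup G = L_subgroup G \<inter> D_subgroup G"

definition X_mod_W :: "('a, 'b) monoid_scheme \<Rightarrow> ('a + 'a) word set set monoid" where
  "X_mod_W G = X_group G Mod W_subgroup G"

text \<open>The relators of \<open>nu_group G\<close> hold in \<open>X_mod_W G\<close>: this group embeds in the product of
  \<open>X_group G Mod L_subgroup G\<close>, in which the two copies of \<open>G\<close> are identified, and
  \<open>X_group G Mod D_subgroup G\<close>, in which they commute.\<close>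

definition nu_to_X_mod_W ::
  "('a, 'b) monoid_scheme \<Rightarrow> ('a + 'a) word set \<Rightarrow> ('a + 'a) word set set" where
  "nu_to_X_mod_W G =
     pres_hom (X_mod_W G) (\<lambda>x. W_subgroup G #>\<^bsub>X_group G\<^esub> X_gen G x)"

definition W0_subgroup :: "('a, 'b) monoid_scheme \<Rightarrow> ('a + 'a) word set set" where
  "W0_subgroup G = kernel (nu_group G) (X_mod_W G) (nu_to_X_mod_W G)"

definition nu_mod_W0 :: "('a, 'b) monoid_scheme \<Rightarrow> ('a + 'a) word set set monoid" where
  "nu_mod_W0 G = nu_group G Mod W0_subgroup G"

definition nu_proj ::
  "('a, 'b) monoid_scheme \<Rightarrow> ('a + 'a) word set \<Rightarrow> ('a + 'a) word set set" where
  "nu_proj G x = W0_subgroup G #>\<^bsub>nu_group G\<^esub> x"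

text \<open>The isomorphism induced on \<open>nu_mod_W0 G\<close>, as in \<open>group_hom.FactGroup_iso\<close>.\<close>

definition induced_iso ::
  "('a, 'b) monoid_scheme \<Rightarrow> ('a + 'a) word set set \<Rightarrow> ('a + 'a) word set set" where
  "induced_iso G c = the_elem (nu_to_X_mod_W G ` c)"

definition fin_gen_group :: "('a, 'b) monoid_scheme \<Rightarrow> bool" where
  "fin_gen_group G \<longleftrightarrow> (\<exists>A. finite A \<and> A \<subseteq> carrier G \<and> generate G A = carrier G)"


section \<open>The character sphere\<close>

text \<open>Characters are extensional, so that equal characters are equal as HOL functions.\<close>

definition characters :: "('h, 'm) monoid_scheme \<Rightarrow> ('h \<Rightarrow> real) set" where
  "characters H = {\<chi> \<in> extensional (carrier H).
     (\<forall>x\<in>carrier H. \<forall>y\<in>carrier H. \<chi> (x \<otimes>\<^bsub>H\<^esub> y) = \<chi> x + \<chi> y) \<and>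
     (\<exists>x\<in>carrier H. \<chi> x \<noteq> 0)}"

definition char_rel :: "('h, 'm) monoid_scheme \<Rightarrow> (('h \<Rightarrow> real) \<times> ('h \<Rightarrow> real)) set" where
  "char_rel H = {(\<chi>, \<psi>). \<chi> \<in> characters H \<and> \<psi> \<in> characters H \<and>
     (\<exists>c>0. \<forall>x\<in>carrier H. \<psi> x = c * \<chi> x)}"

definition char_sphere :: "('h, 'm) monoid_scheme \<Rightarrow> ('h \<Rightarrow> real) set set" where
  "char_sphere H = characters H // char_rel H"

text \<open>The map from \<open>char_sphere K\<close> to \<open>char_sphere H\<close>, \<open>[\<chi>] \<mapsto> [\<chi> \<circ> f]\<close>, for an epimorphism
  \<open>f\<close> from \<open>H\<close> to \<open>K\<close>.\<close>

definition sphere_pullback ::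
  "('h, 'm) monoid_scheme \<Rightarrow> ('h \<Rightarrow> 'k) \<Rightarrow> ('k \<Rightarrow> real) set \<Rightarrow> ('h \<Rightarrow> real) set" where
  "sphere_pullback H f C = char_rel H `` ((\<lambda>\<chi>. restrict (\<chi> \<circ> f) (carrier H)) ` C)"

definition char_monoid :: "('h, 'm) monoid_scheme \<Rightarrow> ('h \<Rightarrow> real) \<Rightarrow> ('h, 'm) monoid_scheme" where
  "char_monoid H \<chi> = H\<lparr>carrier := {h \<in> carrier H. \<chi> h \<ge> 0}\<rparr>"


section \<open>Left modules over not necessarily commutative rings\<close>

text \<open>The locale \<open>module\<close> of the library is restricted to commutative rings.  In the record
  \<open>module\<close> only the additive structure and \<open>smult\<close> matter here.\<close>

locale left_module = R?: ring R + M?: abelian_group M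
  for R (structure) and M (structure) +
  assumes smult_closed: "\<lbrakk>a \<in> carrier R; x \<in> carrier M\<rbrakk> \<Longrightarrow> a \<odot>\<^bsub>M\<^esub> x \<in> carrier M"
    and smult_l_distr: "\<lbrakk>a \<in> carrier R; b \<in> carrier R; x \<in> carrier M\<rbrakk> \<Longrightarrow>
      (a \<oplus>\<^bsub>R\<^esub> b) \<odot>\<^bsub>M\<^esub> x = a \<odot>\<^bsub>M\<^esub> x \<oplus>\<^bsub>M\<^esub> b \<odot>\<^bsub>M\<^esub> x"
    and smult_r_distr: "\<lbrakk>a \<in> carrier R; x \<in> carrier M; y \<in> carrier M\<rbrakk> \<Longrightarrow>
      a \<odot>\<^bsub>M\<^esub> (x \<oplus>\<^bsub>M\<^esub> y) = a \<odot>\<^bsub>M\<^esub> x \<oplus>\<^bsub>M\<^esub> a \<odot>\<^bsub>M\<^esub> y"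
    and smult_assoc: "\<lbrakk>a \<in> carrier R; b \<in> carrier R; x \<in> carrier M\<rbrakk> \<Longrightarrow>
      (a \<otimes>\<^bsub>R\<^esub> b) \<odot>\<^bsub>M\<^esub> x = a \<odot>\<^bsub>M\<^esub> (b \<odot>\<^bsub>M\<^esub> x)"
    and smult_one: "x \<in> carrier M \<Longrightarrow> \<one>\<^bsub>R\<^esub> \<odot>\<^bsub>M\<^esub> x = x"

definition lm_hom ::
  "('r, 's) ring_scheme \<Rightarrow> ('r, 'p, 't) module_scheme \<Rightarrow> ('r, 'q, 'u) module_scheme \<Rightarrow> ('p \<Rightarrow> 'q) set"
where
  "lm_hom R M N = {f \<in> hom (add_monoid M) (add_monoid N).
     \<forall>a\<in>carrier R. \<forall>x\<in>carrier M. f (a \<odot>\<^bsub>M\<^esub> x) = a \<odot>\<^bsub>N\<^esub> f x}"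

definition fin_gen_module :: "('r, 's) ring_scheme \<Rightarrow> ('r, 'p, 't) module_scheme \<Rightarrow> bool" where
  "fin_gen_module R M \<longleftrightarrow> (\<exists>B. finite B \<and> B \<subseteq> carrier M \<and>
     (\<forall>N. submodule N R M \<and> B \<subseteq> N \<longrightarrow> N = carrier M))"

text \<open>The free module on the set \<open>X\<close>: finitely supported functions from \<open>X\<close> to \<open>R\<close>.  The
  \<open>mult\<close> and \<open>one\<close> fields are dummies.\<close>

definition free_module :: "('r, 's) ring_scheme \<Rightarrow> 'x set \<Rightarrow> ('r, 'x \<Rightarrow> 'r) module" where
  "free_module R X =
    \<lparr>carrier = {f. range f \<subseteq> carrier R \<and> finite {x. f x \<noteq> \<zero>\<^bsub>R\<^esub>} \<and> {x. f x \<noteq> \<zero>\<^bsub>R\<^esub>} \<subseteq> X},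
     monoid.mult = (\<lambda>f g x. \<zero>\<^bsub>R\<^esub>), one = (\<lambda>x. \<zero>\<^bsub>R\<^esub>),
     ring.zero = (\<lambda>x. \<zero>\<^bsub>R\<^esub>), add = (\<lambda>f g x. f x \<oplus>\<^bsub>R\<^esub> g x),
     smult = (\<lambda>a f x. a \<otimes>\<^bsub>R\<^esub> f x)\<rparr>"

text \<open>Projective: isomorphic to a direct summand of a free module.  It is enough to
  consider bases \<open>X\<close> inside the carrier type of \<open>P\<close>, because a projective \<open>P\<close> is a direct
  summand of the free module on its underlying set.\<close>

definition projective_module :: "('r, 's) ring_scheme \<Rightarrow> ('r, 'p) module \<Rightarrow> bool" where
  "projective_module R P \<longleftrightarrow> left_module R P \<and>
    (\<exists>(X :: 'p set) i q. i \<in> lm_hom R P (free_module R X) \<and> q \<in> lm_hom R (free_module R X) P \<and>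
       (\<forall>x\<in>carrier P. q (i x) = x))"

text \<open>\<open>\<dots> \<rightarrow> P 2 \<rightarrow> P 1 \<rightarrow> P 0 \<rightarrow> M \<rightarrow> 0\<close> exact, with maps \<open>d i\<close> from \<open>P (i + 1)\<close> to \<open>P i\<close> and
  \<open>e\<close> from \<open>P 0\<close> to \<open>M\<close>.\<close>

definition projective_resolution ::
  "('r, 's) ring_scheme \<Rightarrow> ('r, 'q) module \<Rightarrow> (nat \<Rightarrow> ('r, 'p) module) \<Rightarrow> (nat \<Rightarrow> 'p \<Rightarrow> 'p) \<Rightarrow>
    ('p \<Rightarrow> 'q) \<Rightarrow> bool" where
  "projective_resolution R M P d e \<longleftrightarrow>
    (\<forall>i. projective_module R (P i)) \<and>
    e \<in> lm_hom R (P 0) M \<and> (\<forall>i. d i \<in> lm_hom R (P (Suc i)) (P i)) \<and>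
    e ` carrier (P 0) = carrier M \<and>
    d 0 ` carrier (P (Suc 0)) = a_kernel (P 0) M e \<and>
    (\<forall>i. d (Suc i) ` carrier (P (Suc (Suc i))) = a_kernel (P (Suc i)) (P i) (d i))"

text \<open>The modules of the resolution have their carriers in the type \<open>'r list\<close>, which is infinite
  and at least as large as \<open>R\<close>.  This is no restriction: if \<open>P 0, \<dots>, P n\<close> are finitely generated,
  they and the kernel of \<open>P n \<rightarrow> P (n - 1)\<close> have cardinality at most \<open>max |R| \<aleph>\<^sub>0\<close>, and from
  dimension \<open>n + 1\<close> on the resolution can be replaced by free modules of at most that
  cardinality.\<close>

definition type_FP :: "nat \<Rightarrow> ('r, 's) ring_scheme \<Rightarrow> ('r, 'q) module \<Rightarrow> bool" where
  "type_FP n R M \<longleftrightarrow> left_module R M \<and>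
    (\<exists>(P :: nat \<Rightarrow> ('r, 'r list) module) d e.
       projective_resolution R M P d e \<and> (\<forall>i\<le>n. fin_gen_module R (P i)))"


section \<open>The homological Sigma invariants\<close>

definition monoid_ring :: "('h, 'm) monoid_scheme \<Rightarrow> ('h \<Rightarrow>\<^sub>0 int) ring" where
  "monoid_ring H =
    \<lparr>carrier = {c. Poly_Mapping.keys c \<subseteq> carrier H},
     monoid.mult = (\<lambda>a b. frag_extend (\<lambda>x. frag_extend (\<lambda>y. frag_of (x \<otimes>\<^bsub>H\<^esub> y)) b) a),
     one = frag_of \<one>\<^bsub>H\<^esub>, ring.zero = 0, add = (+)\<rparr>"

definition augmentation :: "('h \<Rightarrow>\<^sub>0 int) \<Rightarrow> int" where
  "augmentation a = (\<Sum>x\<in>Poly_Mapping.keys a. Poly_Mapping.lookup a x)"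

definition trivial_module :: "('h \<Rightarrow>\<^sub>0 int, int) module" where
  "trivial_module =
    \<lparr>carrier = UNIV, monoid.mult = (*), one = 1, ring.zero = 0, add = (+),
     smult = (\<lambda>a k. augmentation a * k)\<rparr>"

definition Sigma_inv :: "nat \<Rightarrow> ('h, 'm) monoid_scheme \<Rightarrow> ('h \<Rightarrow> real) set set" where
  "Sigma_inv n H = {char_rel H `` {\<chi>} | \<chi>.
     \<chi> \<in> characters H \<and> type_FP n (monoid_ring (char_monoid H \<chi>)) trivial_module}"

end

theory Submission
  imports Defs
begin

text \<open>Write \<open>g'\<close> for the image of \<open>g\<close> in the second copy of \<open>G\<close>, and let \<open>\<pi>\<close> be the epimorphism from
  \<open>\<nu>(G)\<close> to \<open>X(G)/W\<close> with kernel \<open>W\<^sub>0\<close>.  The equality of the Sigma invariants rests on three facts: \<open>W\<^sub>0\<close> is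
  contained in the commutator subgroup, \<open>W\<^sub>0\<close> is central, and factoring out a central subgroup on
  which all characters vanish does not change \<open>\<Sigma>\<^sup>1\<close> of a finitely generated group.

  The kernel.  Since \<open>W = L \<inter> D\<close>, an element of \<open>W\<^sub>0\<close> becomes trivial under the projection to \<open>G\<close> that
  identifies the two copies and under the projection to \<open>G \<times> G\<close> that makes them commute.  The latter
  puts it into \<open>T = [G, G']\<close>, hence into the commutator subgroup.  By the relations of \<open>\<nu>(G)\<close>, an
  element of \<open>\<nu>(G)\<close> acts on \<open>T\<close> by conjugation in the same way as its image in \<open>G\<close> does.  This implies
  \<open>[[x, y'], c'] = [[x, y], c']\<close> (\<open>comm_comm\<close>), hence \<open>[t, c'] = [\<lambda>(t), c']\<close> for \<open>t\<close> in \<open>T\<close> with image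
  \<open>\<lambda>(t)\<close> in \<open>G\<close> (\<open>comm_cross\<close>).  So an element of \<open>T\<close> with trivial image in \<open>G\<close> commutes with the second
  copy of \<open>G\<close>, and then also with the first one, which acts on \<open>T\<close> in the same way
  (\<open>kernel_central\<close>).

  The Sigma invariant.  The trivial module is cyclic with annihilator the augmentation ideal, so it
  is of type \<open>FP\<^sub>1\<close> over \<open>\<int>H\<^sub>\<chi>\<close> if and only if the augmentation ideal is a finitely generated left ideal.
  One direction compares a given resolution with the monoid ring by lifting the augmentation
  (\<open>cyclic_type_FP_1_imp\<close>), the other one builds a resolution by free modules on the kernels
  (\<open>type_FP_1_presentation\<close>).  Finite generation passes to the image of an epimorphism of monoids
  (\<open>fin_gen_push\<close>), and it can be lifted if the differences of elements with equal images lie in a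
  finitely generated left ideal (\<open>fin_gen_lift\<close>).  For a central extension it is enough to find all
  \<open>z - 1\<close> with \<open>z\<close> in the central kernel in such an ideal, and this is always possible: a path from \<open>1\<close>
  to \<open>z\<close> in the Cayley graph is pushed into the half \<open>\<chi> \<ge> 0\<close> by a power of an element of positive value
  (\<open>central_in_fin_gen_left_ideal\<close>).  No finiteness of the kernel is needed.\<close>


section \<open>Presented groups and their universal property\<close>

lemma words_append [simp]: "u @ v \<in> words X \<longleftrightarrow> u \<in> words X \<and> v \<in> words X"
  by (auto simp: words_def)

lemma words_Nil [simp]: "[] \<in> words X"
  by (simp add: words_def)

lemma words_Cons [simp]: "p # v \<in> words X \<longleftrightarrow> fst p \<in> X \<and> v \<in> words X"
  by (cases p) (auto simp: words_def)

lemma winv_Nil [simp]: "winv [] = []"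
  by (simp add: winv_def)

lemma winv_Cons [simp]: "winv ((x, b) # w) = winv w @ [(x, \<not> b)]"
  by (simp add: winv_def)

lemma winv_append [simp]: "winv (u @ v) = winv v @ winv u"
  by (simp add: winv_def)

lemma winv_in_words [simp]: "winv w \<in> words X \<longleftrightarrow> w \<in> words X"
  by (induction w) (auto simp: conj_commute)

context group
begin

lemma inv_cancel_left [simp]: "x \<in> carrier G \<Longrightarrow> y \<in> carrier G \<Longrightarrow> inv x \<otimes> (x \<otimes> y) = y"
  by (simp flip: m_assoc)

lemma cancel_inv_left [simp]: "x \<in> carrier G \<Longrightarrow> y \<in> carrier G \<Longrightarrow> x \<otimes> (inv x \<otimes> y) = y"
  by (simp flip: m_assoc)

lemma word_eval_closed:
  assumes "f ` X \<subseteq> carrier G" and "w \<in> words X"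
  shows "word_eval G f w \<in> carrier G"
  using assms(2) by (induction w) (use assms(1) in \<open>auto simp: word_eval_def\<close>)

lemma word_eval_Nil [simp]: "word_eval G f [] = \<one>"
  by (simp add: word_eval_def)

lemma word_eval_Cons [simp]:
  "word_eval G f ((x, b) # w) = (if b then f x else inv (f x)) \<otimes> word_eval G f w"
  by (simp add: word_eval_def)

lemma word_eval_append:
  assumes "f ` X \<subseteq> carrier G" and "u \<in> words X" and "v \<in> words X"
  shows "word_eval G f (u @ v) = word_eval G f u \<otimes> word_eval G f v"
  using assms(2)
proof (induction u)
  case Nil
  then show ?case using word_eval_closed[OF assms(1,3)] by simp
next
  case (Cons p u)
  obtain x b where p: "p = (x, b)" by (cases p)
  have "f x \<in> carrier G" "word_eval G f u \<in> carrier G" "word_eval G f v \<in> carrier G"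
    using Cons.prems assms word_eval_closed[OF assms(1)] p by auto
  then show ?case using Cons p by (simp add: m_assoc)
qed

end

lemma word_eval_hom:
  assumes "group_hom K L h" and "f ` X \<subseteq> carrier K" and "w \<in> words X"
  shows "h (word_eval K f w) = word_eval L (h \<circ> f) w"
proof -
  interpret group_hom K L h by fact
  show ?thesis
    using assms(3)
  proof (induction w)
    case Nil
    then show ?case by simp
  next
    case (Cons p w)
    obtain x b where p: "p = (x, b)" by (cases p)
    have "f x \<in> carrier K" "word_eval K f w \<in> carrier K"
      using Cons.prems assms G.word_eval_closed[OF assms(2)] p by auto
    then show ?case using Cons p by simp
  qed
qed

text \<open>A presentation whose relators are words in its generators.\<close>

locale presentation =
  fixes X :: "'x set" and R :: "'x word set"
  assumes relators: "R \<subseteq> words X"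
begin

text \<open>The element of the presented group that a word represents.\<close>

definition cls :: "'x word \<Rightarrow> 'x word set" where
  "cls w = pres_rel X R `` {w}"

lemma pres_rel_words: "(u, v) \<in> pres_rel X R \<Longrightarrow> u \<in> words X \<and> v \<in> words X"
  by (induction rule: pres_rel.induct) (use relators in auto)

lemma equiv_pres_rel: "equiv (words X) (pres_rel X R)"
  by (rule equivI)
    (auto simp: refl_on_def sym_def trans_def dest: pres_rel_words intro: pres_rel.intros)

lemma pres_rel_context:
  assumes "(u, v) \<in> pres_rel X R" and "a \<in> words X" and "b \<in> words X"
  shows "(a @ u @ b, a @ v @ b) \<in> pres_rel X R"
  using assms
proof (induction rule: pres_rel.induct)
  case (refl w)
  then show ?case by (simp add: pres_rel.refl)
next
  case (sym u v)
  then show ?case by (blast intro: pres_rel.sym)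
next
  case (trans u v w)
  then show ?case by (blast intro: pres_rel.trans)
next
  case (cancel u v x c)
  then show ?case using pres_rel.cancel[of "a @ u" X "v @ b" x c R] by simp
next
  case (relator u v r)
  then show ?case using pres_rel.relator[of "a @ u" X "v @ b" r R] by simp
qed

lemma pres_rel_append:
  assumes "(u, u') \<in> pres_rel X R" and "(v, v') \<in> pres_rel X R"
  shows "(u @ v, u' @ v') \<in> pres_rel X R"
  using pres_rel_context[OF assms(1), of "[]" v] pres_rel_context[OF assms(2), of u' "[]"]
    pres_rel_words[OF assms(1)] pres_rel_words[OF assms(2)]
  by (auto intro: pres_rel.trans)

lemma cls_eq_iff: "u \<in> words X \<Longrightarrow> v \<in> words X \<Longrightarrow> cls u = cls v \<longleftrightarrow> (u, v) \<in> pres_rel X R"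
  unfolding cls_def using eq_equiv_class_iff[OF equiv_pres_rel] by blast

lemma in_cls: "w \<in> words X \<Longrightarrow> w \<in> cls w"
  by (simp add: cls_def pres_rel.refl)

lemma carrier_presented: "carrier (presented_group X R) = cls ` words X"
  by (auto simp: presented_group_def cls_def quotient_def)

lemma one_presented: "\<one>\<^bsub>presented_group X R\<^esub> = cls []"
  by (simp add: presented_group_def cls_def)

lemma mult_presented:
  assumes "u \<in> words X" and "v \<in> words X"
  shows "cls u \<otimes>\<^bsub>presented_group X R\<^esub> cls v = cls (u @ v)"
proof -
  have "pres_rel X R `` {a @ b} = cls (u @ v)" if "a \<in> cls u" "b \<in> cls v" for a b
    using that pres_rel_append[of u a v b] pres_rel_words[of u a] pres_rel_words[of v b] assms
      cls_eq_iff[of "u @ v" "a @ b"] by (auto simp: cls_def)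
  then have "(\<Union>a\<in>cls u. \<Union>b\<in>cls v. pres_rel X R `` {a @ b}) = (\<Union>a\<in>cls u. \<Union>b\<in>cls v. cls (u @ v))"
    by simp
  moreover have "cls u \<noteq> {}" "cls v \<noteq> {}" using in_cls assms by blast+
  ultimately show ?thesis by (simp add: presented_group_def)
qed

lemma pres_rel_winv: "w \<in> words X \<Longrightarrow> (winv w @ w, []) \<in> pres_rel X R"
proof (induction w)
  case Nil
  then show ?case by (simp add: pres_rel.refl)
next
  case (Cons p w)
  obtain x b where p: "p = (x, b)" by (cases p)
  have "(winv w @ [(x, \<not> b), (x, \<not> \<not> b)] @ w, winv w @ w) \<in> pres_rel X R"
    using Cons.prems p by (intro pres_rel.cancel) auto
  then show ?case using Cons p by (auto intro: pres_rel.trans)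
qed

lemma group_presented: "group (presented_group X R)" (is "group ?P")
proof (rule groupI)
  fix x assume "x \<in> carrier ?P"
  then obtain w where w: "w \<in> words X" "x = cls w"
    by (auto simp: carrier_presented)
  show "\<one>\<^bsub>?P\<^esub> \<otimes>\<^bsub>?P\<^esub> x = x"
    using w by (simp add: one_presented mult_presented)
  show "\<exists>y\<in>carrier ?P. y \<otimes>\<^bsub>?P\<^esub> x = \<one>\<^bsub>?P\<^esub>"
    by (rule bexI[of _ "cls (winv w)"])
      (use w in \<open>simp_all add: one_presented mult_presented carrier_presented cls_eq_iff pres_rel_winv\<close>)
qed (auto simp: carrier_presented one_presented mult_presented)

lemma pres_gen_cls: "pres_gen X R x = cls [(x, True)]"
  by (simp add: pres_gen_def cls_def)

lemma pres_gen_closed: "pres_gen X R ` X \<subseteq> carrier (presented_group X R)"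
  by (auto simp: pres_gen_cls carrier_presented)

lemma word_eval_pres_gen:
  assumes "w \<in> words X"
  shows "word_eval (presented_group X R) (pres_gen X R) w = cls w"
proof -
  interpret P: group "presented_group X R" by (rule group_presented)
  show ?thesis
    using assms
  proof (induction w)
    case Nil
    then show ?case by (simp add: one_presented)
  next
    case (Cons p w)
    obtain x b where p: "p = (x, b)" by (cases p)
    have x: "x \<in> X" "w \<in> words X" using Cons.prems p by auto
    have "([(x, False)] @ [(x, True)], []) \<in> pres_rel X R"
      using pres_rel_winv[of "[(x, True)]"] x by simp
    then have "cls [(x, False)] \<otimes>\<^bsub>presented_group X R\<^esub> cls [(x, True)] = \<one>\<^bsub>presented_group X R\<^esub>"
      using x by (simp add: mult_presented one_presented cls_eq_iff)
    then have "inv\<^bsub>presented_group X R\<^esub> (cls [(x, True)]) = cls [(x, False)]"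
      using x by (intro P.inv_equality) (auto simp: carrier_presented)
    then show ?case using Cons x p by (simp add: pres_gen_cls mult_presented)
  qed
qed

lemma word_eval_relator:
  assumes "r \<in> R"
  shows "word_eval (presented_group X R) (pres_gen X R) r = \<one>\<^bsub>presented_group X R\<^esub>"
proof -
  have r: "r \<in> words X" using assms relators by blast
  have "(r, []) \<in> pres_rel X R" using pres_rel.relator[of "[]" X "[]" r R] assms by simp
  then show ?thesis using r by (simp add: word_eval_pres_gen one_presented cls_eq_iff)
qed

lemma presented_generate:
  "carrier (presented_group X R) = generate (presented_group X R) (pres_gen X R ` X)"
  (is "carrier ?P = ?E")
proof
  interpret P: group ?P by (rule group_presented)
  show "?E \<subseteq> carrier ?P"
    using P.generate_incl[OF pres_gen_closed] .
  have "word_eval ?P (pres_gen X R) w \<in> ?E" if "w \<in> words X" for w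
    using that
  proof (induction w)
    case Nil
    then show ?case by (simp add: generate.one)
  next
    case (Cons p w)
    then show ?case
      by (cases p) (auto intro!: generate.eng intro: generate.incl generate.inv)
  qed
  then show "carrier ?P \<subseteq> ?E"
    by (auto simp: carrier_presented word_eval_pres_gen)
qed

context
  fixes K :: "('k, 'm) monoid_scheme" and f :: "'x \<Rightarrow> 'k"
  assumes K: "group K" and f: "f ` X \<subseteq> carrier K"
    and f_relators: "\<And>r. r \<in> R \<Longrightarrow> word_eval K f r = \<one>\<^bsub>K\<^esub>"
begin

lemma word_eval_pres_rel:
  assumes "(u, v) \<in> pres_rel X R"
  shows "word_eval K f u = word_eval K f v"
proof -
  interpret group K by (rule K)
  note [simp] = word_eval_append[OF f] word_eval_closed[OF f]
  have fx: "f x \<in> carrier K" if "x \<in> X" for x using f that by auto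
  show ?thesis
    using assms
  proof (induction rule: pres_rel.induct)
    case (cancel u v x b)
    then have "word_eval K f (u @ ([(x, b), (x, \<not> b)] @ v)) =
        word_eval K f u \<otimes>\<^bsub>K\<^esub> (word_eval K f [(x, b), (x, \<not> b)] \<otimes>\<^bsub>K\<^esub> word_eval K f v)"
      by (subst word_eval_append[OF f], simp, simp, subst word_eval_append[OF f]) simp_all
    then show ?case using cancel fx[of x] by (cases b) simp_all
  next
    case (relator u v r)
    then show ?case using f_relators[of r] relators by (simp add: subset_iff)
  qed auto
qed

lemma pres_hom_cls:
  assumes "w \<in> words X"
  shows "pres_hom K f (cls w) = word_eval K f w"
proof -
  have "word_eval K f ` cls w = {word_eval K f w}"
  proof
    show "word_eval K f ` cls w \<subseteq> {word_eval K f w}"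
    proof
      fix k assume "k \<in> word_eval K f ` cls w"
      then obtain v where "(w, v) \<in> pres_rel X R" "k = word_eval K f v"
        by (auto simp: cls_def)
      then show "k \<in> {word_eval K f w}"
        using word_eval_pres_rel[of w v] by simp
    qed
  qed (use in_cls[OF assms] in auto)
  then show ?thesis by (simp add: pres_hom_def)
qed

lemma pres_hom_hom: "pres_hom K f \<in> hom (presented_group X R) K"
proof -
  interpret group K by (rule K)
  show ?thesis
    by (rule homI)
      (auto simp: carrier_presented mult_presented pres_hom_cls word_eval_append[OF f]
        word_eval_closed[OF f])
qed

lemma pres_hom_pres_gen:
  assumes "x \<in> X"
  shows "pres_hom K f (pres_gen X R x) = f x"
proof -
  interpret group K by (rule K)
  show ?thesis using assms f by (auto simp: pres_gen_cls pres_hom_cls)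
qed

end

end


section \<open>Conjugates and commutators\<close>

context group
begin

lemma conj_elem_closed [simp]: "x \<in> carrier G \<Longrightarrow> c \<in> carrier G \<Longrightarrow> conj_elem G x c \<in> carrier G"
  by (simp add: conj_elem_def)

lemma comm_elem_closed [simp]: "x \<in> carrier G \<Longrightarrow> y \<in> carrier G \<Longrightarrow> comm_elem G x y \<in> carrier G"
  by (simp add: comm_elem_def)

lemma conj_elem_mult:
  "x \<in> carrier G \<Longrightarrow> y \<in> carrier G \<Longrightarrow> c \<in> carrier G \<Longrightarrow>
    conj_elem G (x \<otimes> y) c = conj_elem G x c \<otimes> conj_elem G y c"
  by (simp add: conj_elem_def m_assoc)

lemma conj_elem_inv:
  "x \<in> carrier G \<Longrightarrow> c \<in> carrier G \<Longrightarrow> conj_elem G (inv x) c = inv (conj_elem G x c)"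
  by (simp add: conj_elem_def m_assoc inv_mult_group)

lemma conj_elem_comm_elem:
  "x \<in> carrier G \<Longrightarrow> y \<in> carrier G \<Longrightarrow> c \<in> carrier G \<Longrightarrow>
    conj_elem G (comm_elem G x y) c = comm_elem G (conj_elem G x c) (conj_elem G y c)"
  by (simp add: conj_elem_def comm_elem_def m_assoc inv_mult_group)

lemma conj_elem_conj_elem:
  "x \<in> carrier G \<Longrightarrow> c \<in> carrier G \<Longrightarrow> d \<in> carrier G \<Longrightarrow>
    conj_elem G (conj_elem G x c) d = conj_elem G x (c \<otimes> d)"
  by (simp add: conj_elem_def m_assoc inv_mult_group)

lemma comm_elem_mult_left:
  "x \<in> carrier G \<Longrightarrow> y \<in> carrier G \<Longrightarrow> c \<in> carrier G \<Longrightarrow>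
    comm_elem G (x \<otimes> y) c = conj_elem G (comm_elem G x c) y \<otimes> comm_elem G y c"
  by (simp add: conj_elem_def comm_elem_def m_assoc inv_mult_group)

lemma comm_elem_inv_left:
  "x \<in> carrier G \<Longrightarrow> c \<in> carrier G \<Longrightarrow>
    comm_elem G (inv x) c = conj_elem G (inv (comm_elem G x c)) (inv x)"
  by (simp add: conj_elem_def comm_elem_def m_assoc inv_mult_group)

lemma normal_conj_elem:
  assumes "N \<lhd> G" and "x \<in> N" and "c \<in> carrier G"
  shows "conj_elem G x c \<in> N"
  using normal.inv_op_closed1[OF assms(1,3,2)] by (simp add: conj_elem_def)

lemma conj_elem_eq_iff:
  "x \<in> carrier G \<Longrightarrow> c \<in> carrier G \<Longrightarrow> conj_elem G x c = x \<longleftrightarrow> x \<otimes> c = c \<otimes> x"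
  by (simp add: conj_elem_def m_assoc) (metis inv_cancel_left cancel_inv_left m_closed)

lemma comm_elem_eq_one_iff:
  "x \<in> carrier G \<Longrightarrow> c \<in> carrier G \<Longrightarrow> comm_elem G x c = \<one> \<longleftrightarrow> x \<otimes> c = c \<otimes> x"
  by (simp add: comm_elem_def m_assoc)
    (metis inv_cancel_left cancel_inv_left m_closed r_inv inv_closed r_one)

end

context group_hom
begin

lemma hom_conj_elem: "x \<in> carrier G \<Longrightarrow> c \<in> carrier G \<Longrightarrow> h (conj_elem G x c) = conj_elem H (h x) (h c)"
  by (simp add: conj_elem_def)

lemma hom_comm_elem: "x \<in> carrier G \<Longrightarrow> c \<in> carrier G \<Longrightarrow> h (comm_elem G x c) = comm_elem H (h x) (h c)"
  by (simp add: comm_elem_def)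

end


section \<open>Groups generated by two images of a group\<close>

text \<open>The group \<open>K\<close> is generated by the images of \<open>G\<close> under the homomorphisms \<open>a\<close> and \<open>b\<close>.  This covers
  \<open>X(G)\<close> as well as \<open>\<nu>(G)\<close>.\<close>

locale double_image = K?: group K + G?: group G for K (structure) and G (structure) +
  fixes a b
  assumes a_hom: "a \<in> hom G K" and b_hom: "b \<in> hom G K"
    and generated: "carrier K = generate K (a ` carrier G \<union> b ` carrier G)"
begin

sublocale a: group_hom G K a
  by unfold_locales (rule a_hom)

sublocale b: group_hom G K b
  by unfold_locales (rule b_hom)

text \<open>Inverses need no case of their own, because the two images of \<open>G\<close> are closed under them.\<close>

lemma double_induct [consumes 1, case_names one a b mult]:
  assumes "x \<in> carrier K" and "P \<one>" and "\<And>g. g \<in> carrier G \<Longrightarrow> P (a g)"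
    and "\<And>g. g \<in> carrier G \<Longrightarrow> P (b g)"
    and "\<And>x y. x \<in> carrier K \<Longrightarrow> y \<in> carrier K \<Longrightarrow> P x \<Longrightarrow> P y \<Longrightarrow> P (x \<otimes> y)"
  shows "P x"
proof -
  have "x \<in> generate K (a ` carrier G \<union> b ` carrier G)" using assms(1) generated by simp
  then have "x \<in> carrier K \<and> P x"
  proof (induction rule: generate.induct)
    case (incl h)
    then show ?case using assms(3,4) by auto
  next
    case (inv h)
    then show ?case using assms(3,4) by (auto simp flip: a.hom_inv b.hom_inv)
  qed (use assms in auto)
  then show ?thesis ..
qed

lemma normal_generate:
  assumes "S \<subseteq> carrier K"
    and a: "\<And>s g. s \<in> S \<Longrightarrow> g \<in> carrier G \<Longrightarrow> conj_elem K s (a g) \<in> generate K S"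
    and b: "\<And>s g. s \<in> S \<Longrightarrow> g \<in> carrier G \<Longrightarrow> conj_elem K s (b g) \<in> generate K S"
  shows "generate K S \<lhd> K"
proof -
  let ?N = "generate K S"
  have sub: "subgroup ?N K" using K.generate_is_subgroup[OF assms(1)] .
  note in_K = K.generate_in_carrier[OF assms(1)]
  have extend: "conj_elem K t c \<in> ?N"
    if "t \<in> ?N" "c \<in> carrier K" "\<And>s. s \<in> S \<Longrightarrow> conj_elem K s c \<in> ?N" for t c
    using that(1)
  proof (induction rule: generate.induct)
    case one
    then show ?case using that(2) by (simp add: conj_elem_def generate.one)
  next
    case (inv h)
    then show ?case using that(2) that(3)[of h] assms(1)
      by (subst K.conj_elem_inv) (auto intro: subgroup.m_inv_closed[OF sub])
  next
    case (eng h1 h2)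
    then show ?case using that(2) in_K by (simp add: K.conj_elem_mult generate.eng)
  qed (use that(3) in auto)
  have conj: "\<forall>t\<in>?N. conj_elem K t c \<in> ?N" if "c \<in> carrier K" for c
    using that
  proof (induction rule: double_induct)
    case one
    then show ?case using in_K by (simp add: conj_elem_def)
  next
    case (mult x y)
    then show ?case using in_K by (simp flip: K.conj_elem_conj_elem)
  qed (use extend a b in auto)
  show ?thesis
  proof (rule K.normal_invI[OF sub])
    fix x h assume "x \<in> carrier K" "h \<in> ?N"
    then show "x \<otimes> h \<otimes> inv x \<in> ?N"
      using conj[of "inv x"] by (simp add: conj_elem_def)
  qed
qed

text \<open>The subgroup that has to be divided out in order to identify the two images.\<close>

definition diff_subgroup where
  "diff_subgroup = generate K {inv (b g) \<otimes> a g | g. g \<in> carrier G}"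

text \<open>The subgroup that has to be divided out in order to make the two images commute.\<close>

definition cross_subgroup where
  "cross_subgroup = generate K {comm_elem K (a g) (b h) | g h. g \<in> carrier G \<and> h \<in> carrier G}"

lemma diff_in: "g \<in> carrier G \<Longrightarrow> inv (b g) \<otimes> a g \<in> diff_subgroup"
  unfolding diff_subgroup_def by (rule generate.incl) blast

lemma cross_in: "g \<in> carrier G \<Longrightarrow> h \<in> carrier G \<Longrightarrow> comm_elem K (a g) (b h) \<in> cross_subgroup"
  unfolding cross_subgroup_def by (rule generate.incl) blast

lemma diff_normal: "diff_subgroup \<lhd> K"
proof -
  let ?l = "\<lambda>g. inv (b g) \<otimes> a g"
  have sub: "subgroup diff_subgroup K"
    unfolding diff_subgroup_def by (rule K.generate_is_subgroup) auto
  have "conj_elem K (?l g) (a h) \<in> diff_subgroup" "conj_elem K (?l g) (b h) \<in> diff_subgroup"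
    if "g \<in> carrier G" "h \<in> carrier G" for g h
  proof -
    have "conj_elem K (?l g) (a h) = inv (?l h) \<otimes> ?l (g \<otimes>\<^bsub>G\<^esub> h)"
      "conj_elem K (?l g) (b h) = ?l (g \<otimes>\<^bsub>G\<^esub> h) \<otimes> inv (?l h)"
      using that by (simp_all add: conj_elem_def K.m_assoc K.inv_mult_group)
    then show "conj_elem K (?l g) (a h) \<in> diff_subgroup" "conj_elem K (?l g) (b h) \<in> diff_subgroup"
      using that diff_in subgroup.m_closed[OF sub] subgroup.m_inv_closed[OF sub]
      by (simp_all del: a.hom_mult b.hom_mult)
  qed
  then show ?thesis
    unfolding diff_subgroup_def by (intro normal_generate) auto
qed

lemma cross_normal: "cross_subgroup \<lhd> K"
proof -
  let ?c = "\<lambda>g h. comm_elem K (a g) (b h)"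
  have sub: "subgroup cross_subgroup K"
    unfolding cross_subgroup_def by (rule K.generate_is_subgroup) auto
  have "conj_elem K (?c g h) (a k) \<in> cross_subgroup" "conj_elem K (?c g h) (b k) \<in> cross_subgroup"
    if "g \<in> carrier G" "h \<in> carrier G" "k \<in> carrier G" for g h k
  proof -
    have "conj_elem K (?c g h) (a k) = ?c (g \<otimes>\<^bsub>G\<^esub> k) h \<otimes> inv (?c k h)"
      "conj_elem K (?c g h) (b k) = inv (?c g k) \<otimes> ?c g (h \<otimes>\<^bsub>G\<^esub> k)"
      using that by (simp_all add: conj_elem_def comm_elem_def K.m_assoc K.inv_mult_group)
    then show "conj_elem K (?c g h) (a k) \<in> cross_subgroup" "conj_elem K (?c g h) (b k) \<in> cross_subgroup"
      using that cross_in subgroup.m_closed[OF sub] subgroup.m_inv_closed[OF sub]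
      by (simp_all del: a.hom_mult b.hom_mult)
  qed
  then show ?thesis
    unfolding cross_subgroup_def by (intro normal_generate) auto
qed

lemma cross_carrier: "t \<in> cross_subgroup \<Longrightarrow> t \<in> carrier K"
  using normal_imp_subgroup[OF cross_normal] by (auto dest: subgroup.mem_carrier)

lemma cross_closed:
  "s \<in> cross_subgroup \<Longrightarrow> t \<in> cross_subgroup \<Longrightarrow> s \<otimes> t \<in> cross_subgroup"
  "t \<in> cross_subgroup \<Longrightarrow> inv t \<in> cross_subgroup"
  "t \<in> cross_subgroup \<Longrightarrow> c \<in> carrier K \<Longrightarrow> conj_elem K t c \<in> cross_subgroup"
  using normal_imp_subgroup[OF cross_normal] K.normal_conj_elem[OF cross_normal]
  by (auto intro: subgroup.m_closed subgroup.m_inv_closed)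

text \<open>The values of the relators of \<open>\<nu>(G)\<close> lie in both normal subgroups: in \<open>cross_subgroup\<close> as
  products of conjugates of its generators and their inverses, and in \<open>diff_subgroup\<close> because modulo this subgroup \<open>b\<close>
  can be replaced by \<open>a\<close>, where the relation holds as conjugation is an automorphism.\<close>

lemma nu_relation_in_both:
  assumes "x \<in> carrier G" and "y \<in> carrier G" and "z \<in> carrier G"
  defines "u \<equiv> comm_elem K (a (conj_elem G x z)) (b (conj_elem G y z))"
  shows "conj_elem K (comm_elem K (a x) (b y)) (a z) \<otimes> inv u \<in> diff_subgroup \<inter> cross_subgroup"
    and "u \<otimes> inv (conj_elem K (comm_elem K (a x) (b y)) (b z)) \<in> diff_subgroup \<inter> cross_subgroup"
proof -
  let ?Q = "K Mod diff_subgroup" and ?q = "\<lambda>k. diff_subgroup #> k"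
  interpret N: normal diff_subgroup K by (rule diff_normal)
  interpret q: group_hom K ?Q ?q
    using N.r_coset_hom_Mod N.factorgroup_is_group
    by (auto intro!: group_hom.intro group_hom_axioms.intro)
  have ab: "?q (b g) = ?q (a g)" if "g \<in> carrier G" for g
  proof -
    have "?q (inv (b g) \<otimes> a g) = \<one>\<^bsub>?Q\<^esub>"
      using N.rcos_const[OF K.is_group diff_in[OF that]] by simp
    then have "?q (b g) \<otimes>\<^bsub>?Q\<^esub> (?q (inv (b g) \<otimes> a g)) = ?q (b g)"
      using that q.hom_closed[of "b g"] by (simp del: one_FactGroup mult_FactGroup q.hom_mult)
    then show ?thesis using that by (simp del: one_FactGroup mult_FactGroup flip: q.hom_mult)
  qed
  have in_diff: "k \<in> diff_subgroup" if "k \<in> carrier K" "?q k = \<one>\<^bsub>?Q\<^esub>" for k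
    using that K.rcos_self[OF _ N.subgroup_axioms, of k] by simp
  note [simp del] = one_FactGroup mult_FactGroup
  note [simp] = a.hom_conj_elem b.hom_conj_elem q.hom_conj_elem q.hom_comm_elem ab
    conj_elem_comm_elem q.H.conj_elem_comm_elem
  have c: "a x \<in> carrier K" "b x \<in> carrier K" "a y \<in> carrier K" "b y \<in> carrier K"
      "a z \<in> carrier K" "b z \<in> carrier K"
    using assms by auto
  have "?q u = ?q (conj_elem K (comm_elem K (a x) (b y)) (a z))"
       "?q u = ?q (conj_elem K (comm_elem K (a x) (b y)) (b z))"
    using assms(1-3) c unfolding u_def by simp_all
  moreover have "u \<in> cross_subgroup" "conj_elem K (comm_elem K (a x) (b y)) (a z) \<in> cross_subgroup"
      "conj_elem K (comm_elem K (a x) (b y)) (b z) \<in> cross_subgroup"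
    unfolding u_def using assms(1-3) c by (blast intro: cross_in cross_closed(3) conj_elem_closed)+
  ultimately show "conj_elem K (comm_elem K (a x) (b y)) (a z) \<otimes> inv u \<in> diff_subgroup \<inter> cross_subgroup"
    "u \<otimes> inv (conj_elem K (comm_elem K (a x) (b y)) (b z)) \<in> diff_subgroup \<inter> cross_subgroup"
    using cross_closed cross_carrier by (auto intro!: in_diff simp del: conj_elem_comm_elem q.hom_conj_elem)
qed

text \<open>Here \<open>q\<close> is a projection to \<open>G \<times> G\<close> that separates the two images.\<close>

lemma cross_decomposition:
  assumes "group_hom K (G \<times>\<times> G) q"
    and qa: "\<And>g. g \<in> carrier G \<Longrightarrow> q (a g) = (g, \<one>\<^bsub>G\<^esub>)"
    and qb: "\<And>g. g \<in> carrier G \<Longrightarrow> q (b g) = (\<one>\<^bsub>G\<^esub>, g)"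
    and "x \<in> carrier K"
  shows "\<exists>t\<in>cross_subgroup. x = a (fst (q x)) \<otimes> b (snd (q x)) \<otimes> t"
  using assms(4)
proof (induction rule: double_induct)
  interpret q: group_hom K "G \<times>\<times> G" q by fact
  have one: "\<one> \<in> cross_subgroup"
    using cross_normal by (simp add: normal_imp_subgroup subgroup.one_closed)
  case one
  then show ?case using \<open>\<one> \<in> cross_subgroup\<close> by (intro bexI[of _ \<one>]) (use q.hom_one in simp_all)
next
  have one: "\<one> \<in> cross_subgroup"
    using cross_normal by (simp add: normal_imp_subgroup subgroup.one_closed)
  case (a g)
  then show ?case using one by (intro bexI[of _ \<one>]) (simp_all add: qa)
next
  have one: "\<one> \<in> cross_subgroup"
    using cross_normal by (simp add: normal_imp_subgroup subgroup.one_closed)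
  case (b g)
  then show ?case using one by (intro bexI[of _ \<one>]) (simp_all add: qb)
next
  interpret q: group_hom K "G \<times>\<times> G" q by fact
  case (mult x y)
  from mult obtain t s where t: "t \<in> cross_subgroup" "x = a (fst (q x)) \<otimes> b (snd (q x)) \<otimes> t"
    and s: "s \<in> cross_subgroup" "y = a (fst (q y)) \<otimes> b (snd (q y)) \<otimes> s" by blast
  obtain g h where gh: "q x = (g, h)" "g \<in> carrier G" "h \<in> carrier G"
    using q.hom_closed[OF mult(1)] by (cases "q x") auto
  obtain g' h' where gh': "q y = (g', h')" "g' \<in> carrier G" "h' \<in> carrier G"
    using q.hom_closed[OF mult(2)] by (cases "q y") auto
  let ?r = "conj_elem K (inv (comm_elem K (a g') (b h)) \<otimes> conj_elem K t (a g')) (b h') \<otimes> s"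
  have "?r \<in> cross_subgroup"
    using s t gh gh' by (intro cross_closed cross_in) auto
  moreover have "x \<otimes> y = a (g \<otimes>\<^bsub>G\<^esub> g') \<otimes> b (h \<otimes>\<^bsub>G\<^esub> h') \<otimes> ?r"
  proof -
    have x: "x = a g \<otimes> b h \<otimes> t" and y: "y = a g' \<otimes> b h' \<otimes> s"
      using s t gh gh' by simp_all
    show ?thesis
      unfolding x y using cross_carrier[OF s(1)] cross_carrier[OF t(1)] gh gh'
      by (simp add: conj_elem_def comm_elem_def K.m_assoc K.inv_mult_group)
  qed
  moreover have "q (x \<otimes> y) = (g \<otimes>\<^bsub>G\<^esub> g', h \<otimes>\<^bsub>G\<^esub> h')"
    using mult gh gh' by simp
  ultimately show ?case by auto
qed

lemma cross_induct [consumes 1, case_names one comm inv mult]: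
  assumes "t \<in> cross_subgroup" and "P \<one>"
    and "\<And>g h. g \<in> carrier G \<Longrightarrow> h \<in> carrier G \<Longrightarrow> P (comm_elem K (a g) (b h))"
    and "\<And>t. t \<in> cross_subgroup \<Longrightarrow> P t \<Longrightarrow> P (inv t)"
    and "\<And>s t. s \<in> cross_subgroup \<Longrightarrow> t \<in> cross_subgroup \<Longrightarrow> P s \<Longrightarrow> P t \<Longrightarrow> P (s \<otimes> t)"
  shows "P t"
proof -
  have "t \<in> cross_subgroup \<and> P t"
    using assms(1)[unfolded cross_subgroup_def]
  proof (induction rule: generate.induct)
    case one
    then show ?case using assms(2) by (simp add: cross_subgroup_def generate.one)
  next
    case (incl h)
    then show ?case using assms(3) cross_in by auto
  next
    case (inv h)
    then show ?case using assms(3,4) cross_in cross_closed by auto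
  next
    case (eng s t)
    then show ?case using assms(5) cross_closed by auto
  qed
  then show ?thesis ..
qed

lemma additive_cross_eq_0:
  fixes \<chi> :: "_ \<Rightarrow> real"
  assumes \<chi>: "\<And>x y. x \<in> carrier K \<Longrightarrow> y \<in> carrier K \<Longrightarrow> \<chi> (x \<otimes> y) = \<chi> x + \<chi> y"
    and "t \<in> cross_subgroup"
  shows "\<chi> t = 0"
proof -
  have one: "\<chi> \<one> = 0" using \<chi>[of \<one> \<one>] by simp
  have inv: "\<chi> (inv x) = - \<chi> x" if "x \<in> carrier K" for x
    using \<chi>[of "inv x" x] that one by simp
  show ?thesis
    using assms(2)
    by (induction rule: cross_induct) (auto simp: one inv \<chi> cross_carrier comm_elem_def)
qed

end


section \<open>Centrality of the kernel\<close>

text \<open>The situation in \<open>\<nu>(G)\<close>: the two images satisfy the conjugation relations, \<open>p\<close> is the projection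
  to \<open>G\<close> that identifies the two copies, and \<open>q\<close> is the one to \<open>G \<times> G\<close> that separates them.\<close>

locale nu_like = double_image +
  fixes p q
  assumes p_hom: "group_hom K G p" and q_hom: "group_hom K (G \<times>\<times> G) q"
    and pa: "\<And>g. g \<in> carrier G \<Longrightarrow> p (a g) = g"
    and pb: "\<And>g. g \<in> carrier G \<Longrightarrow> p (b g) = g"
    and qa: "\<And>g. g \<in> carrier G \<Longrightarrow> q (a g) = (g, \<one>\<^bsub>G\<^esub>)"
    and qb: "\<And>g. g \<in> carrier G \<Longrightarrow> q (b g) = (\<one>\<^bsub>G\<^esub>, g)"
    and conj_a: "\<And>x y z. x \<in> carrier G \<Longrightarrow> y \<in> carrier G \<Longrightarrow> z \<in> carrier G \<Longrightarrow>
      conj_elem K (comm_elem K (a x) (b y)) (a z) =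
      comm_elem K (a (conj_elem G x z)) (b (conj_elem G y z))"
    and conj_b: "\<And>x y z. x \<in> carrier G \<Longrightarrow> y \<in> carrier G \<Longrightarrow> z \<in> carrier G \<Longrightarrow>
      conj_elem K (comm_elem K (a x) (b y)) (b z) =
      comm_elem K (a (conj_elem G x z)) (b (conj_elem G y z))"
begin

sublocale p: group_hom K G p by (rule p_hom)
sublocale q: group_hom K "G \<times>\<times> G" q by (rule q_hom)

lemma conj_cross_a_eq_b:
  assumes "t \<in> cross_subgroup" and "z \<in> carrier G"
  shows "conj_elem K t (a z) = conj_elem K t (b z)"
  using assms(1)
proof (induction rule: cross_induct)
  case one
  then show ?case using assms(2) by (simp add: conj_elem_def)
qed (use assms(2) in \<open>simp_all add: conj_a conj_b K.conj_elem_inv K.conj_elem_mult cross_carrier\<close>)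

text \<open>Every element of \<open>K\<close> acts on \<open>[G, G']\<close> like its image in \<open>G\<close>.\<close>

lemma conj_cross:
  assumes "u \<in> carrier K" and "t \<in> cross_subgroup"
  shows "conj_elem K t u = conj_elem K t (a (p u))"
  using assms
proof (induction arbitrary: t rule: double_induct)
  case (mult x y)
  then show ?case
    using cross_closed(3)[of t "a (p x)"]
    by (simp add: cross_carrier flip: K.conj_elem_conj_elem)
qed (simp_all add: pa pb conj_cross_a_eq_b)

text \<open>Both sides of \<open>[[x, y'], c'] = [[x, y], c']\<close> are compared by expanding the right-hand side for
  \<open>[x, y] = x\<^sup>-\<^sup>1 x\<^sup>y\<close>.  In the factor \<open>[x\<^sup>y, c']\<close> the conjugation by \<open>y\<close> is replaced by that by \<open>y'\<close>, which
  turns \<open>x\<close> into \<open>x t\<close> with \<open>t = [x, y']\<close>.\<close>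

lemma comm_comm:
  assumes x: "x \<in> carrier G" and y: "y \<in> carrier G" and c: "c \<in> carrier G"
  shows "comm_elem K (comm_elem K (a x) (b y)) (b c) = comm_elem K (a (comm_elem G x y)) (b c)"
proof -
  define t where "t = comm_elem K (a x) (b y)"
  define A where "A = comm_elem K (a x) (b c)"
  have t: "t \<in> cross_subgroup" and A: "A \<in> cross_subgroup"
    unfolding t_def A_def using assms cross_in by auto
  note [simp] = cross_carrier[OF t] cross_carrier[OF A]
  have pt: "p t = comm_elem G x y"
    using x y by (simp add: t_def p.hom_comm_elem pa pb)
  let ?xy = "conj_elem G x y"
  \<comment> \<open>the conjugate of \<open>c\<close> that becomes \<open>c\<close> after conjugation by \<open>y\<close>\<close>
  define c' where "c' = y \<otimes>\<^bsub>G\<^esub> c \<otimes>\<^bsub>G\<^esub> inv\<^bsub>G\<^esub> y"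
  have c': "c' \<in> carrier G" "conj_elem G c' y = c"
    using c y by (simp_all add: c'_def conj_elem_def G.m_assoc)
  have "comm_elem K (a (inv\<^bsub>G\<^esub> x)) (b c) = conj_elem K (inv A) (inv (a x))"
    using x c by (simp add: A_def K.comm_elem_inv_left)
  then have "conj_elem K (comm_elem K (a (inv\<^bsub>G\<^esub> x)) (b c)) (a ?xy) =
      conj_elem K (inv A) (inv (a x) \<otimes> a ?xy)"
    using x y by (simp add: K.conj_elem_conj_elem)
  also have "inv (a x) \<otimes> a ?xy = a (comm_elem G x y)"
    using x y by (simp add: conj_elem_def comm_elem_def K.m_assoc)
  also have "conj_elem K (inv A) \<dots> = conj_elem K (inv A) t"
    using conj_cross[of t "inv A"] cross_closed(2)[OF A] pt by simp
  finally have 1: "conj_elem K (comm_elem K (a (inv\<^bsub>G\<^esub> x)) (b c)) (a ?xy) = inv (conj_elem K A t)"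
    by (simp add: K.conj_elem_inv)
  have "comm_elem K (a ?xy) (b c) = conj_elem K (comm_elem K (a x) (b c')) (b y)"
    using conj_b[OF x c'(1) y] c' by simp
  also have "\<dots> = comm_elem K (conj_elem K (a x) (b y)) (b c)"
    using x y c' by (simp add: K.conj_elem_comm_elem flip: b.hom_conj_elem)
  also have "conj_elem K (a x) (b y) = a x \<otimes> t"
    using x y by (simp add: t_def conj_elem_def comm_elem_def K.m_assoc)
  also have "comm_elem K (a x \<otimes> t) (b c) = conj_elem K A t \<otimes> comm_elem K t (b c)"
    using x c by (simp add: A_def K.comm_elem_mult_left)
  finally have 2: "comm_elem K (a ?xy) (b c) = conj_elem K A t \<otimes> comm_elem K t (b c)" .
  have "comm_elem G x y = inv\<^bsub>G\<^esub> x \<otimes>\<^bsub>G\<^esub> ?xy"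
    using x y by (simp add: conj_elem_def comm_elem_def G.m_assoc)
  then have "comm_elem K (a (comm_elem G x y)) (b c) = comm_elem K (a (inv\<^bsub>G\<^esub> x) \<otimes> a ?xy) (b c)"
    using x y by simp
  also have "\<dots> = inv (conj_elem K A t) \<otimes> (conj_elem K A t \<otimes> comm_elem K t (b c))"
    using x y c by (simp only: 1 2 K.comm_elem_mult_left a.hom_closed b.hom_closed G.inv_closed G.conj_elem_closed)
  also have "\<dots> = comm_elem K t (b c)" using c by simp
  finally show ?thesis by (simp add: t_def)
qed

lemma comm_cross:
  assumes "t \<in> cross_subgroup" and c: "c \<in> carrier G"
  shows "comm_elem K t (b c) = comm_elem K (a (p t)) (b c)"
  using assms(1)
proof (induction rule: cross_induct)
  case one
  then show ?case by simp
next
  case (comm g h)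
  then show ?case using comm_comm c by (simp add: p.hom_comm_elem pa pb)
next
  have comm_in: "comm_elem K t (b c) \<in> cross_subgroup" if "t \<in> cross_subgroup" for t
  proof -
    have "comm_elem K t (b c) = inv t \<otimes> conj_elem K t (b c)"
      using that c by (simp add: cross_carrier comm_elem_def conj_elem_def K.m_assoc)
    then show ?thesis using that c cross_closed by simp
  qed
  {
    case (inv t)
    then have "comm_elem K (inv t) (b c) = conj_elem K (inv (comm_elem K t (b c))) (inv t)"
      using c by (simp add: cross_carrier K.comm_elem_inv_left)
    also have "\<dots> = conj_elem K (inv (comm_elem K t (b c))) (a (p (inv t)))"
      using inv(1) comm_in by (intro conj_cross cross_closed) (simp_all add: cross_carrier)
    also have "\<dots> = comm_elem K (a (p (inv t))) (b c)"
      using inv c by (simp add: cross_carrier K.comm_elem_inv_left)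
    finally show ?case .
  next
    case (mult s t)
    then have "comm_elem K (s \<otimes> t) (b c) =
        conj_elem K (comm_elem K s (b c)) t \<otimes> comm_elem K t (b c)"
      using c by (simp add: cross_carrier K.comm_elem_mult_left)
    also have "conj_elem K (comm_elem K s (b c)) t = conj_elem K (comm_elem K s (b c)) (a (p t))"
      using mult(1,2) comm_in by (intro conj_cross) (simp_all add: cross_carrier)
    also have "\<dots> \<otimes> comm_elem K t (b c) = comm_elem K (a (p (s \<otimes> t))) (b c)"
      using mult c by (simp add: cross_carrier K.comm_elem_mult_left)
    finally show ?case .
  }
qed

lemma kernel_in_cross:
  assumes "w \<in> carrier K" and "q w = (\<one>\<^bsub>G\<^esub>, \<one>\<^bsub>G\<^esub>)"
  shows "w \<in> cross_subgroup"
  using cross_decomposition[OF q_hom qa qb assms(1)] assms(2) by (auto simp: cross_carrier)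

lemma kernel_central:
  assumes w: "w \<in> carrier K" and "p w = \<one>\<^bsub>G\<^esub>" and "q w = (\<one>\<^bsub>G\<^esub>, \<one>\<^bsub>G\<^esub>)" and "x \<in> carrier K"
  shows "w \<otimes> x = x \<otimes> w"
  using assms(4)
proof (induction rule: double_induct)
  have D: "w \<in> cross_subgroup" using kernel_in_cross assms by blast
  have wb: "w \<otimes> b g = b g \<otimes> w" if "g \<in> carrier G" for g
  proof -
    have "comm_elem K w (b g) = \<one>"
      using comm_cross[OF D that] assms that by (simp add: comm_elem_def)
    then show ?thesis using w that K.comm_elem_eq_one_iff by simp
  qed
  {
    case (b g)
    then show ?case by (rule wb)
  next
    case (a g)
    have "conj_elem K w (a g) = w"
      using conj_cross_a_eq_b[OF D a] wb[OF a] K.conj_elem_eq_iff[of w "b g"] w a by simp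
    then show ?case using K.conj_elem_eq_iff[of w "a g"] w a by simp
  next
    case (mult x y)
    then show ?case using w by (metis K.m_assoc)
  }
qed (use w in simp)

end


section \<open>Left modules, free modules and linear combinations\<close>

lemma lm_homI:
  assumes "\<And>x. x \<in> carrier M \<Longrightarrow> f x \<in> carrier N"
    and "\<And>x y. x \<in> carrier M \<Longrightarrow> y \<in> carrier M \<Longrightarrow> f (x \<oplus>\<^bsub>M\<^esub> y) = f x \<oplus>\<^bsub>N\<^esub> f y"
    and "\<And>a x. a \<in> carrier R \<Longrightarrow> x \<in> carrier M \<Longrightarrow> f (a \<odot>\<^bsub>M\<^esub> x) = a \<odot>\<^bsub>N\<^esub> f x"
  shows "f \<in> lm_hom R M N"
  using assms by (auto simp: lm_hom_def hom_def)

lemma lm_homD: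
  assumes "f \<in> lm_hom R M N"
  shows "x \<in> carrier M \<Longrightarrow> f x \<in> carrier N"
    and "x \<in> carrier M \<Longrightarrow> y \<in> carrier M \<Longrightarrow> f (x \<oplus>\<^bsub>M\<^esub> y) = f x \<oplus>\<^bsub>N\<^esub> f y"
    and "a \<in> carrier R \<Longrightarrow> x \<in> carrier M \<Longrightarrow> f (a \<odot>\<^bsub>M\<^esub> x) = a \<odot>\<^bsub>N\<^esub> f x"
  using assms by (auto simp: lm_hom_def hom_def)

lemma lm_hom_compose:
  "f \<in> lm_hom R L M \<Longrightarrow> g \<in> lm_hom R M N \<Longrightarrow> g \<circ> f \<in> lm_hom R L N"
  by (rule lm_homI) (simp_all add: lm_homD)

lemma submoduleD:
  assumes "submodule N R M"
  shows "N \<subseteq> carrier M" and "\<zero>\<^bsub>M\<^esub> \<in> N"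
    and "\<And>x y. x \<in> N \<Longrightarrow> y \<in> N \<Longrightarrow> x \<oplus>\<^bsub>M\<^esub> y \<in> N"
    and "\<And>a x. a \<in> carrier R \<Longrightarrow> x \<in> N \<Longrightarrow> a \<odot>\<^bsub>M\<^esub> x \<in> N"
proof -
  interpret submodule N R M by fact
  show "N \<subseteq> carrier M" "\<zero>\<^bsub>M\<^esub> \<in> N"
    "\<And>x y. x \<in> N \<Longrightarrow> y \<in> N \<Longrightarrow> x \<oplus>\<^bsub>M\<^esub> y \<in> N"
    "\<And>a x. a \<in> carrier R \<Longrightarrow> x \<in> N \<Longrightarrow> a \<odot>\<^bsub>M\<^esub> x \<in> N"
    using subset one_closed m_closed smult_closed by auto
qed

text \<open>The value at a finitely supported family \<open>f\<close> of coefficients of the linear map that sends the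
  basis element \<open>x\<close> to \<open>v x\<close>.\<close>

definition lincomb ::
  "('r, 's) ring_scheme \<Rightarrow> ('r, 'q, 't) module_scheme \<Rightarrow> ('x \<Rightarrow> 'q) \<Rightarrow> ('x \<Rightarrow> 'r) \<Rightarrow> 'q" where
  "lincomb R M v f = (\<Oplus>\<^bsub>M\<^esub>x\<in>{x. f x \<noteq> \<zero>\<^bsub>R\<^esub>}. f x \<odot>\<^bsub>M\<^esub> v x)"

text \<open>The basis element of a free module that belongs to \<open>x\<close>.\<close>

definition basis_elem :: "('r, 's) ring_scheme \<Rightarrow> 'x \<Rightarrow> 'x \<Rightarrow> 'r" where
  "basis_elem R x = (\<lambda>y. if y = x then \<one>\<^bsub>R\<^esub> else \<zero>\<^bsub>R\<^esub>)"

text \<open>The ring as a left module over itself; its submodules are the left ideals.\<close>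

definition regular_module :: "('r, 's) ring_scheme \<Rightarrow> ('r, 'r) module" where
  "regular_module R =
    \<lparr>carrier = carrier R, monoid.mult = monoid.mult R, one = \<one>\<^bsub>R\<^esub>, ring.zero = \<zero>\<^bsub>R\<^esub>,
     add = add R, smult = monoid.mult R\<rparr>"

lemma regular_module_simps [simp]:
  "carrier (regular_module R) = carrier R" "\<zero>\<^bsub>regular_module R\<^esub> = \<zero>\<^bsub>R\<^esub>"
  "x \<oplus>\<^bsub>regular_module R\<^esub> y = x \<oplus>\<^bsub>R\<^esub> y" "a \<odot>\<^bsub>regular_module R\<^esub> x = a \<otimes>\<^bsub>R\<^esub> x"
  by (simp_all add: regular_module_def)

context ring
begin

lemma free_left_module: "left_module R (free_module R X)"
proof -
  let ?F = "free_module R X"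
  have carrierI: "f \<in> carrier ?F"
    if "\<And>x. f x \<in> carrier R" "finite {x. g x \<noteq> \<zero> \<or> h x \<noteq> \<zero>}" "{x. g x \<noteq> \<zero> \<or> h x \<noteq> \<zero>} \<subseteq> X"
      "\<And>x. g x = \<zero> \<Longrightarrow> h x = \<zero> \<Longrightarrow> f x = \<zero>" for f g h
  proof -
    have "{x. f x \<noteq> \<zero>} \<subseteq> {x. g x \<noteq> \<zero> \<or> h x \<noteq> \<zero>}" using that(4) by blast
    then show ?thesis using that(1-3) finite_subset by (auto simp: free_module_def)
  qed
  have D: "f x \<in> carrier R" "finite {x. f x \<noteq> \<zero>}" "{x. f x \<noteq> \<zero>} \<subseteq> X" if "f \<in> carrier ?F" for f x
    using that by (auto simp: free_module_def)
  have DD: "finite {x. f x \<noteq> \<zero> \<or> g x \<noteq> \<zero>}" "{x. f x \<noteq> \<zero> \<or> g x \<noteq> \<zero>} \<subseteq> X"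
    if "f \<in> carrier ?F" "g \<in> carrier ?F" for f g
  proof -
    have "{x. f x \<noteq> \<zero> \<or> g x \<noteq> \<zero>} = {x. f x \<noteq> \<zero>} \<union> {x. g x \<noteq> \<zero>}" by blast
    then show "finite {x. f x \<noteq> \<zero> \<or> g x \<noteq> \<zero>}" "{x. f x \<noteq> \<zero> \<or> g x \<noteq> \<zero>} \<subseteq> X"
      using D(2,3)[OF that(1)] D(2,3)[OF that(2)] by simp_all
  qed
  have add: "f \<oplus>\<^bsub>?F\<^esub> g = (\<lambda>x. f x \<oplus> g x)" "\<zero>\<^bsub>?F\<^esub> = (\<lambda>x. \<zero>)" "a \<odot>\<^bsub>?F\<^esub> f = (\<lambda>x. a \<otimes> f x)" for f g a
    by (simp_all add: free_module_def)
  have closed: "(\<lambda>x. f x \<oplus> g x) \<in> carrier ?F" if "f \<in> carrier ?F" "g \<in> carrier ?F" for f g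
    by (rule carrierI[of _ f g]) (use that D(1) DD in auto)
  have minus: "(\<lambda>x. \<ominus> f x) \<in> carrier ?F" if "f \<in> carrier ?F" for f
    by (rule carrierI[of _ f f]) (use D[OF that] in auto)
  have smult: "(\<lambda>x. a \<otimes> f x) \<in> carrier ?F" if "a \<in> carrier R" "f \<in> carrier ?F" for a f
    by (rule carrierI[of _ f f]) (use that(1) D[OF that(2)] in auto)
  interpret A: abelian_group ?F
  proof (rule abelian_groupI)
    fix f assume f: "f \<in> carrier ?F"
    show "\<exists>g\<in>carrier ?F. g \<oplus>\<^bsub>?F\<^esub> f = \<zero>\<^bsub>?F\<^esub>"
      by (rule bexI[OF _ minus[OF f]]) (use D(1)[OF f] in \<open>simp add: add l_neg\<close>)
  qed (auto simp: add closed D(1) a_ac, simp add: free_module_def)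
  show ?thesis
    by unfold_locales (auto simp: add smult D(1) l_distr r_distr m_assoc)
qed

end

context left_module
begin

lemma smult_zero_left: "x \<in> carrier M \<Longrightarrow> \<zero> \<odot>\<^bsub>M\<^esub> x = \<zero>\<^bsub>M\<^esub>"
proof -
  assume x: "x \<in> carrier M"
  then have c: "\<zero> \<odot>\<^bsub>M\<^esub> x \<in> carrier M" by (simp add: smult_closed)
  have "\<zero> \<odot>\<^bsub>M\<^esub> x \<oplus>\<^bsub>M\<^esub> \<zero> \<odot>\<^bsub>M\<^esub> x = \<zero> \<odot>\<^bsub>M\<^esub> x"
    using x smult_l_distr[of \<zero> \<zero> x] by simp
  then show ?thesis using c by (metis M.add.l_cancel_one)
qed

lemma smult_zero_right: "a \<in> carrier R \<Longrightarrow> a \<odot>\<^bsub>M\<^esub> \<zero>\<^bsub>M\<^esub> = \<zero>\<^bsub>M\<^esub>"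
proof -
  assume a: "a \<in> carrier R"
  then have c: "a \<odot>\<^bsub>M\<^esub> \<zero>\<^bsub>M\<^esub> \<in> carrier M" by (simp add: smult_closed)
  have "a \<odot>\<^bsub>M\<^esub> \<zero>\<^bsub>M\<^esub> \<oplus>\<^bsub>M\<^esub> a \<odot>\<^bsub>M\<^esub> \<zero>\<^bsub>M\<^esub> = a \<odot>\<^bsub>M\<^esub> \<zero>\<^bsub>M\<^esub>"
    using a smult_r_distr[of a "\<zero>\<^bsub>M\<^esub>" "\<zero>\<^bsub>M\<^esub>"] by simp
  then show ?thesis using c by (metis M.add.l_cancel_one)
qed

lemma smult_minus_one: "x \<in> carrier M \<Longrightarrow> (\<ominus> \<one>) \<odot>\<^bsub>M\<^esub> x = \<ominus>\<^bsub>M\<^esub> x"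
proof -
  assume x: "x \<in> carrier M"
  have "(\<ominus> \<one>) \<odot>\<^bsub>M\<^esub> x \<oplus>\<^bsub>M\<^esub> x = (\<ominus> \<one> \<oplus> \<one>) \<odot>\<^bsub>M\<^esub> x"
    using x smult_l_distr[of "\<ominus> \<one>" \<one> x] smult_one by simp
  also have "\<dots> = \<zero>\<^bsub>M\<^esub>" using x by (simp add: R.l_neg smult_zero_left)
  finally show ?thesis using x by (metis M.minus_equality R.a_inv_closed R.one_closed smult_closed)
qed

text \<open>Closure under negation is automatic over a ring with \<open>\<one>\<close>.\<close>

lemma submoduleI':
  assumes "N \<subseteq> carrier M" and "\<zero>\<^bsub>M\<^esub> \<in> N" and "\<And>x y. x \<in> N \<Longrightarrow> y \<in> N \<Longrightarrow> x \<oplus>\<^bsub>M\<^esub> y \<in> N"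
    and smult: "\<And>a x. a \<in> carrier R \<Longrightarrow> x \<in> N \<Longrightarrow> a \<odot>\<^bsub>M\<^esub> x \<in> N"
  shows "submodule N R M"
proof -
  have "\<ominus>\<^bsub>M\<^esub> x \<in> N" if "x \<in> N" for x
    using smult[of "\<ominus> \<one>" x] that assms(1) by (auto simp: smult_minus_one)
  then show ?thesis
    using assms by (intro submodule.intro subgroup.intro submodule_axioms.intro) (auto simp: a_inv_def)
qed

lemma submodule_finsum:
  assumes N: "submodule N R M" and "\<And>x. x \<in> A \<Longrightarrow> f x \<in> N"
  shows "(\<Oplus>\<^bsub>M\<^esub>x\<in>A. f x) \<in> N"
proof (cases "finite A")
  case True
  then show ?thesis
    using assms(2)
  proof (induction A rule: finite_induct)
    case empty
    then show ?case using submoduleD(2)[OF N] by simp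
  next
    case (insert x F)
    then have "f \<in> F \<rightarrow> carrier M" "f x \<in> carrier M" using submoduleD(1)[OF N] by auto
    then show ?case using insert submoduleD(3)[OF N] by simp
  qed
qed (use submoduleD(2)[OF N] in \<open>simp add: M.finsum_infinite\<close>)

lemma free_module_D:
  assumes "f \<in> carrier (free_module R X)"
  shows "f x \<in> carrier R" and "finite {x. f x \<noteq> \<zero>}" and "f x \<noteq> \<zero> \<Longrightarrow> x \<in> X"
  using assms by (auto simp: free_module_def)

lemma lincomb_superset:
  assumes "f \<in> carrier (free_module R X)" and "v ` X \<subseteq> carrier M" and "finite A" and "A \<subseteq> X"
    and "{x. f x \<noteq> \<zero>} \<subseteq> A"
  shows "lincomb R M v f = (\<Oplus>\<^bsub>M\<^esub>x\<in>A. f x \<odot>\<^bsub>M\<^esub> v x)"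
  unfolding lincomb_def
  by (rule M.add.finprod_mono_neutral_cong_left)
    (use assms free_module_D(1)[OF assms(1)] in \<open>auto simp: smult_zero_left smult_closed subset_iff image_subset_iff\<close>)

lemma lincomb_in_submodule:
  assumes "submodule N R M" and "f \<in> carrier (free_module R X)" and "v ` X \<subseteq> N"
  shows "lincomb R M v f \<in> N"
  unfolding lincomb_def
  by (rule submodule_finsum[OF assms(1)])
    (use free_module_D[OF assms(2)] assms(3) submoduleD(4)[OF assms(1)] in \<open>auto simp: image_subset_iff\<close>)

lemma lincomb_basis_elem:
  assumes "x \<in> X" and "v ` X \<subseteq> carrier M"
  shows "lincomb R M v (basis_elem R x) = v x"
proof -
  have f: "basis_elem R x \<in> carrier (free_module R X)"
    using assms by (auto simp: free_module_def basis_elem_def)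
  have vx: "v x \<in> carrier M" using assms by auto
  have "lincomb R M v (basis_elem R x) = (\<Oplus>\<^bsub>M\<^esub>y\<in>{x}. basis_elem R x y \<odot>\<^bsub>M\<^esub> v y)"
    by (rule lincomb_superset[OF f assms(2)]) (use assms in \<open>auto simp: basis_elem_def\<close>)
  also have "\<dots> = v x"
    using vx by (subst M.finsum_insert) (auto simp: basis_elem_def smult_one)
  finally show ?thesis .
qed

lemma smult_finsum:
  assumes "finite A" and "a \<in> carrier R" and "g \<in> A \<rightarrow> carrier M"
  shows "a \<odot>\<^bsub>M\<^esub> (\<Oplus>\<^bsub>M\<^esub>x\<in>A. g x) = (\<Oplus>\<^bsub>M\<^esub>x\<in>A. a \<odot>\<^bsub>M\<^esub> g x)"
  using assms
proof (induction A rule: finite_induct)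
  case empty
  then show ?case by (simp add: smult_zero_right)
next
  case (insert x F)
  then have "g \<in> F \<rightarrow> carrier M" "g x \<in> carrier M" by auto
  then show ?case using insert by (simp add: smult_r_distr smult_closed Pi_def)
qed

lemma lincomb_hom:
  assumes v: "v ` X \<subseteq> carrier M"
  shows "lincomb R M v \<in> lm_hom R (free_module R X) M"
proof (rule lm_homI)
  interpret F: left_module R "free_module R X" by (rule R.free_left_module)
  fix f assume f: "f \<in> carrier (free_module R X)"
  let ?S = "\<lambda>f. {x. f x \<noteq> \<zero>}"
  have vx: "x \<in> X \<Longrightarrow> v x \<in> carrier M" for x using v by auto
  have S: "finite (?S f)" "?S f \<subseteq> X" if "f \<in> carrier (free_module R X)" for f
    using free_module_D[OF that] by auto
  note c = free_module_D(1)
  show "lincomb R M v f \<in> carrier M"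
    unfolding lincomb_def using S[OF f] c[OF f] vx
    by (intro M.finsum_closed) (auto simp: smult_closed subset_iff)
  {
    fix g assume g: "g \<in> carrier (free_module R X)"
    have fg: "f \<oplus>\<^bsub>free_module R X\<^esub> g \<in> carrier (free_module R X)"
      using f g by (rule F.M.a_closed)
    let ?A = "?S f \<union> ?S g"
    have A: "finite ?A" "?A \<subseteq> X" using S[OF f] S[OF g] by auto
    have *: "lincomb R M v h = (\<Oplus>\<^bsub>M\<^esub>x\<in>?A. h x \<odot>\<^bsub>M\<^esub> v x)"
      if "h \<in> carrier (free_module R X)" "?S h \<subseteq> ?A" for h
      using lincomb_superset[OF that(1) v A that(2)] .
    have "lincomb R M v (f \<oplus>\<^bsub>free_module R X\<^esub> g) =
        (\<Oplus>\<^bsub>M\<^esub>x\<in>?A. (f \<oplus>\<^bsub>free_module R X\<^esub> g) x \<odot>\<^bsub>M\<^esub> v x)"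
      using c[OF f] c[OF g] by (intro *[OF fg]) (auto simp: free_module_def)
    also have "\<dots> = (\<Oplus>\<^bsub>M\<^esub>x\<in>?A. f x \<odot>\<^bsub>M\<^esub> v x \<oplus>\<^bsub>M\<^esub> g x \<odot>\<^bsub>M\<^esub> v x)"
      using A(2) c[OF f] c[OF g] vx
      by (intro M.finsum_cong') (auto simp: free_module_def smult_l_distr smult_closed subset_iff)
    also have "\<dots> = (\<Oplus>\<^bsub>M\<^esub>x\<in>?A. f x \<odot>\<^bsub>M\<^esub> v x) \<oplus>\<^bsub>M\<^esub> (\<Oplus>\<^bsub>M\<^esub>x\<in>?A. g x \<odot>\<^bsub>M\<^esub> v x)"
      using A(2) c[OF f] c[OF g] vx by (intro M.finsum_addf) (auto simp: smult_closed subset_iff)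
    finally show "lincomb R M v (f \<oplus>\<^bsub>free_module R X\<^esub> g) = lincomb R M v f \<oplus>\<^bsub>M\<^esub> lincomb R M v g"
      using *[OF f] *[OF g] by simp
  next
    fix a assume a: "a \<in> carrier R"
    have af: "a \<odot>\<^bsub>free_module R X\<^esub> f \<in> carrier (free_module R X)"
      using a f by (rule F.smult_closed)
    have "lincomb R M v (a \<odot>\<^bsub>free_module R X\<^esub> f) =
        (\<Oplus>\<^bsub>M\<^esub>x\<in>?S f. (a \<odot>\<^bsub>free_module R X\<^esub> f) x \<odot>\<^bsub>M\<^esub> v x)"
      using a by (intro lincomb_superset[OF af v S[OF f]]) (auto simp: free_module_def)
    also have "\<dots> = (\<Oplus>\<^bsub>M\<^esub>x\<in>?S f. a \<odot>\<^bsub>M\<^esub> (f x \<odot>\<^bsub>M\<^esub> v x))"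
      using a S(2)[OF f] c[OF f] vx
      by (intro M.finsum_cong') (auto simp: free_module_def smult_assoc smult_closed subset_iff)
    also have "\<dots> = a \<odot>\<^bsub>M\<^esub> lincomb R M v f"
      unfolding lincomb_def using a S[OF f] c[OF f] vx
      by (intro smult_finsum[symmetric]) (auto simp: smult_closed subset_iff)
    finally show "lincomb R M v (a \<odot>\<^bsub>free_module R X\<^esub> f) = a \<odot>\<^bsub>M\<^esub> lincomb R M v f" .
  }
qed

lemma lm_hom_zero:
  assumes "left_module R N" and "f \<in> lm_hom R M N"
  shows "f \<zero>\<^bsub>M\<^esub> = \<zero>\<^bsub>N\<^esub>"
proof -
  interpret N: left_module R N by fact
  have "f (\<zero> \<odot>\<^bsub>M\<^esub> \<zero>\<^bsub>M\<^esub>) = \<zero> \<odot>\<^bsub>N\<^esub> f \<zero>\<^bsub>M\<^esub>"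
    by (rule lm_homD(3)[OF assms(2)]) auto
  then show ?thesis using lm_homD(1)[OF assms(2)] by (simp add: smult_zero_left N.smult_zero_left)
qed

lemma submodule_vimage:
  assumes "left_module R N" and f: "f \<in> lm_hom R M N" and J: "submodule J R N"
  shows "submodule {x \<in> carrier M. f x \<in> J} R M"
  by (rule submoduleI')
    (use submoduleD[OF J] lm_homD[OF f] lm_hom_zero[OF assms(1,2)] in \<open>auto simp: smult_closed\<close>)

lemma submodule_zero: "submodule {\<zero>\<^bsub>M\<^esub>} R M"
  by (rule submoduleI') (auto simp: smult_zero_right)

lemma submodule_equalizer:
  assumes N: "left_module R N" and f: "f \<in> lm_hom R M N" and g: "g \<in> lm_hom R M N"
  shows "submodule {x \<in> carrier M. f x = g x} R M"
  by (rule submoduleI')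
    (use lm_homD[OF f] lm_homD[OF g] lm_hom_zero[OF N f] lm_hom_zero[OF N g] in \<open>auto simp: smult_closed\<close>)

lemma smult_hom: "u \<in> carrier M \<Longrightarrow> (\<lambda>r. r \<odot>\<^bsub>M\<^esub> u) \<in> lm_hom R (regular_module R) M"
  by (rule lm_homI) (simp_all add: smult_closed smult_l_distr smult_assoc)

lemma submodule_a_kernel:
  assumes N: "left_module R N" and f: "f \<in> lm_hom R M N"
  shows "submodule (a_kernel M N f) R M"
  using submodule_vimage[OF N f left_module.submodule_zero[OF N]] by (simp add: a_kernel_def')

lemma submodule_image:
  assumes "left_module R N" and f: "f \<in> lm_hom R M N"
  shows "submodule (f ` carrier M) R N"
proof (rule left_module.submoduleI'[OF assms(1)])
  show "\<zero>\<^bsub>N\<^esub> \<in> f ` carrier M"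
    using lm_hom_zero[OF assms] by (metis M.zero_closed imageI)
qed (use lm_homD[OF f] smult_closed in \<open>auto simp: image_iff\<close>, (metis M.a_closed smult_closed)+)

end

lemma (in ring) regular_left_module: "left_module R (regular_module R)"
proof -
  interpret A: abelian_group "regular_module R"
    by (rule abelian_groupI) (auto simp: regular_module_def a_ac intro: l_neg)
  show ?thesis
    by unfold_locales (auto simp: regular_module_def m_assoc l_distr r_distr)
qed

context ring
begin

lemma basis_elem_closed: "x \<in> X \<Longrightarrow> basis_elem R x \<in> carrier (free_module R X)"
  by (auto simp: free_module_def basis_elem_def)

lemma free_module_spanned:
  assumes N: "submodule N R (free_module R X)" and "basis_elem R ` X \<subseteq> N"
  shows "N = carrier (free_module R X)"
proof
  interpret F: left_module R "free_module R X" by (rule free_left_module)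
  show "N \<subseteq> carrier (free_module R X)" using submoduleD(1)[OF N] .
  have "f \<in> N" if "finite A" "f \<in> carrier (free_module R X)" "{x. f x \<noteq> \<zero>} \<subseteq> A" for A f
    using that
  proof (induction A arbitrary: f rule: finite_induct)
    case empty
    then have "f = (\<lambda>x. \<zero>)" by auto
    then show ?case using submoduleD(2)[OF N] by (simp add: free_module_def)
  next
    case (insert x A)
    note f = F.free_module_D[OF insert(4)]
    let ?g = "f(x := \<zero>)"
    have g: "?g \<in> N"
    proof (rule insert.IH)
      show "?g \<in> carrier (free_module R X)"
        using f by (auto simp: free_module_def intro: finite_subset[of _ "{x. f x \<noteq> \<zero>}"])
    qed (use insert in auto)
    show ?case
    proof (cases "f x = \<zero>")
      case True
      then have "?g = f" by auto
      then show ?thesis using g by simp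
    next
      case False
      then have "f x \<odot>\<^bsub>free_module R X\<^esub> basis_elem R x \<in> N"
        using assms(2) f by (intro submoduleD(4)[OF N]) auto
      from submoduleD(3)[OF N g this]
      have "?g \<oplus>\<^bsub>free_module R X\<^esub> (f x \<odot>\<^bsub>free_module R X\<^esub> basis_elem R x) \<in> N" .
      moreover have "?g \<oplus>\<^bsub>free_module R X\<^esub> (f x \<odot>\<^bsub>free_module R X\<^esub> basis_elem R x) = f"
        using f by (auto simp: free_module_def basis_elem_def)
      ultimately show ?thesis by simp
    qed
  qed
  then show "carrier (free_module R X) \<subseteq> N"
    using F.free_module_D(2) by blast
qed

end

section \<open>Transport of a module along an injection\<close>

text \<open>The module structure on the image of \<open>M\<close> that makes an injection \<open>h\<close> an isomorphism.  The fields
  \<open>mult\<close> and \<open>one\<close> are dummies.\<close>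

definition transport :: "('p \<Rightarrow> 'q) \<Rightarrow> ('r, 'p) module \<Rightarrow> ('r, 'q) module" where
  "transport h M = (let k = inv_into (carrier M) h in
    \<lparr>carrier = h ` carrier M, monoid.mult = (\<lambda>x y. h \<zero>\<^bsub>M\<^esub>), one = h \<zero>\<^bsub>M\<^esub>,
     ring.zero = h \<zero>\<^bsub>M\<^esub>, add = (\<lambda>x y. h (k x \<oplus>\<^bsub>M\<^esub> k y)), smult = (\<lambda>a x. h (a \<odot>\<^bsub>M\<^esub> k x))\<rparr>)"

context
  fixes R :: "('r, 's) ring_scheme" and M :: "('r, 'p) module" and h :: "'p \<Rightarrow> 'q"
  assumes M: "left_module R M" and inj: "inj_on h (carrier M)"
begin

interpretation left_module R M by (rule M)

lemma transport_left_module: "left_module R (transport h M)"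
proof -
  let ?T = "transport h M"
  note [simp] = inv_into_f_f[OF inj] smult_closed
  have s: "carrier ?T = h ` carrier M" "\<zero>\<^bsub>?T\<^esub> = h \<zero>\<^bsub>M\<^esub>"
    "x \<oplus>\<^bsub>?T\<^esub> y = h (inv_into (carrier M) h x \<oplus>\<^bsub>M\<^esub> inv_into (carrier M) h y)"
    "a \<odot>\<^bsub>?T\<^esub> x = h (a \<odot>\<^bsub>M\<^esub> inv_into (carrier M) h x)" for x y a
    by (simp_all add: transport_def Let_def)
  interpret T: abelian_group ?T
  proof (rule abelian_groupI)
    fix x assume "x \<in> carrier ?T"
    then obtain m where m: "m \<in> carrier M" "x = h m" by (auto simp: s)
    show "\<exists>y\<in>carrier ?T. y \<oplus>\<^bsub>?T\<^esub> x = \<zero>\<^bsub>?T\<^esub>"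
      by (rule bexI[of _ "h (\<ominus>\<^bsub>M\<^esub> m)"]) (use m in \<open>auto simp: s M.l_neg\<close>)
  qed (auto simp: s M.a_ac)
  show ?thesis
    by unfold_locales
      (auto simp: s smult_l_distr smult_r_distr smult_assoc smult_one)
qed

lemma transport_hom: "h \<in> lm_hom R M (transport h M)"
  by (rule lm_homI) (simp_all add: transport_def Let_def inv_into_f_f[OF inj])

lemma transport_inv_hom: "inv_into (carrier M) h \<in> lm_hom R (transport h M) M"
  by (rule lm_homI) (auto simp: transport_def Let_def inv_into_f_f[OF inj] smult_closed)

end

text \<open>Lists of lists over an alphabet with two letters \<open>s \<noteq> t\<close> are encoded in lists: every letter
  of an inner list is preceded by \<open>s\<close>, and \<open>t\<close> marks the end of an inner list.\<close>

primrec list_code :: "'a \<Rightarrow> 'a \<Rightarrow> 'a list list \<Rightarrow> 'a list" where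
  "list_code s t [] = []"
| "list_code s t (xs # xss) = concat (map (\<lambda>x. [s, x]) xs) @ t # list_code s t xss"

lemma list_code_inject:
  assumes "s \<noteq> t"
  shows "list_code s t xss = list_code s t yss \<Longrightarrow> xss = yss"
proof (induction xss arbitrary: yss)
  case Nil
  then show ?case by (cases yss) auto
next
  case (Cons xs xss)
  have block: "concat (map (\<lambda>x. [s, x]) xs) @ t # u = concat (map (\<lambda>x. [s, x]) ys) @ t # v \<Longrightarrow>
      xs = ys \<and> u = v" for xs ys u v
  proof (induction xs arbitrary: ys)
    case Nil
    then show ?case using assms by (cases ys) auto
  next
    case (Cons x xs)
    then show ?case using assms by (cases ys) auto
  qed
  show ?case
  proof (cases yss)
    case Nil
    then show ?thesis using Cons.prems by simp
  next
    case (Cons ys yss')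
    then show ?thesis using block[of xs _ ys] Cons.prems Cons.IH by auto
  qed
qed

text \<open>A function that has the value \<open>z\<close> almost everywhere is encoded by a list of its other values, each
  of them with the argument, a list, attached to it.\<close>

lemma finite_support_encoding:
  fixes s t z :: 'r
  assumes "s \<noteq> t"
  obtains enc :: "('r list \<Rightarrow> 'r) \<Rightarrow> 'r list" where "inj_on enc {f. finite {x. f x \<noteq> z}}"
proof -
  define graph where "graph f = (SOME ps. set ps = (\<lambda>x. f x # x) ` {x. f x \<noteq> z})" for f :: "'r list \<Rightarrow> 'r"
  have graph: "set (graph f) = (\<lambda>x. f x # x) ` {x. f x \<noteq> z}" if "finite {x. f x \<noteq> z}" for f
    unfolding graph_def by (rule someI_ex) (use that finite_list in blast)
  have "inj_on (list_code s t \<circ> graph) {f. finite {x. f x \<noteq> z}}"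
  proof (rule inj_onI)
    fix f g
    assume fg: "f \<in> {f. finite {x. f x \<noteq> z}}" "g \<in> {f. finite {x. f x \<noteq> z}}"
      and "(list_code s t \<circ> graph) f = (list_code s t \<circ> graph) g"
    then have "graph f = graph g" using list_code_inject[OF assms] by simp
    then have eq: "(\<lambda>x. f x # x) ` {x. f x \<noteq> z} = (\<lambda>x. g x # x) ` {x. g x \<noteq> z}"
      using graph[of f] graph[of g] fg by simp
    have "f x = g x" for x
    proof (cases "f x = z \<and> g x = z")
      case False
      then consider "f x # x \<in> (\<lambda>x. f x # x) ` {x. f x \<noteq> z}" | "g x # x \<in> (\<lambda>x. g x # x) ` {x. g x \<noteq> z}"
        by blast
      then show ?thesis
      proof cases
        case 1
        then show ?thesis unfolding eq by auto
      next
        case 2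
        then show ?thesis unfolding eq[symmetric] by auto
      qed
    qed simp
    then show "f = g" by auto
  qed
  then show ?thesis by (rule that)
qed


section \<open>Cyclic modules of type \<open>FP\<^sub>1\<close>\<close>

text \<open>An injective encoding of finitely supported functions on lists by lists.  It provides free modules,
  with bases of lists, whose elements are lists as well, so that subsets of one of these modules can
  serve as the basis of another one.\<close>

locale encoded_free = ring R for R :: "('r, 's) ring_scheme" (structure) +
  fixes enc :: "('r list \<Rightarrow> 'r) \<Rightarrow> 'r list"
  assumes enc_inj: "inj_on enc {f. finite {x. f x \<noteq> \<zero>}}"
begin

text \<open>The encoded free module on a set of lists.\<close>

definition FM :: "'r list set \<Rightarrow> ('r, 'r list) module" where
  "FM X = transport enc (free_module R X)"

text \<open>The inverse of the encoding: the coefficients of an element of \<open>FM X\<close>.\<close>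

definition dec :: "'r list set \<Rightarrow> 'r list \<Rightarrow> 'r list \<Rightarrow> 'r" where
  "dec X = inv_into (carrier (free_module R X)) enc"

text \<open>The linear map on \<open>FM X\<close> with values \<open>v x\<close> on the basis.\<close>

definition ext :: "('r, 'q) module \<Rightarrow> 'r list set \<Rightarrow> ('r list \<Rightarrow> 'q) \<Rightarrow> 'r list \<Rightarrow> 'q" where
  "ext M X v = lincomb R M v \<circ> dec X"

lemma enc_inj_free: "inj_on enc (carrier (free_module R X))"
  by (rule inj_on_subset[OF enc_inj]) (auto simp: free_module_def)

lemma FM_left_module: "left_module R (FM X)"
  unfolding FM_def by (intro transport_left_module free_left_module enc_inj_free)

lemma enc_hom: "enc \<in> lm_hom R (free_module R X) (FM X)"
  unfolding FM_def by (intro transport_hom free_left_module enc_inj_free)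

lemma dec_hom: "dec X \<in> lm_hom R (FM X) (free_module R X)"
  unfolding FM_def dec_def by (intro transport_inv_hom free_left_module enc_inj_free)

lemma FM_carrier: "carrier (FM X) = enc ` carrier (free_module R X)"
  by (simp add: FM_def transport_def Let_def)

lemma dec_enc: "f \<in> carrier (free_module R X) \<Longrightarrow> dec X (enc f) = f"
  unfolding dec_def by (rule inv_into_f_f[OF enc_inj_free])

lemma enc_dec: "x \<in> carrier (FM X) \<Longrightarrow> enc (dec X x) = x"
  by (auto simp: FM_carrier dec_enc)

lemma FM_projective: "projective_module R (FM X)"
  unfolding projective_module_def using FM_left_module dec_hom enc_hom enc_dec by blast

lemma FM_basis: "x \<in> X \<Longrightarrow> enc (basis_elem R x) \<in> carrier (FM X)"
  by (simp add: FM_carrier basis_elem_closed)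

lemma FM_spanned:
  assumes N: "submodule N R (FM X)" and "\<And>x. x \<in> X \<Longrightarrow> enc (basis_elem R x) \<in> N"
  shows "N = carrier (FM X)"
proof
  show "N \<subseteq> carrier (FM X)" by (rule submoduleD(1)[OF N])
  have "submodule {f \<in> carrier (free_module R X). enc f \<in> N} R (free_module R X)"
    by (rule left_module.submodule_vimage[OF free_left_module FM_left_module enc_hom N])
  then have "{f \<in> carrier (free_module R X). enc f \<in> N} = carrier (free_module R X)"
    by (rule free_module_spanned) (use assms(2) basis_elem_closed in auto)
  then show "carrier (FM X) \<subseteq> N" by (auto simp: FM_carrier)
qed

lemma FM_fin_gen:
  assumes "finite X"
  shows "fin_gen_module R (FM X)"
  unfolding fin_gen_module_def
proof (intro exI conjI allI impI)
  show "finite ((\<lambda>x. enc (basis_elem R x)) ` X)" using assms by simp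
  show "(\<lambda>x. enc (basis_elem R x)) ` X \<subseteq> carrier (FM X)" using FM_basis by blast
  show "N = carrier (FM X)" if "submodule N R (FM X) \<and> (\<lambda>x. enc (basis_elem R x)) ` X \<subseteq> N" for N
    using that by (intro FM_spanned) auto
qed

context
  fixes M :: "('r, 'q) module" and X :: "'r list set" and v :: "'r list \<Rightarrow> 'q"
  assumes M: "left_module R M" and v: "v ` X \<subseteq> carrier M"
begin

lemma ext_hom: "ext M X v \<in> lm_hom R (FM X) M"
  unfolding ext_def by (rule lm_hom_compose[OF dec_hom left_module.lincomb_hom[OF M v]])

lemma ext_basis: "x \<in> X \<Longrightarrow> ext M X v (enc (basis_elem R x)) = v x"
  by (simp add: ext_def dec_enc basis_elem_closed left_module.lincomb_basis_elem[OF M _ v])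

lemma ext_image_subset:
  assumes "submodule N R M" and "v ` X \<subseteq> N"
  shows "ext M X v ` carrier (FM X) \<subseteq> N"
  using left_module.lincomb_in_submodule[OF M assms(1) _ assms(2)] lm_homD(1)[OF dec_hom]
  by (auto simp: ext_def)

lemma ext_image_generators: "v ` X \<subseteq> ext M X v ` carrier (FM X)"
  using ext_basis FM_basis by (force simp: image_iff)

end

text \<open>A free presentation with finite bases extends to a resolution in which every module after the
  first two is free on the kernel of the previous map.\<close>

lemma type_FP_1_presentation:
  fixes M :: "('r, 'q) module"
  assumes M: "left_module R M" and v: "v ` X \<subseteq> carrier M" and fin: "finite X" "finite Y"
    and onto: "ext M X v ` carrier (FM X) = carrier M"
    and Y: "Y \<subseteq> carrier (FM X)"
    and exact: "ext (FM X) Y (\<lambda>y. y) ` carrier (FM Y) = a_kernel (FM X) M (ext M X v)"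
  shows "type_FP 1 R M"
proof -
  \<comment> \<open>the bases of two consecutive modules of the resolution; the next basis is the kernel of the
    map between these modules\<close>
  define st where "st = rec_nat (X, Y)
    (\<lambda>_ (X, Y). (Y, a_kernel (FM Y) (FM X) (ext (FM X) Y (\<lambda>y. y))))"
  define P where "P i = FM (fst (st i))" for i
  define d where "d i = ext (P i) (snd (st i)) (\<lambda>y. y)" for i
  have st0: "st 0 = (X, Y)" by (simp add: st_def)
  have fstS: "fst (st (Suc i)) = snd (st i)" for i by (simp add: st_def case_prod_beta)
  have sndS: "snd (st (Suc i)) = a_kernel (P (Suc i)) (P i) (d i)" for i
    unfolding P_def d_def fstS by (simp add: st_def case_prod_beta)
  have sub: "snd (st i) \<subseteq> carrier (P i)" for i
    by (cases i) (use Y in \<open>auto simp: st0 P_def sndS a_kernel_def'\<close>)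
  have P: "left_module R (P i)" for i by (simp add: P_def FM_left_module)
  have PS: "P (Suc i) = FM (snd (st i))" for i by (simp add: P_def fstS)
  have d: "d i \<in> lm_hom R (P (Suc i)) (P i)" for i
    unfolding d_def PS using sub by (intro ext_hom P) simp
  have exact_d: "d (Suc i) ` carrier (P (Suc (Suc i))) = a_kernel (P (Suc i)) (P i) (d i)" for i
  proof
    let ?K = "a_kernel (P (Suc i)) (P i) (d i)"
    have K: "submodule ?K R (P (Suc i))"
      by (rule left_module.submodule_a_kernel[OF P P d])
    have v: "(\<lambda>y. y) ` ?K \<subseteq> carrier (P (Suc i))"
      using submoduleD(1)[OF K] by simp
    have dS: "d (Suc i) = ext (P (Suc i)) ?K (\<lambda>y. y)" "P (Suc (Suc i)) = FM ?K"
      using sndS[of i] by (simp_all add: d_def PS[of "Suc i"])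
    show "d (Suc i) ` carrier (P (Suc (Suc i))) \<subseteq> ?K"
      unfolding dS by (rule ext_image_subset[OF P v K]) simp
    show "?K \<subseteq> d (Suc i) ` carrier (P (Suc (Suc i)))"
      unfolding dS using ext_image_generators[OF P v] by simp
  qed
  have "projective_resolution R M P d (ext M X v)"
    unfolding projective_resolution_def
  proof (intro conjI allI)
    show "ext M X v \<in> lm_hom R (P 0) M"
      using ext_hom[OF M v] by (simp add: P_def st0)
    show "d 0 ` carrier (P (Suc 0)) = a_kernel (P 0) M (ext M X v)"
      using exact unfolding PS by (simp add: d_def st0 P_def)
  qed (use onto d exact_d FM_projective in \<open>auto simp: P_def st0\<close>)
  moreover have "\<forall>i\<le>1. fin_gen_module R (P i)"
    using fin FM_fin_gen PS[of 0] by (auto simp: le_Suc_eq st0 P_def)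
  ultimately show ?thesis
    unfolding type_FP_def using M by blast
qed

end

text \<open>A left ideal is finitely generated if the left ideals that contain a suitable finite subset
  contain all of it.\<close>

definition fin_gen_left_ideal :: "('r, 's) ring_scheme \<Rightarrow> 'r set \<Rightarrow> bool" where
  "fin_gen_left_ideal R I \<longleftrightarrow> (\<exists>B. finite B \<and> B \<subseteq> I \<and>
     (\<forall>J. submodule J R (regular_module R) \<and> B \<subseteq> J \<longrightarrow> I \<subseteq> J))"

context
  fixes R :: "('r, 's) ring_scheme" and M :: "('r, 'q) module" and m
  assumes M: "left_module R M" and m: "m \<in> carrier M"
    and cyclic: "carrier M = (\<lambda>r. r \<odot>\<^bsub>M\<^esub> m) ` carrier R"
begin

text \<open>For a cyclic module, type \<open>FP\<^sub>1\<close> means that the annihilator of the generator is finitely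
  generated.\<close>

interpretation M: left_module R M by (rule M)

lemma cyclic_type_FP_1_imp:
  assumes "type_FP 1 R M"
  shows "fin_gen_left_ideal R {r \<in> carrier R. r \<odot>\<^bsub>M\<^esub> m = \<zero>\<^bsub>M\<^esub>}" (is "fin_gen_left_ideal R ?I")
proof -
  obtain P :: "nat \<Rightarrow> ('r, 'r list) module" and d e
    where res: "projective_resolution R M P d e" and fg: "fin_gen_module R (P 1)"
    using assms unfolding type_FP_def by auto
  have e: "e \<in> lm_hom R (P 0) M" and onto: "e ` carrier (P 0) = carrier M"
    and d: "d 0 \<in> lm_hom R (P 1) (P 0)"
    and exact: "d 0 ` carrier (P 1) = a_kernel (P 0) M e"
    and P0: "projective_module R (P 0)" and P1: "left_module R (P 1)"
    using res unfolding projective_resolution_def projective_module_def by auto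
  have P0': "left_module R (P 0)" using P0 by (simp add: projective_module_def)
  let ?R = "regular_module R"
  note RR = M.R.regular_left_module
  \<comment> \<open>as \<open>P 0\<close> is projective, \<open>e\<close> lifts to a map \<open>g\<close> from \<open>P 0\<close> to the ring\<close>
  obtain g where g: "g \<in> lm_hom R (P 0) ?R" and ge: "\<And>p. p \<in> carrier (P 0) \<Longrightarrow> g p \<odot>\<^bsub>M\<^esub> m = e p"
  proof -
    obtain X :: "'r list set" and i q where i: "i \<in> lm_hom R (P 0) (free_module R X)"
      and q: "q \<in> lm_hom R (free_module R X) (P 0)" and qi: "\<forall>x\<in>carrier (P 0). q (i x) = x"
      using P0 unfolding projective_module_def by blast
    let ?F = "free_module R X"
    have "\<exists>r\<in>carrier R. r \<odot>\<^bsub>M\<^esub> m = e (q (basis_elem R x))" if "x \<in> X" for x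
      using lm_homD(1)[OF e lm_homD(1)[OF q M.R.basis_elem_closed[OF that]]] cyclic by auto
    then obtain r where r: "\<And>x. x \<in> X \<Longrightarrow> r x \<in> carrier R"
      "\<And>x. x \<in> X \<Longrightarrow> r x \<odot>\<^bsub>M\<^esub> m = e (q (basis_elem R x))" by metis
    have rX: "r ` X \<subseteq> carrier ?R" using r by auto
    have l: "lincomb R ?R r \<in> lm_hom R ?F ?R" by (rule left_module.lincomb_hom[OF RR rX])
    let ?s = "(\<lambda>r. r \<odot>\<^bsub>M\<^esub> m) \<circ> lincomb R ?R r" and ?t = "e \<circ> q"
    have "{f \<in> carrier ?F. ?s f = ?t f} = carrier ?F"
    proof (rule M.R.free_module_spanned)
      show "submodule {f \<in> carrier ?F. ?s f = ?t f} R ?F"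
        using lm_hom_compose[OF l M.smult_hom[OF m]] lm_hom_compose[OF q e]
        by (rule left_module.submodule_equalizer[OF M.R.free_left_module M])
      show "basis_elem R ` X \<subseteq> {f \<in> carrier ?F. ?s f = ?t f}"
      proof (rule image_subsetI, rule CollectI, rule conjI)
        fix x assume x: "x \<in> X"
        show "basis_elem R x \<in> carrier ?F" by (rule M.R.basis_elem_closed[OF x])
        show "?s (basis_elem R x) = ?t (basis_elem R x)"
          unfolding comp_def left_module.lincomb_basis_elem[OF RR x rX] by (rule r(2)[OF x])
      qed
    qed
    then have "lincomb R ?R r f \<odot>\<^bsub>M\<^esub> m = e (q f)" if "f \<in> carrier ?F" for f
      using that by auto
    then show ?thesis
      using that[OF lm_hom_compose[OF i l]] lm_homD(1)[OF i] qi by simp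
  qed
  obtain p where p: "p \<in> carrier (P 0)" "e p = m" using onto m by (metis imageE)
  obtain B where B: "finite B" "B \<subseteq> carrier (P 1)"
    and B_span: "\<forall>N. submodule N R (P 1) \<and> B \<subseteq> N \<longrightarrow> N = carrier (P 1)"
    using fg unfolding fin_gen_module_def by (elim exE conjE) (rule that)
  have gp: "g p \<in> carrier R" using lm_homD(1)[OF g p(1)] by simp
  \<comment> \<open>\<open>r = r g(p) + r c = g(r p) + r c\<close>, and \<open>r p\<close> lies in the kernel of \<open>e\<close> if \<open>r\<close> annihilates \<open>m\<close>\<close>
  define c where "c = \<one>\<^bsub>R\<^esub> \<ominus>\<^bsub>R\<^esub> g p"
  have c: "c \<in> carrier R" "g p \<oplus>\<^bsub>R\<^esub> c = \<one>\<^bsub>R\<^esub>"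
    using gp by (simp_all add: c_def M.R.minus_eq M.R.r_neg1 M.R.a_lcomm M.R.r_neg)
  have gd: "g \<circ> d 0 \<in> lm_hom R (P 1) ?R" by (rule lm_hom_compose[OF d g])
  have gd_I: "g (d 0 b) \<in> ?I" if "b \<in> carrier (P 1)" for b
  proof -
    have "d 0 b \<in> a_kernel (P 0) M e" using that exact by blast
    then show ?thesis using ge[of "d 0 b"] lm_homD(1)[OF g, of "d 0 b"] by (simp add: a_kernel_def')
  qed
  have "m = (g p \<oplus>\<^bsub>R\<^esub> c) \<odot>\<^bsub>M\<^esub> m" using m c by (simp add: M.smult_one)
  also have "\<dots> = m \<oplus>\<^bsub>M\<^esub> c \<odot>\<^bsub>M\<^esub> m" using c(1) gp m ge[OF p(1)] p(2) by (simp add: M.smult_l_distr)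
  finally have cI: "c \<in> ?I"
    using c(1) m M.M.add.l_cancel_one'[of m "c \<odot>\<^bsub>M\<^esub> m"] by (simp add: M.smult_closed)
  show ?thesis
    unfolding fin_gen_left_ideal_def
  proof (intro exI conjI allI impI)
    show "finite (insert c ((g \<circ> d 0) ` B))" using B by simp
    show "insert c ((g \<circ> d 0) ` B) \<subseteq> ?I" using cI gd_I B(2) by auto
    fix J assume "submodule J R ?R \<and> insert c ((g \<circ> d 0) ` B) \<subseteq> J"
    then have J: "submodule J R ?R" and cJ: "c \<in> J" and BJ: "(g \<circ> d 0) ` B \<subseteq> J" by auto
    have "submodule {x \<in> carrier (P 1). (g \<circ> d 0) x \<in> J} R (P 1)"
      by (rule left_module.submodule_vimage[OF P1 RR gd J])
    then have "{x \<in> carrier (P 1). (g \<circ> d 0) x \<in> J} = carrier (P 1)"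
      using B BJ by (intro B_span[rule_format] conjI) auto
    then have gdJ: "g (d 0 x) \<in> J" if "x \<in> carrier (P 1)" for x using that by auto
    show "?I \<subseteq> J"
    proof
      fix r assume r: "r \<in> ?I"
      have rp: "r \<odot>\<^bsub>P 0\<^esub> p \<in> carrier (P 0)"
        using r p left_module.smult_closed[OF P0'] by blast
      have "e (r \<odot>\<^bsub>P 0\<^esub> p) = \<zero>\<^bsub>M\<^esub>" using r p lm_homD(3)[OF e] by simp
      then have "r \<odot>\<^bsub>P 0\<^esub> p \<in> d 0 ` carrier (P 1)" using rp unfolding exact by (simp add: a_kernel_def')
      then have "g (r \<odot>\<^bsub>P 0\<^esub> p) \<in> J" using gdJ by auto
      then have 1: "r \<otimes>\<^bsub>R\<^esub> g p \<in> J" using r p lm_homD(3)[OF g] by simp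
      have 2: "r \<otimes>\<^bsub>R\<^esub> c \<in> J" using submoduleD(4)[OF J _ cJ, of r] r by simp
      have "r \<otimes>\<^bsub>R\<^esub> g p \<oplus>\<^bsub>R\<^esub> r \<otimes>\<^bsub>R\<^esub> c = r"
        using r c gp by (simp flip: M.R.r_distr)
      then show "r \<in> J" using submoduleD(3)[OF J 1 2] by simp
    qed
  qed
qed

lemma fin_gen_imp_cyclic_type_FP_1:
  assumes nontrivial: "\<one>\<^bsub>R\<^esub> \<noteq> \<zero>\<^bsub>R\<^esub>"
    and "fin_gen_left_ideal R {r \<in> carrier R. r \<odot>\<^bsub>M\<^esub> m = \<zero>\<^bsub>M\<^esub>}" (is "fin_gen_left_ideal R ?I")
  shows "type_FP 1 R M"
proof -
  obtain enc :: "('r list \<Rightarrow> 'r) \<Rightarrow> 'r list" where "inj_on enc {f. finite {x. f x \<noteq> \<zero>\<^bsub>R\<^esub>}}"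
    using finite_support_encoding[OF nontrivial] by blast
  then interpret encoded_free R enc by unfold_locales
  obtain B where B: "finite B" "B \<subseteq> ?I"
    and B_span: "\<forall>J. submodule J R (regular_module R) \<and> B \<subseteq> J \<longrightarrow> ?I \<subseteq> J"
    using assms(2) unfolding fin_gen_left_ideal_def by (elim exE conjE) (rule that)
  define X where "X = {[] :: 'r list}"
  define u where "u = enc (basis_elem R [])"
  define Y where "Y = (\<lambda>r. r \<odot>\<^bsub>FM X\<^esub> u) ` B"
  let ?e = "ext M X (\<lambda>_. m)" and ?d = "ext (FM X) Y (\<lambda>y. y)"
  interpret F: left_module R "FM X" by (rule FM_left_module)
  have v: "(\<lambda>_. m) ` X \<subseteq> carrier M" using m by auto
  have u: "u \<in> carrier (FM X)" unfolding u_def by (rule FM_basis) (simp add: X_def)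
  have e: "?e \<in> lm_hom R (FM X) M" by (rule ext_hom[OF M v])
  have eu: "?e (r \<odot>\<^bsub>FM X\<^esub> u) = r \<odot>\<^bsub>M\<^esub> m" if "r \<in> carrier R" for r
    using that u lm_homD(3)[OF e] ext_basis[OF M v, of "[]"] by (simp add: u_def X_def)
  have FX: "carrier (FM X) = (\<lambda>r. r \<odot>\<^bsub>FM X\<^esub> u) ` carrier R"
  proof (rule FM_spanned[symmetric])
    from left_module.submodule_image[OF M.R.regular_left_module FM_left_module F.smult_hom[OF u]]
    show "submodule ((\<lambda>r. r \<odot>\<^bsub>FM X\<^esub> u) ` carrier R) R (FM X)" by simp
    show "enc (basis_elem R x) \<in> (\<lambda>r. r \<odot>\<^bsub>FM X\<^esub> u) ` carrier R" if "x \<in> X" for x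
      by (rule image_eqI[of _ _ "\<one>\<^bsub>R\<^esub>"]) (use that F.smult_one[OF u] in \<open>auto simp: X_def u_def\<close>)
  qed
  have K: "submodule (a_kernel (FM X) M ?e) R (FM X)"
    by (rule F.submodule_a_kernel[OF M e])
  have YK: "Y \<subseteq> a_kernel (FM X) M ?e"
    using B(2) eu u by (auto simp: Y_def a_kernel_def' F.smult_closed)
  have Y: "(\<lambda>y. y) ` Y \<subseteq> carrier (FM X)" using YK submoduleD(1)[OF K] by auto
  show ?thesis
  proof (rule type_FP_1_presentation[OF M v])
    show "finite X" "finite Y" using B(1) by (simp_all add: X_def Y_def)
    show "Y \<subseteq> carrier (FM X)" using Y by simp
    show "?e ` carrier (FM X) = carrier M"
      unfolding FX cyclic using eu by (force simp: image_iff)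
    show "?d ` carrier (FM Y) = a_kernel (FM X) M ?e"
    proof
      show "?d ` carrier (FM Y) \<subseteq> a_kernel (FM X) M ?e"
        by (rule ext_image_subset[OF FM_left_module Y K]) (use YK in simp)
      have im: "submodule (?d ` carrier (FM Y)) R (FM X)"
        by (rule left_module.submodule_image[OF FM_left_module FM_left_module ext_hom[OF FM_left_module Y]])
      let ?J = "{r \<in> carrier R. r \<odot>\<^bsub>FM X\<^esub> u \<in> ?d ` carrier (FM Y)}"
      have "submodule ?J R (regular_module R)"
        by (rule left_module.submoduleI'[OF M.R.regular_left_module])
          (use u submoduleD[OF im] in
            \<open>simp_all add: F.smult_zero_left F.smult_l_distr F.smult_assoc\<close>)
      then have "?I \<subseteq> ?J"
        by (intro B_span[rule_format] conjI) (use B(2) ext_image_generators[OF FM_left_module Y] in \<open>auto simp: Y_def\<close>)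
      then show "a_kernel (FM X) M ?e \<subseteq> ?d ` carrier (FM Y)"
        using eu by (auto simp: a_kernel_def' FX)
    qed
  qed
qed

end


section \<open>Integral monoid rings\<close>

lemma frag_extend_diff_fun:
  "frag_extend (\<lambda>x. f x - g x) a = frag_extend f a - frag_extend g a"
proof -
  have "frag_cmul k (b - c) = frag_cmul k b - frag_cmul k c" for k and b c :: "'a \<Rightarrow>\<^sub>0 int"
    by (rule poly_mapping_eqI) (simp add: lookup_minus right_diff_distrib)
  then show ?thesis by (simp add: frag_extend_def sum_subtractf)
qed

lemma frag_extend_add_fun:
  "frag_extend (\<lambda>x. f x + g x) a = frag_extend f a + frag_extend g a"
  by (simp add: frag_extend_def frag_cmul_distrib2 sum.distrib)

text \<open>The augmentation is induced by the map of all elements to a one-element set.\<close>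

lemma augmentation_lookup: "augmentation a = Poly_Mapping.lookup (frag_extend (\<lambda>_. frag_of ()) a) ()"
  by (simp add: augmentation_def frag_extend_def lookup_sum)

lemma augmentation_simps [simp]:
  "augmentation 0 = 0" "augmentation (frag_of x) = 1"
  "augmentation (a + b) = augmentation a + augmentation b"
  "augmentation (a - b) = augmentation a - augmentation b"
  "augmentation (frag_cmul k a) = k * augmentation a"
  by (simp_all add: augmentation_lookup frag_extend_add frag_extend_diff frag_extend_cmul
      lookup_add lookup_minus)

lemma augmentation_frag_extend: "augmentation (frag_extend (frag_of \<circ> f) a) = augmentation a"
  using frag_extend_compose[of "\<lambda>_. frag_of ()" f a] by (simp only: augmentation_lookup comp_def)

lemma monoid_ring_simps [simp]:
  "carrier (monoid_ring H) = {c. Poly_Mapping.keys c \<subseteq> carrier H}"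
  "\<one>\<^bsub>monoid_ring H\<^esub> = frag_of \<one>\<^bsub>H\<^esub>" "\<zero>\<^bsub>monoid_ring H\<^esub> = 0" "a \<oplus>\<^bsub>monoid_ring H\<^esub> b = a + b"
  by (simp_all add: monoid_ring_def)

text \<open>The product in the monoid ring of \<open>H\<close>.\<close>

abbreviation mr_mult (infixl \<open>\<star>\<index>\<close> 70) where
  "a \<star>\<^bsub>H\<^esub> b \<equiv> a \<otimes>\<^bsub>monoid_ring H\<^esub> b"

lemma monoid_ring_mult:
  "a \<star>\<^bsub>H\<^esub> b = frag_extend (\<lambda>x. frag_extend (\<lambda>y. frag_of (x \<otimes>\<^bsub>H\<^esub> y)) b) a"
  by (simp add: monoid_ring_def)

lemma mr_mult_of_of [simp]: "frag_of x \<star>\<^bsub>H\<^esub> frag_of y = frag_of (x \<otimes>\<^bsub>H\<^esub> y)"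
  by (simp add: monoid_ring_mult)

lemma mr_mult_distrib:
  "0 \<star>\<^bsub>H\<^esub> b = 0" "a \<star>\<^bsub>H\<^esub> 0 = 0"
  "(a + b) \<star>\<^bsub>H\<^esub> c = a \<star>\<^bsub>H\<^esub> c + b \<star>\<^bsub>H\<^esub> c" "a \<star>\<^bsub>H\<^esub> (b + c) = a \<star>\<^bsub>H\<^esub> b + a \<star>\<^bsub>H\<^esub> c"
  "(a - b) \<star>\<^bsub>H\<^esub> c = a \<star>\<^bsub>H\<^esub> c - b \<star>\<^bsub>H\<^esub> c" "a \<star>\<^bsub>H\<^esub> (b - c) = a \<star>\<^bsub>H\<^esub> b - a \<star>\<^bsub>H\<^esub> c"
  by (simp_all add: monoid_ring_mult frag_extend_add frag_extend_diff frag_extend_add_fun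
      frag_extend_diff_fun frag_extend_eq_0)

lemma mr_keys_add: "Poly_Mapping.keys a \<subseteq> S \<Longrightarrow> Poly_Mapping.keys b \<subseteq> S \<Longrightarrow> Poly_Mapping.keys (a + b) \<subseteq> S"
  using keys_add[of a b] by blast

lemma mr_keys_diff:
  fixes a b :: "'a \<Rightarrow>\<^sub>0 int"
  shows "Poly_Mapping.keys a \<subseteq> S \<Longrightarrow> Poly_Mapping.keys b \<subseteq> S \<Longrightarrow> Poly_Mapping.keys (a - b) \<subseteq> S"
  using keys_diff[of a b] by blast

lemma mr_keys_extend:
  "Poly_Mapping.keys a \<subseteq> S \<Longrightarrow> (\<And>x. x \<in> S \<Longrightarrow> Poly_Mapping.keys (f x) \<subseteq> T) \<Longrightarrow> Poly_Mapping.keys (frag_extend f a) \<subseteq> T"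
  using keys_frag_extend[of f a] by blast

context monoid
begin

lemma mr_mult_closed:
  "Poly_Mapping.keys a \<subseteq> carrier G \<Longrightarrow> Poly_Mapping.keys b \<subseteq> carrier G \<Longrightarrow> Poly_Mapping.keys (a \<star>\<^bsub>G\<^esub> b) \<subseteq> carrier G"
  unfolding monoid_ring_mult by (intro mr_keys_extend[of _ "carrier G"]) auto

lemma mr_mult_assoc:
  assumes "Poly_Mapping.keys a \<subseteq> carrier G" and "Poly_Mapping.keys b \<subseteq> carrier G" and "Poly_Mapping.keys c \<subseteq> carrier G"
  shows "(a \<star>\<^bsub>G\<^esub> b) \<star>\<^bsub>G\<^esub> c = a \<star>\<^bsub>G\<^esub> (b \<star>\<^bsub>G\<^esub> c)"
  using assms(1)
proof (induction a rule: frag_induction)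
  case (one x)
  show ?case using assms(2)
  proof (induction b rule: frag_induction)
    case (one y)
    show ?case using assms(3)
      by (induction c rule: frag_induction)
        (use \<open>x \<in> carrier G\<close> \<open>y \<in> carrier G\<close> in \<open>simp_all add: mr_mult_distrib m_assoc\<close>)
  qed (simp_all add: mr_mult_distrib)
qed (simp_all add: mr_mult_distrib)

lemma mr_mult_one:
  assumes "Poly_Mapping.keys a \<subseteq> carrier G"
  shows "frag_of \<one> \<star>\<^bsub>G\<^esub> a = a" and "a \<star>\<^bsub>G\<^esub> frag_of \<one> = a"
  using assms by (induction a rule: frag_induction) (simp_all add: mr_mult_distrib)

lemma ring_monoid_ring: "ring (monoid_ring G)"
proof (rule ringI)
  show "abelian_group (monoid_ring G)"
  proof (rule abelian_groupI)
    fix x assume "x \<in> carrier (monoid_ring G)"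
    then show "\<exists>y\<in>carrier (monoid_ring G). y \<oplus>\<^bsub>monoid_ring G\<^esub> x = \<zero>\<^bsub>monoid_ring G\<^esub>"
      by (intro bexI[of _ "- x"]) auto
  qed (auto simp: ac_simps dest: subsetD[OF keys_add])
  show "Group.monoid (monoid_ring G)"
    by (rule monoidI) (simp_all add: mr_mult_closed mr_mult_assoc mr_mult_one)
qed (simp_all add: mr_mult_distrib)

lemma augmentation_mult:
  assumes "Poly_Mapping.keys a \<subseteq> carrier G" and "Poly_Mapping.keys b \<subseteq> carrier G"
  shows "augmentation (a \<star>\<^bsub>G\<^esub> b) = augmentation a * augmentation b"
  using assms(1)
proof (induction a rule: frag_induction)
  case (one x)
  show ?case using assms(2)
    by (induction b rule: frag_induction) (simp_all add: mr_mult_distrib algebra_simps)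
qed (simp_all add: mr_mult_distrib algebra_simps)

lemma trivial_left_module: "left_module (monoid_ring G) trivial_module"
proof -
  interpret R: ring "monoid_ring G" by (rule ring_monoid_ring)
  interpret abelian_group "trivial_module :: ('a \<Rightarrow>\<^sub>0 int, int) module"
    by (rule abelian_groupI) (auto simp: trivial_module_def intro: exI[of _ "- x" for x])
  show ?thesis
    by unfold_locales (auto simp: trivial_module_def augmentation_mult algebra_simps)
qed

end

text \<open>The augmentation ideal of the monoid ring.\<close>

definition aug_ideal :: "('h, 'm) monoid_scheme \<Rightarrow> ('h \<Rightarrow>\<^sub>0 int) set" where
  "aug_ideal H = {c. Poly_Mapping.keys c \<subseteq> carrier H \<and> augmentation c = 0}"

lemma trivial_type_FP_1_iff:
  assumes "Group.monoid H"
  shows "type_FP 1 (monoid_ring H) trivial_module \<longleftrightarrow> fin_gen_left_ideal (monoid_ring H) (aug_ideal H)"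
proof -
  interpret Group.monoid H by fact
  let ?M = "trivial_module :: ('a \<Rightarrow>\<^sub>0 int, int) module"
  have M: "carrier ?M = UNIV" "a \<odot>\<^bsub>?M\<^esub> 1 = augmentation a" "\<zero>\<^bsub>?M\<^esub> = 0" for a
    by (simp_all add: trivial_module_def)
  have "k \<in> augmentation ` carrier (monoid_ring H)" for k
    by (rule image_eqI[of _ _ "frag_cmul k (frag_of \<one>\<^bsub>H\<^esub>)"]) auto
  then have cyclic: "carrier ?M = (\<lambda>a. a \<odot>\<^bsub>?M\<^esub> 1) ` carrier (monoid_ring H)"
    unfolding M by blast
  have I: "aug_ideal H = {a \<in> carrier (monoid_ring H). a \<odot>\<^bsub>?M\<^esub> 1 = \<zero>\<^bsub>?M\<^esub>}"
    by (auto simp: aug_ideal_def M)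
  have one: "1 \<in> carrier ?M" by (simp add: M)
  show ?thesis
    unfolding I using cyclic_type_FP_1_imp[OF trivial_left_module one cyclic]
      fin_gen_imp_cyclic_type_FP_1[OF trivial_left_module one cyclic] by auto
qed

text \<open>Left ideals of the monoid ring, in terms of the operations of polynomial mappings.\<close>

definition mr_left_ideal :: "('h, 'm) monoid_scheme \<Rightarrow> ('h \<Rightarrow>\<^sub>0 int) set \<Rightarrow> bool" where
  "mr_left_ideal H J \<longleftrightarrow> J \<subseteq> {c. Poly_Mapping.keys c \<subseteq> carrier H} \<and> 0 \<in> J \<and>
    (\<forall>a\<in>J. \<forall>b\<in>J. a + b \<in> J) \<and> (\<forall>a b. Poly_Mapping.keys a \<subseteq> carrier H \<longrightarrow> b \<in> J \<longrightarrow> a \<star>\<^bsub>H\<^esub> b \<in> J)"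

lemma mr_left_idealD:
  assumes "mr_left_ideal H J"
  shows "a \<in> J \<Longrightarrow> Poly_Mapping.keys a \<subseteq> carrier H" and "0 \<in> J" and "a \<in> J \<Longrightarrow> b \<in> J \<Longrightarrow> a + b \<in> J"
    and "Poly_Mapping.keys a \<subseteq> carrier H \<Longrightarrow> b \<in> J \<Longrightarrow> a \<star>\<^bsub>H\<^esub> b \<in> J"
  using assms by (auto simp: mr_left_ideal_def)

context monoid
begin

lemma submodule_monoid_ring_iff:
  "submodule J (monoid_ring G) (regular_module (monoid_ring G)) \<longleftrightarrow> mr_left_ideal G J"
proof
  assume J: "submodule J (monoid_ring G) (regular_module (monoid_ring G))"
  show "mr_left_ideal G J"
    using submoduleD[OF J] by (auto simp: mr_left_ideal_def)
next
  assume J: "mr_left_ideal G J"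
  show "submodule J (monoid_ring G) (regular_module (monoid_ring G))"
    by (rule left_module.submoduleI'[OF ring.regular_left_module[OF ring_monoid_ring]])
      (use J in \<open>auto simp: mr_left_ideal_def\<close>)
qed

lemma mr_left_ideal_diff:
  assumes J: "mr_left_ideal G J" and "a \<in> J" and "b \<in> J"
  shows "a - b \<in> J"
proof -
  have "(0 - frag_of \<one>) \<star>\<^bsub>G\<^esub> b = - b"
    using mr_mult_one(1)[OF mr_left_idealD(1)[OF J assms(3)]] by (simp only: mr_mult_distrib) simp
  then have "- b \<in> J"
    using mr_left_idealD(4)[OF J _ assms(3), of "0 - frag_of \<one>"] by simp
  then show ?thesis using mr_left_idealD(3)[OF J assms(2), of "- b"] by simp
qed

lemma fin_gen_aug_ideal_iff:
  "fin_gen_left_ideal (monoid_ring G) (aug_ideal G) \<longleftrightarrow>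
    (\<exists>B. finite B \<and> B \<subseteq> aug_ideal G \<and> (\<forall>J. mr_left_ideal G J \<and> B \<subseteq> J \<longrightarrow> aug_ideal G \<subseteq> J))"
  unfolding fin_gen_left_ideal_def submodule_monoid_ring_iff ..

end


section \<open>The augmentation ideal under an epimorphism of monoids\<close>

text \<open>An epimorphism \<open>f\<close> of monoids and the homomorphism \<open>push\<close> of monoid rings that it induces.\<close>

locale monoid_epi = M?: Group.monoid M + N?: Group.monoid N for M (structure) and N (structure) +
  fixes f
  assumes f_hom: "f \<in> hom M N" and f_one: "f \<one>\<^bsub>M\<^esub> = \<one>\<^bsub>N\<^esub>" and onto: "f ` carrier M = carrier N"
begin

definition push where "push = frag_extend (frag_of \<circ> f)"

text \<open>An additive section of \<open>push\<close>, induced by a choice of preimages under \<open>f\<close>.\<close>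

definition lift where "lift = frag_extend (frag_of \<circ> inv_into (carrier M) f)"

lemma f_closed: "x \<in> carrier M \<Longrightarrow> f x \<in> carrier N"
  using onto by blast

lemma push_simps:
  "push 0 = 0" "push (frag_of x) = frag_of (f x)"
  "push (a + b) = push a + push b" "push (a - b) = push a - push b"
  by (simp_all add: push_def frag_extend_add frag_extend_diff)

lemma push_closed: "Poly_Mapping.keys a \<subseteq> carrier M \<Longrightarrow> Poly_Mapping.keys (push a) \<subseteq> carrier N"
  unfolding push_def by (rule mr_keys_extend) (auto simp: f_closed)

lemma lift_closed: "Poly_Mapping.keys a \<subseteq> carrier N \<Longrightarrow> Poly_Mapping.keys (lift a) \<subseteq> carrier M"
  unfolding lift_def by (rule mr_keys_extend) (auto simp: onto inv_into_into)

lemma push_lift: "Poly_Mapping.keys a \<subseteq> carrier N \<Longrightarrow> push (lift a) = a"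
  unfolding push_def lift_def frag_extend_compose
  by (subst (2) frag_expansion, rule frag_extend_eq) (auto simp: onto f_inv_into_f subset_iff)

lemma push_mult:
  assumes "Poly_Mapping.keys a \<subseteq> carrier M" and "Poly_Mapping.keys b \<subseteq> carrier M"
  shows "push (a \<star>\<^bsub>M\<^esub> b) = push a \<star>\<^bsub>N\<^esub> push b"
  using assms(1)
proof (induction a rule: frag_induction)
  case (one x)
  show ?case using assms(2)
    by (induction b rule: frag_induction)
      (use one f_hom in \<open>simp_all add: push_simps mr_mult_distrib hom_def\<close>)
qed (simp_all add: push_simps mr_mult_distrib)

lemma push_aug_ideal: "a \<in> aug_ideal M \<Longrightarrow> push a \<in> aug_ideal N"
  using push_closed by (auto simp: aug_ideal_def push_def augmentation_frag_extend)

lemma lift_aug_ideal: "a \<in> aug_ideal N \<Longrightarrow> lift a \<in> aug_ideal M"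
  using lift_closed by (auto simp: aug_ideal_def lift_def augmentation_frag_extend)

lemma fin_gen_push:
  assumes "fin_gen_left_ideal (monoid_ring M) (aug_ideal M)"
  shows "fin_gen_left_ideal (monoid_ring N) (aug_ideal N)"
proof -
  obtain B where B: "finite B" "B \<subseteq> aug_ideal M"
    and span: "\<forall>J. mr_left_ideal M J \<and> B \<subseteq> J \<longrightarrow> aug_ideal M \<subseteq> J"
    using assms M.fin_gen_aug_ideal_iff by auto
  have "aug_ideal N \<subseteq> J" if J: "mr_left_ideal N J" and BJ: "push ` B \<subseteq> J" for J
  proof
    fix a assume a: "a \<in> aug_ideal N"
    let ?K = "{c. Poly_Mapping.keys c \<subseteq> carrier M \<and> push c \<in> J}"
    have "mr_left_ideal M ?K"
      unfolding mr_left_ideal_def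
    proof (intro conjI ballI allI impI)
      show "0 \<in> ?K" using mr_left_idealD(2)[OF J] by (simp add: push_simps)
      show "c + d \<in> ?K" if "c \<in> ?K" "d \<in> ?K" for c d
        using that mr_left_idealD(3)[OF J] by (simp add: push_simps mr_keys_add)
      show "c \<star>\<^bsub>M\<^esub> d \<in> ?K" if "Poly_Mapping.keys c \<subseteq> carrier M" "d \<in> ?K" for c d
        using that mr_left_idealD(4)[OF J push_closed[OF that(1)]]
        by (simp add: push_mult M.mr_mult_closed)
    qed blast
    moreover have "B \<subseteq> ?K" using B BJ by (auto simp: aug_ideal_def)
    ultimately have "lift a \<in> ?K" using span lift_aug_ideal[OF a] by blast
    then show "a \<in> J" using a by (simp add: push_lift aug_ideal_def)
  qed
  then show ?thesis
    unfolding N.fin_gen_aug_ideal_iff using B push_aug_ideal by (intro exI[of _ "push ` B"]) auto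
qed

text \<open>Conversely, finite generation of the augmentation ideal can be lifted if there is a finitely
  generated left ideal that contains the differences of elements in the same fibre of \<open>f\<close>: modulo a left
  ideal with this property, every \<open>c\<close> is congruent to \<open>lift (push c)\<close>.\<close>

lemma fin_gen_lift:
  assumes "fin_gen_left_ideal (monoid_ring N) (aug_ideal N)"
    and B0: "finite B0" "B0 \<subseteq> aug_ideal M"
    and fibres: "\<And>J x y. \<lbrakk>mr_left_ideal M J; B0 \<subseteq> J; x \<in> carrier M; y \<in> carrier M; f x = f y\<rbrakk> \<Longrightarrow>
      frag_of x - frag_of y \<in> J"
  shows "fin_gen_left_ideal (monoid_ring M) (aug_ideal M)"
proof -
  obtain B where B: "finite B" "B \<subseteq> aug_ideal N"
    and span: "\<forall>J. mr_left_ideal N J \<and> B \<subseteq> J \<longrightarrow> aug_ideal N \<subseteq> J"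
    using assms(1) N.fin_gen_aug_ideal_iff by auto
  have "aug_ideal M \<subseteq> J" if J: "mr_left_ideal M J" and BJ: "B0 \<union> lift ` B \<subseteq> J" for J
  proof
    fix a assume a: "a \<in> aug_ideal M"
    have lift_push: "c - lift (push c) \<in> J" if "Poly_Mapping.keys c \<subseteq> carrier M" for c
      using that
    proof (induction c rule: frag_induction)
      case zero
      then show ?case using mr_left_idealD(2)[OF J] by (simp add: push_simps lift_def)
    next
      case (one x)
      then have "f (inv_into (carrier M) f (f x)) = f x" "inv_into (carrier M) f (f x) \<in> carrier M"
        by (simp_all add: f_inv_into_f inv_into_into)
      then show ?case using fibres[OF J, of x] one BJ by (simp add: push_simps lift_def)
    next
      case (diff c d)
      have "(c - d) - lift (push (c - d)) = (c - lift (push c)) - (d - lift (push d))"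
        by (simp add: push_simps lift_def frag_extend_diff)
      then show ?case using M.mr_left_ideal_diff[OF J diff] by (simp only:)
    qed
    have "mr_left_ideal N (push ` J)"
      unfolding mr_left_ideal_def
    proof (intro conjI ballI allI impI)
      show "push ` J \<subseteq> {c. Poly_Mapping.keys c \<subseteq> carrier N}"
        using mr_left_idealD(1)[OF J] push_closed by blast
      show "0 \<in> push ` J" using mr_left_idealD(2)[OF J] push_simps(1) by (metis imageI)
      show "c + d \<in> push ` J" if "c \<in> push ` J" "d \<in> push ` J" for c d
        using that mr_left_idealD(3)[OF J] push_simps(3) by (auto simp: image_iff) metis
      show "c \<star>\<^bsub>N\<^esub> d \<in> push ` J" if c: "Poly_Mapping.keys c \<subseteq> carrier N" and d: "d \<in> push ` J" for c d
      proof -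
        obtain j where j: "j \<in> J" "d = push j" using d by blast
        have "c \<star>\<^bsub>N\<^esub> d = push (lift c \<star>\<^bsub>M\<^esub> j)"
          using j c mr_left_idealD(1)[OF J] by (simp add: push_mult push_lift lift_closed)
        then show ?thesis using mr_left_idealD(4)[OF J lift_closed[OF c] j(1)] by simp
      qed
    qed
    moreover have "B \<subseteq> push ` J"
    proof
      fix b assume "b \<in> B"
      then have "b = push (lift b)" "lift b \<in> J" using B BJ by (auto simp: push_lift aug_ideal_def)
      then show "b \<in> push ` J" by blast
    qed
    ultimately have "push a \<in> push ` J" using span push_aug_ideal[OF a] by blast
    then obtain j where j: "j \<in> J" "push a = push j" by blast
    have "Poly_Mapping.keys (a - j) \<subseteq> carrier M"
      using a mr_left_idealD(1)[OF J j(1)] by (intro mr_keys_diff) (auto simp: aug_ideal_def)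
    from lift_push[OF this] have "a - j \<in> J" using j by (simp add: push_simps lift_def)
    from mr_left_idealD(3)[OF J this j(1)] show "a \<in> J" by simp
  qed
  moreover have "finite (B0 \<union> lift ` B)" "B0 \<union> lift ` B \<subseteq> aug_ideal M"
    using B B0 lift_aug_ideal by auto
  ultimately show ?thesis
    unfolding M.fin_gen_aug_ideal_iff by blast
qed

end


section \<open>Central elements in the kernel of a character\<close>

lemma monoid_char_monoid:
  assumes "group H" and "\<And>x y. x \<in> carrier H \<Longrightarrow> y \<in> carrier H \<Longrightarrow> \<chi> (x \<otimes>\<^bsub>H\<^esub> y) = \<chi> x + \<chi> y"
  shows "Group.monoid (char_monoid H \<chi>)"
proof -
  interpret group H by fact
  have "\<chi> \<one>\<^bsub>H\<^esub> = 0" using assms(2)[of "\<one>\<^bsub>H\<^esub>" "\<one>\<^bsub>H\<^esub>"] by simp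
  then show ?thesis
    by unfold_locales (auto simp: char_monoid_def assms(2) m_assoc)
qed

lemma char_monoid_simps [simp]:
  "carrier (char_monoid H \<chi>) = {h \<in> carrier H. 0 \<le> \<chi> h}"
  "x \<otimes>\<^bsub>char_monoid H \<chi>\<^esub> y = x \<otimes>\<^bsub>H\<^esub> y" "\<one>\<^bsub>char_monoid H \<chi>\<^esub> = \<one>\<^bsub>H\<^esub>"
  by (simp_all add: char_monoid_def)

text \<open>In a finitely generated group, a central element \<open>z\<close> in the kernel of a non-zero character
  can be joined to the identity in the part of the Cayley graph where the character is
  non-negative: a path from \<open>1\<close> to \<open>z\<close> is moved into that part by a power of an element \<open>t\<close>
  on which the character is positive, and the ends of the new path, \<open>t^m\<close> and \<open>t^m z = z t^m\<close>,
  are joined to \<open>1\<close> and \<open>z\<close>.  Algebraically, \<open>x\<close> and \<open>y\<close> are joined if \<open>x - y\<close> lies in the left ideal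
  generated by the elements \<open>s - 1\<close> with \<open>s\<close> in a finite generating set and \<open>\<chi> s \<ge> 0\<close>.\<close>

lemma central_in_fin_gen_left_ideal:
  fixes \<chi> :: "'h \<Rightarrow> real"
  assumes "group H" and "fin_gen_group H"
    and add: "\<And>x y. x \<in> carrier H \<Longrightarrow> y \<in> carrier H \<Longrightarrow> \<chi> (x \<otimes>\<^bsub>H\<^esub> y) = \<chi> x + \<chi> y"
    and "\<exists>x\<in>carrier H. \<chi> x \<noteq> 0"
  obtains B where "finite B" and "B \<subseteq> aug_ideal (char_monoid H \<chi>)"
    and "\<And>J z. \<lbrakk>mr_left_ideal (char_monoid H \<chi>) J; B \<subseteq> J; z \<in> carrier H; \<chi> z = 0;
      \<forall>x\<in>carrier H. z \<otimes>\<^bsub>H\<^esub> x = x \<otimes>\<^bsub>H\<^esub> z\<rbrakk> \<Longrightarrow> frag_of z - frag_of \<one>\<^bsub>H\<^esub> \<in> J"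
proof -
  interpret group H by fact
  let ?M = "char_monoid H \<chi>"
  interpret M: Group.monoid ?M by (rule monoid_char_monoid) (use assms add in auto)
  have one: "\<chi> \<one>\<^bsub>H\<^esub> = 0" using add[of "\<one>\<^bsub>H\<^esub>" "\<one>\<^bsub>H\<^esub>"] by simp
  have inv: "\<chi> (inv\<^bsub>H\<^esub> x) = - \<chi> x" if "x \<in> carrier H" for x
    using add[of "inv\<^bsub>H\<^esub> x" x] that one by simp
  obtain A where A: "finite A" "A \<subseteq> carrier H" "generate H A = carrier H"
    using assms(2) by (auto simp: fin_gen_group_def)
  obtain t where t: "t \<in> carrier H" "0 < \<chi> t"
  proof -
    obtain x where x: "x \<in> carrier H" "\<chi> x \<noteq> 0" using assms(4) by blast
    show ?thesis
    proof (cases "0 < \<chi> x")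
      case True
      then show ?thesis using that x by blast
    next
      case False
      then show ?thesis using that[of "inv\<^bsub>H\<^esub> x"] x by (simp add: inv)
    qed
  qed
  define S where "S = {s \<in> insert t (A \<union> (\<lambda>x. inv\<^bsub>H\<^esub> x) ` A). 0 \<le> \<chi> s}"
  define B where "B = (\<lambda>s. frag_of s - frag_of \<one>\<^bsub>H\<^esub>) ` S"
  have S: "S \<subseteq> carrier ?M" using A t by (auto simp: S_def)
  show ?thesis
  proof (rule that)
    show "finite B" using A by (simp add: B_def S_def)
    show "B \<subseteq> aug_ideal ?M"
      unfolding B_def aug_ideal_def
      by (intro image_subsetI CollectI conjI mr_keys_diff) (use S one in auto)
    fix J z
    assume J: "mr_left_ideal ?M J" and BJ: "B \<subseteq> J" and z: "z \<in> carrier H" "\<chi> z = 0"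
      and central: "\<forall>x\<in>carrier H. z \<otimes>\<^bsub>H\<^esub> x = x \<otimes>\<^bsub>H\<^esub> z"
    define rel where "rel x y \<longleftrightarrow> frag_of x - frag_of y \<in> J" for x y
    have rel_refl: "rel x x" for x
      using mr_left_idealD(2)[OF J] by (simp add: rel_def)
    have rel_sym: "rel y x" if "rel x y" for x y
      using M.mr_left_ideal_diff[OF J mr_left_idealD(2)[OF J]] that by (fastforce simp: rel_def)
    have rel_trans: "rel x w" if "rel x y" "rel y w" for x y w
      using mr_left_idealD(3)[OF J, of "frag_of x - frag_of y" "frag_of y - frag_of w"] that
      by (simp add: rel_def)
    have rel_mult: "rel (p \<otimes>\<^bsub>H\<^esub> x) (p \<otimes>\<^bsub>H\<^esub> y)" if "rel x y" "p \<in> carrier H" "0 \<le> \<chi> p" for p x y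
      using mr_left_idealD(4)[OF J, of "frag_of p"] that by (fastforce simp: rel_def mr_mult_distrib)
    have rel_S: "rel p (p \<otimes>\<^bsub>H\<^esub> s)" if "p \<in> carrier H" "0 \<le> \<chi> p" "s \<in> S" for p s
    proof -
      have "rel s \<one>\<^bsub>H\<^esub>" using BJ that(3) by (auto simp: rel_def B_def)
      from rel_mult[OF this that(1,2)] show ?thesis using that(1) rel_sym by simp
    qed
    \<comment> \<open>edges, and then paths, whose starting point is sufficiently far inside the half \<open>\<chi> \<ge> 0\<close>\<close>
    have step: "\<exists>r. \<forall>p\<in>carrier H. r \<le> \<chi> p \<longrightarrow> 0 \<le> \<chi> p \<and> 0 \<le> \<chi> (p \<otimes>\<^bsub>H\<^esub> s) \<and> rel p (p \<otimes>\<^bsub>H\<^esub> s)"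
      if s: "s \<in> A \<union> (\<lambda>x. inv\<^bsub>H\<^esub> x) ` A" for s
    proof -
      have sH: "s \<in> carrier H" "inv\<^bsub>H\<^esub> s \<in> A \<union> (\<lambda>x. inv\<^bsub>H\<^esub> x) ` A" using s A(2) by auto
      show ?thesis
      proof (cases "0 \<le> \<chi> s")
        case True
        then have "s \<in> S" using s by (simp add: S_def)
        then show ?thesis using rel_S True sH by (intro exI[of _ 0]) (simp add: add)
      next
        case False
        then have iS: "inv\<^bsub>H\<^esub> s \<in> S" using sH by (simp add: S_def inv)
        have "rel p (p \<otimes>\<^bsub>H\<^esub> s)" if "p \<in> carrier H" "- \<chi> s \<le> \<chi> p" for p
          using rel_S[of "p \<otimes>\<^bsub>H\<^esub> s", OF _ _ iS] that sH rel_sym by (simp add: add m_assoc)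
        then show ?thesis using False sH by (intro exI[of _ "- \<chi> s"]) (simp add: add)
      qed
    qed
    have path: "\<exists>r. \<forall>p\<in>carrier H. r \<le> \<chi> p \<longrightarrow> 0 \<le> \<chi> p \<and> 0 \<le> \<chi> (p \<otimes>\<^bsub>H\<^esub> w) \<and> rel p (p \<otimes>\<^bsub>H\<^esub> w)"
      if "w \<in> generate H A" for w
      using that
    proof (induction w rule: generate.induct)
      case one
      then show ?case by (intro exI[of _ 0]) (simp add: rel_refl)
    next
      case (eng u w)
      obtain r r' where
        r: "\<forall>p\<in>carrier H. r \<le> \<chi> p \<longrightarrow> 0 \<le> \<chi> p \<and> 0 \<le> \<chi> (p \<otimes>\<^bsub>H\<^esub> u) \<and> rel p (p \<otimes>\<^bsub>H\<^esub> u)" and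
        r': "\<forall>p\<in>carrier H. r' \<le> \<chi> p \<longrightarrow> 0 \<le> \<chi> p \<and> 0 \<le> \<chi> (p \<otimes>\<^bsub>H\<^esub> w) \<and> rel p (p \<otimes>\<^bsub>H\<^esub> w)"
        using eng.IH by blast
      have uw: "u \<in> carrier H" "w \<in> carrier H" using eng.hyps A(3) by auto
      show ?case
      proof (intro exI ballI impI)
        fix p assume p: "p \<in> carrier H" "max r (r' - \<chi> u) \<le> \<chi> p"
        then have "r' \<le> \<chi> (p \<otimes>\<^bsub>H\<^esub> u)" using uw by (simp add: add)
        then have "0 \<le> \<chi> (p \<otimes>\<^bsub>H\<^esub> u \<otimes>\<^bsub>H\<^esub> w) \<and> rel (p \<otimes>\<^bsub>H\<^esub> u) (p \<otimes>\<^bsub>H\<^esub> u \<otimes>\<^bsub>H\<^esub> w)"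
          using r' uw p(1) by simp
        moreover have "0 \<le> \<chi> p \<and> rel p (p \<otimes>\<^bsub>H\<^esub> u)" using r p by simp
        ultimately show "0 \<le> \<chi> p \<and> 0 \<le> \<chi> (p \<otimes>\<^bsub>H\<^esub> (u \<otimes>\<^bsub>H\<^esub> w)) \<and> rel p (p \<otimes>\<^bsub>H\<^esub> (u \<otimes>\<^bsub>H\<^esub> w))"
          using uw p(1) rel_trans by (simp add: m_assoc) blast
      qed
    qed (use step in blast)+
    obtain r where r: "\<forall>p\<in>carrier H. r \<le> \<chi> p \<longrightarrow> 0 \<le> \<chi> p \<and> 0 \<le> \<chi> (p \<otimes>\<^bsub>H\<^esub> z) \<and> rel p (p \<otimes>\<^bsub>H\<^esub> z)"
      using path z(1) A(3) by blast
    have pow: "\<chi> (t [^]\<^bsub>H\<^esub> m) = real m * \<chi> t" for m :: nat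
      using t(1) by (induction m) (simp_all add: one add algebra_simps)
    have tS: "t \<in> S" using t(2) by (simp add: S_def)
    have rel_pow: "rel (t [^]\<^bsub>H\<^esub> m) \<one>\<^bsub>H\<^esub>" for m :: nat
    proof (induction m)
      case 0
      then show ?case by (simp add: rel_refl)
    next
      case (Suc m)
      have "rel (t [^]\<^bsub>H\<^esub> m) (t [^]\<^bsub>H\<^esub> m \<otimes>\<^bsub>H\<^esub> t)"
        using t by (intro rel_S tS) (auto simp: pow)
      then show ?case using Suc rel_sym rel_trans by (metis nat_pow_Suc)
    qed
    obtain m :: nat where "r \<le> real m * \<chi> t"
      using reals_Archimedean3[OF t(2)] less_imp_le by blast
    then have "rel (t [^]\<^bsub>H\<^esub> m) (t [^]\<^bsub>H\<^esub> m \<otimes>\<^bsub>H\<^esub> z)" using r t(1) by (simp add: pow)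
    moreover have "t [^]\<^bsub>H\<^esub> m \<otimes>\<^bsub>H\<^esub> z = z \<otimes>\<^bsub>H\<^esub> t [^]\<^bsub>H\<^esub> m" using central t(1) by simp
    moreover have "rel (z \<otimes>\<^bsub>H\<^esub> t [^]\<^bsub>H\<^esub> m) z"
      using rel_mult[OF rel_pow[of m], of z] z by simp
    ultimately have "rel (t [^]\<^bsub>H\<^esub> m) z" using rel_trans by metis
    then have "rel z \<one>\<^bsub>H\<^esub>" using rel_pow[of m] rel_sym rel_trans by blast
    then show "frag_of z - frag_of \<one>\<^bsub>H\<^esub> \<in> J" by (simp add: rel_def)
  qed
qed


section \<open>The first Sigma invariant of a central extension\<close>

lemma charactersD:
  assumes "\<chi> \<in> characters H"
  shows "x \<in> carrier H \<Longrightarrow> y \<in> carrier H \<Longrightarrow> \<chi> (x \<otimes>\<^bsub>H\<^esub> y) = \<chi> x + \<chi> y"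
    and "\<exists>x\<in>carrier H. \<chi> x \<noteq> 0" and "\<chi> \<in> extensional (carrier H)"
  using assms by (auto simp: characters_def)

lemma equiv_char_rel: "equiv (characters H) (char_rel H)"
proof (rule equivI)
  show "char_rel H \<subseteq> characters H \<times> characters H" by (auto simp: char_rel_def)
  show "refl_on (characters H) (char_rel H)"
    by (auto simp: refl_on_def char_rel_def intro!: exI[of _ 1])
  show "sym (char_rel H)"
  proof (rule symI)
    fix \<chi> \<psi> assume "(\<chi>, \<psi>) \<in> char_rel H"
    then obtain c where "c > 0" "\<forall>x\<in>carrier H. \<psi> x = c * \<chi> x" "\<chi> \<in> characters H" "\<psi> \<in> characters H"
      by (auto simp: char_rel_def)
    then show "(\<psi>, \<chi>) \<in> char_rel H"
      by (auto simp: char_rel_def intro!: exI[of _ "inverse c"])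
  qed
  show "trans (char_rel H)"
  proof (rule transI)
    fix \<chi> \<psi> \<xi> assume "(\<chi>, \<psi>) \<in> char_rel H" "(\<psi>, \<xi>) \<in> char_rel H"
    then obtain c d where "c > 0" "\<forall>x\<in>carrier H. \<psi> x = c * \<chi> x" "d > 0" "\<forall>x\<in>carrier H. \<xi> x = d * \<psi> x"
      "\<chi> \<in> characters H" "\<xi> \<in> characters H"
      by (auto simp: char_rel_def)
    then show "(\<chi>, \<xi>) \<in> char_rel H"
      by (auto simp: char_rel_def intro!: exI[of _ "d * c"])
  qed
qed

text \<open>An epimorphism on whose kernel all characters vanish identifies the character spheres.\<close>

locale character_epi = group_hom H K f for H (structure) and K (structure) and f +
  assumes onto: "f ` carrier H = carrier K"
    and vanish: "\<And>\<chi> w. \<chi> \<in> characters H \<Longrightarrow> w \<in> carrier H \<Longrightarrow> f w = \<one>\<^bsub>K\<^esub> \<Longrightarrow> \<chi> w = 0"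
begin

text \<open>The pullback of a character along \<open>f\<close>; \<open>sphere_pullback H f\<close> is the induced map of classes.\<close>

definition pullback :: "('c \<Rightarrow> real) \<Rightarrow> 'a \<Rightarrow> real" where
  "pullback \<chi> = restrict (\<chi> \<circ> f) (carrier H)"

lemma pullback_apply [simp]: "x \<in> carrier H \<Longrightarrow> pullback \<chi> x = \<chi> (f x)"
  by (simp add: pullback_def)

lemma pullback_character:
  assumes \<chi>: "\<chi> \<in> characters K"
  shows "pullback \<chi> \<in> characters H"
proof -
  obtain y where "y \<in> carrier K" "\<chi> y \<noteq> 0" using charactersD(2)[OF \<chi>] by blast
  then have "\<exists>x\<in>carrier H. \<chi> (f x) \<noteq> 0" unfolding onto[symmetric] by blast
  then show ?thesis using charactersD(1)[OF \<chi>] by (auto simp: characters_def pullback_def)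
qed

lemma pullback_onto:
  assumes \<psi>: "\<psi> \<in> characters H"
  obtains \<chi> where "\<chi> \<in> characters K" and "pullback \<chi> = \<psi>"
proof -
  let ?s = "inv_into (carrier H) f"
  have s: "?s y \<in> carrier H" "f (?s y) = y" if "y \<in> carrier K" for y
    using that by (simp_all add: onto inv_into_into f_inv_into_f)
  have eq: "\<psi> x = \<psi> y" if "x \<in> carrier H" "y \<in> carrier H" "f x = f y" for x y
  proof -
    have "\<psi> (x \<otimes>\<^bsub>H\<^esub> inv\<^bsub>H\<^esub> y) = 0" using vanish[OF \<psi>, of "x \<otimes>\<^bsub>H\<^esub> inv\<^bsub>H\<^esub> y"] that by simp
    moreover have "\<psi> x = \<psi> (x \<otimes>\<^bsub>H\<^esub> inv\<^bsub>H\<^esub> y) + \<psi> y"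
      using charactersD(1)[OF \<psi>, of "x \<otimes>\<^bsub>H\<^esub> inv\<^bsub>H\<^esub> y" y] that by (simp add: G.m_assoc)
    ultimately show ?thesis by simp
  qed
  define \<chi> where "\<chi> = restrict (\<psi> \<circ> ?s) (carrier K)"
  have \<chi>f: "\<chi> (f x) = \<psi> x" if "x \<in> carrier H" for x
    using that s[of "f x"] eq[of "?s (f x)" x] by (simp add: \<chi>_def)
  have "\<chi> (x \<otimes>\<^bsub>K\<^esub> y) = \<chi> x + \<chi> y" if "x \<in> carrier K" "y \<in> carrier K" for x y
  proof -
    have "\<chi> (f (?s x \<otimes>\<^bsub>H\<^esub> ?s y)) = \<chi> (f (?s x)) + \<chi> (f (?s y))"
      using s(1) that charactersD(1)[OF \<psi>] \<chi>f by (simp del: hom_mult)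
    then show ?thesis using s that by simp
  qed
  moreover have "\<exists>y\<in>carrier K. \<chi> y \<noteq> 0"
    using charactersD(2)[OF \<psi>] \<chi>f by (metis hom_closed)
  ultimately have "\<chi> \<in> characters K" by (simp add: characters_def \<chi>_def)
  moreover have "pullback \<chi> = \<psi>"
    by (rule extensionalityI[of _ "carrier H"]) (use charactersD(3)[OF \<psi>] \<chi>f in \<open>auto simp: pullback_def\<close>)
  ultimately show ?thesis by (rule that)
qed

lemma pullback_rel_iff:
  assumes "\<chi> \<in> characters K" and "\<psi> \<in> characters K"
  shows "(pullback \<chi>, pullback \<psi>) \<in> char_rel H \<longleftrightarrow> (\<chi>, \<psi>) \<in> char_rel K"
proof -
  have "(\<forall>x\<in>carrier H. \<psi> (f x) = c * \<chi> (f x)) \<longleftrightarrow> (\<forall>y\<in>carrier K. \<psi> y = c * \<chi> y)" for c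
    unfolding onto[symmetric] by blast
  then show ?thesis using assms pullback_character by (simp add: char_rel_def)
qed

lemma sphere_pullback_class:
  assumes \<chi>: "\<chi> \<in> characters K"
  shows "sphere_pullback H f (char_rel K `` {\<chi>}) = char_rel H `` {pullback \<chi>}"
proof -
  have "char_rel H `` {pullback \<psi>} = char_rel H `` {pullback \<chi>}" if "\<psi> \<in> char_rel K `` {\<chi>}" for \<psi>
  proof -
    have "\<psi> \<in> characters K" using that by (auto simp: char_rel_def)
    then have "(pullback \<chi>, pullback \<psi>) \<in> char_rel H" using that \<chi> pullback_rel_iff by simp
    then show ?thesis using equiv_class_eq[OF equiv_char_rel] by blast
  qed
  moreover have "\<chi> \<in> char_rel K `` {\<chi>}" using equiv_class_self[OF equiv_char_rel \<chi>] .
  ultimately show ?thesis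
    unfolding sphere_pullback_def pullback_def[symmetric] by blast
qed

lemma bij_sphere_pullback: "bij_betw (sphere_pullback H f) (char_sphere K) (char_sphere H)"
  unfolding bij_betw_def
proof
  show "inj_on (sphere_pullback H f) (char_sphere K)"
  proof (rule inj_onI)
    fix C D assume "C \<in> char_sphere K" "D \<in> char_sphere K"
      and eq: "sphere_pullback H f C = sphere_pullback H f D"
    then obtain \<chi> \<psi> where CD: "\<chi> \<in> characters K" "C = char_rel K `` {\<chi>}" "\<psi> \<in> characters K" "D = char_rel K `` {\<psi>}"
      by (auto simp: char_sphere_def quotient_def)
    then have "(pullback \<chi>, pullback \<psi>) \<in> char_rel H"
      using eq pullback_character by (simp add: sphere_pullback_class eq_equiv_class_iff[OF equiv_char_rel])
    then show "C = D" using CD pullback_rel_iff equiv_class_eq[OF equiv_char_rel] by blast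
  qed
  show "sphere_pullback H f ` char_sphere K = char_sphere H"
  proof
    show "sphere_pullback H f ` char_sphere K \<subseteq> char_sphere H"
      using pullback_character by (auto simp: char_sphere_def sphere_pullback_class elim!: quotientE intro!: quotientI)
    show "char_sphere H \<subseteq> sphere_pullback H f ` char_sphere K"
    proof
      fix C assume "C \<in> char_sphere H"
      then obtain \<psi> where \<psi>: "\<psi> \<in> characters H" "C = char_rel H `` {\<psi>}"
        by (auto simp: char_sphere_def elim: quotientE)
      obtain \<chi> where "\<chi> \<in> characters K" "pullback \<chi> = \<psi>" using pullback_onto[OF \<psi>(1)] .
      then show "C \<in> sphere_pullback H f ` char_sphere K"
        using \<psi> sphere_pullback_class[of \<chi>] unfolding char_sphere_def by (metis imageI quotientI)
    qed
  qed
qed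

lemma type_FP_1_pullback:
  assumes fg: "fin_gen_group H"
    and central: "\<And>w x. w \<in> carrier H \<Longrightarrow> f w = \<one>\<^bsub>K\<^esub> \<Longrightarrow> x \<in> carrier H \<Longrightarrow> w \<otimes>\<^bsub>H\<^esub> x = x \<otimes>\<^bsub>H\<^esub> w"
    and \<chi>: "\<chi> \<in> characters K"
  shows "type_FP 1 (monoid_ring (char_monoid H (pullback \<chi>))) trivial_module \<longleftrightarrow>
    type_FP 1 (monoid_ring (char_monoid K \<chi>)) trivial_module"
proof -
  let ?\<psi> = "pullback \<chi>"
  let ?M = "char_monoid H ?\<psi>" and ?N = "char_monoid K \<chi>"
  note \<psi> = pullback_character[OF \<chi>]
  have M: "Group.monoid ?M" by (rule monoid_char_monoid) (use charactersD(1)[OF \<psi>] in auto)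
  have N: "Group.monoid ?N" by (rule monoid_char_monoid) (use charactersD(1)[OF \<chi>] in auto)
  have "f ` carrier ?M = carrier ?N"
    unfolding char_monoid_simps onto[symmetric] by auto
  then interpret E: monoid_epi ?M ?N f
    using M N by (intro monoid_epi.intro monoid_epi_axioms.intro) (auto simp: hom_def)
  obtain B where B: "finite B" "B \<subseteq> aug_ideal ?M" and
    zB: "\<And>J z. \<lbrakk>mr_left_ideal ?M J; B \<subseteq> J; z \<in> carrier H; ?\<psi> z = 0;
      \<forall>x\<in>carrier H. z \<otimes>\<^bsub>H\<^esub> x = x \<otimes>\<^bsub>H\<^esub> z\<rbrakk> \<Longrightarrow> frag_of z - frag_of \<one>\<^bsub>H\<^esub> \<in> J"
    using central_in_fin_gen_left_ideal[OF G.is_group fg charactersD(1,2)[OF \<psi>]] by metis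
  have "frag_of x - frag_of y \<in> J"
    if J: "mr_left_ideal ?M J" and BJ: "B \<subseteq> J" and x: "x \<in> carrier ?M" and y: "y \<in> carrier ?M"
      and xy: "f x = f y" for J x y
  proof -
    define z where "z = inv\<^bsub>H\<^esub> y \<otimes>\<^bsub>H\<^esub> x"
    have z: "z \<in> carrier H" "f z = \<one>\<^bsub>K\<^esub>" "y \<otimes>\<^bsub>H\<^esub> z = x"
      using x y xy by (simp_all add: z_def flip: G.m_assoc)
    have "frag_of z - frag_of \<one>\<^bsub>H\<^esub> \<in> J"
      using zB[OF J BJ z(1) vanish[OF \<psi> z(1,2)]] central[OF z(1,2)] by blast
    then have "frag_of y \<star>\<^bsub>?M\<^esub> (frag_of z - frag_of \<one>\<^bsub>H\<^esub>) \<in> J"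
      using y by (intro mr_left_idealD(4)[OF J]) auto
    then show ?thesis using y z by (simp add: mr_mult_distrib)
  qed
  then have "fin_gen_left_ideal (monoid_ring ?M) (aug_ideal ?M) \<longleftrightarrow>
      fin_gen_left_ideal (monoid_ring ?N) (aug_ideal ?N)"
    using E.fin_gen_push E.fin_gen_lift[OF _ B] by blast
  then show ?thesis using trivial_type_FP_1_iff[OF M] trivial_type_FP_1_iff[OF N] by simp
qed

theorem Sigma_inv_1_central_extension:
  assumes "fin_gen_group H"
    and "\<And>w x. w \<in> carrier H \<Longrightarrow> f w = \<one>\<^bsub>K\<^esub> \<Longrightarrow> x \<in> carrier H \<Longrightarrow> w \<otimes>\<^bsub>H\<^esub> x = x \<otimes>\<^bsub>H\<^esub> w"
  shows "Sigma_inv 1 H = sphere_pullback H f ` Sigma_inv 1 K"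
proof
  note FP = type_FP_1_pullback[OF assms]
  show "Sigma_inv 1 H \<subseteq> sphere_pullback H f ` Sigma_inv 1 K"
  proof
    fix C assume "C \<in> Sigma_inv 1 H"
    then obtain \<psi> where \<psi>: "\<psi> \<in> characters H" "C = char_rel H `` {\<psi>}"
      "type_FP 1 (monoid_ring (char_monoid H \<psi>)) trivial_module"
      by (auto simp: Sigma_inv_def)
    obtain \<chi> where \<chi>: "\<chi> \<in> characters K" "pullback \<chi> = \<psi>" using pullback_onto[OF \<psi>(1)] .
    have "char_rel K `` {\<chi>} \<in> Sigma_inv 1 K" using \<chi> \<psi>(3) FP unfolding Sigma_inv_def by blast
    then show "C \<in> sphere_pullback H f ` Sigma_inv 1 K"
      using \<chi> \<psi>(2) sphere_pullback_class[OF \<chi>(1)] by (metis imageI)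
  qed
  show "sphere_pullback H f ` Sigma_inv 1 K \<subseteq> Sigma_inv 1 H"
  proof
    fix C assume "C \<in> sphere_pullback H f ` Sigma_inv 1 K"
    then obtain \<chi> where \<chi>: "\<chi> \<in> characters K" "C = sphere_pullback H f (char_rel K `` {\<chi>})"
      "type_FP 1 (monoid_ring (char_monoid K \<chi>)) trivial_module"
      by (auto simp: Sigma_inv_def)
    then show "C \<in> Sigma_inv 1 H"
      using FP pullback_character sphere_pullback_class unfolding Sigma_inv_def by blast
  qed
qed

end


lemma (in character_epi) fin_gen_image:
  assumes "fin_gen_group H"
  shows "fin_gen_group K"
proof -
  obtain A where A: "finite A" "A \<subseteq> carrier H" "generate H A = carrier H"
    using assms by (auto simp: fin_gen_group_def)
  then have "generate K (f ` A) = carrier K" using generate_img[OF A(2)] onto by simp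
  then show ?thesis using A onto unfolding fin_gen_group_def by (intro exI[of _ "f ` A"]) auto
qed


section \<open>The groups \<open>X(G)\<close> and \<open>\<nu>(G)\<close>\<close>

lemma Inl_Inr_two_copies [simp]:
  "Inl g \<in> two_copies G \<longleftrightarrow> g \<in> carrier G" "Inr g \<in> two_copies G \<longleftrightarrow> g \<in> carrier G"
  by (auto simp: two_copies_def)

lemma image_two_copies: "f ` two_copies G = (\<lambda>g. f (Inl g)) ` carrier G \<union> (\<lambda>g. f (Inr g)) ` carrier G"
  by (auto simp: two_copies_def)

context group
begin

lemma relators_in_words: "X_relators G \<subseteq> words (two_copies G)" "nu_relators G \<subseteq> words (two_copies G)"
  by (auto simp: X_relators_def nu_relators_def table_relators_def wcomm_def wconj_def conj_elem_def)

end

text \<open>An assignment of elements of a group \<open>K\<close> to the generators of \<open>X(G)\<close> and \<open>\<nu>(G)\<close>.\<close>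

locale copies_assignment = K?: group K + G?: group G for K (structure) and G (structure) +
  fixes f
  assumes f_closed: "f ` two_copies G \<subseteq> carrier K"
begin

lemma f_in [simp]: "g \<in> carrier G \<Longrightarrow> f (Inl g) \<in> carrier K" "g \<in> carrier G \<Longrightarrow> f (Inr g) \<in> carrier K"
  using f_closed by (auto simp: image_two_copies)

lemma eq_one_iff: "x \<in> carrier K \<Longrightarrow> y \<in> carrier K \<Longrightarrow> x \<otimes> inv y = \<one> \<longleftrightarrow> x = y"
  using K.inv_solve_right'[of \<one> x y] by auto

lemma table_relators_iff:
  "(\<forall>r\<in>table_relators G. word_eval K f r = \<one>) \<longleftrightarrow>
    (\<lambda>g. f (Inl g)) \<in> hom G K \<and> (\<lambda>g. f (Inr g)) \<in> hom G K"
proof -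
  have "word_eval K f (wl g @ wl h @ winv (wl (g \<otimes>\<^bsub>G\<^esub> h))) = \<one> \<longleftrightarrow>
      f (Inl (g \<otimes>\<^bsub>G\<^esub> h)) = f (Inl g) \<otimes> f (Inl h)"
    "word_eval K f (wr g @ wr h @ winv (wr (g \<otimes>\<^bsub>G\<^esub> h))) = \<one> \<longleftrightarrow>
      f (Inr (g \<otimes>\<^bsub>G\<^esub> h)) = f (Inr g) \<otimes> f (Inr h)"
    if "g \<in> carrier G" "h \<in> carrier G" for g h
    using that eq_one_iff[of "f (Inl g) \<otimes> f (Inl h)" "f (Inl (g \<otimes>\<^bsub>G\<^esub> h))"]
      eq_one_iff[of "f (Inr g) \<otimes> f (Inr h)" "f (Inr (g \<otimes>\<^bsub>G\<^esub> h))"]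
    by (auto simp: K.m_assoc)
  note word = this
  have "(\<forall>r\<in>table_relators G. word_eval K f r = \<one>) \<longleftrightarrow> (\<forall>g\<in>carrier G. \<forall>h\<in>carrier G.
      word_eval K f (wl g @ wl h @ winv (wl (g \<otimes>\<^bsub>G\<^esub> h))) = \<one> \<and>
      word_eval K f (wr g @ wr h @ winv (wr (g \<otimes>\<^bsub>G\<^esub> h))) = \<one>)"
    unfolding table_relators_def by blast
  also have "\<dots> \<longleftrightarrow> (\<forall>g\<in>carrier G. \<forall>h\<in>carrier G.
      f (Inl (g \<otimes>\<^bsub>G\<^esub> h)) = f (Inl g) \<otimes> f (Inl h) \<and> f (Inr (g \<otimes>\<^bsub>G\<^esub> h)) = f (Inr g) \<otimes> f (Inr h))"
    by (intro ball_cong[OF HOL.refl] arg_cong2[where f = "(\<and>)"] word)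
  finally show ?thesis by (auto simp: hom_def)
qed

lemma X_relators_iff:
  "(\<forall>r\<in>X_relators G. word_eval K f r = \<one>) \<longleftrightarrow>
    (\<lambda>g. f (Inl g)) \<in> hom G K \<and> (\<lambda>g. f (Inr g)) \<in> hom G K \<and>
    (\<forall>g\<in>carrier G. comm_elem K (f (Inl g)) (f (Inr g)) = \<one>)"
proof -
  have "(\<forall>r\<in>X_relators G. word_eval K f r = \<one>) \<longleftrightarrow> (\<forall>r\<in>table_relators G. word_eval K f r = \<one>) \<and>
      (\<forall>g\<in>carrier G. word_eval K f (wcomm (wl g) (wr g)) = \<one>)"
    unfolding X_relators_def by blast
  moreover have "word_eval K f (wcomm (wl g) (wr g)) = comm_elem K (f (Inl g)) (f (Inr g))"
    if "g \<in> carrier G" for g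
    using that by (simp add: wcomm_def comm_elem_def K.m_assoc)
  ultimately show ?thesis unfolding table_relators_iff by simp
qed

lemma word_eval_nu_relators:
  assumes g: "g1 \<in> carrier G" "g2 \<in> carrier G" "g3 \<in> carrier G"
  defines "c \<equiv> comm_elem K (f (Inl g1)) (f (Inr g2))"
    and "d \<equiv> comm_elem K (f (Inl (conj_elem G g1 g3))) (f (Inr (conj_elem G g2 g3)))"
  shows "word_eval K f (wconj (wcomm (wl g1) (wr g2)) (wl g3)
      @ winv (wcomm (wl (conj_elem G g1 g3)) (wr (conj_elem G g2 g3)))) =
      conj_elem K c (f (Inl g3)) \<otimes> inv d" (is ?A)
    and "word_eval K f (wcomm (wl (conj_elem G g1 g3)) (wr (conj_elem G g2 g3))
      @ winv (wconj (wcomm (wl g1) (wr g2)) (wr g3))) =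
      d \<otimes> inv (conj_elem K c (f (Inr g3)))" (is ?B)
proof -
  show ?A ?B
    unfolding c_def d_def wconj_def wcomm_def conj_elem_def[of K] comm_elem_def
    using g f_in(1)[OF G.conj_elem_closed[OF g(1,3)]] f_in(2)[OF G.conj_elem_closed[OF g(2,3)]]
    by (simp_all add: K.m_assoc K.inv_mult_group)
qed

lemma nu_relators_iff:
  "(\<forall>r\<in>nu_relators G. word_eval K f r = \<one>) \<longleftrightarrow>
    (\<lambda>g. f (Inl g)) \<in> hom G K \<and> (\<lambda>g. f (Inr g)) \<in> hom G K \<and>
    (\<forall>g1\<in>carrier G. \<forall>g2\<in>carrier G. \<forall>g3\<in>carrier G.
      conj_elem K (comm_elem K (f (Inl g1)) (f (Inr g2))) (f (Inl g3)) =
        comm_elem K (f (Inl (conj_elem G g1 g3))) (f (Inr (conj_elem G g2 g3))) \<and>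
      conj_elem K (comm_elem K (f (Inl g1)) (f (Inr g2))) (f (Inr g3)) =
        comm_elem K (f (Inl (conj_elem G g1 g3))) (f (Inr (conj_elem G g2 g3))))"
proof -
  let ?c = "\<lambda>g1 g2. comm_elem K (f (Inl g1)) (f (Inr g2))"
  let ?d = "\<lambda>g1 g2 g3. ?c (conj_elem G g1 g3) (conj_elem G g2 g3)"
  have "(\<forall>r\<in>nu_relators G. word_eval K f r = \<one>) \<longleftrightarrow>
    (\<forall>r\<in>table_relators G. word_eval K f r = \<one>) \<and>
    (\<forall>g1\<in>carrier G. \<forall>g2\<in>carrier G. \<forall>g3\<in>carrier G.
      word_eval K f (wconj (wcomm (wl g1) (wr g2)) (wl g3)
        @ winv (wcomm (wl (conj_elem G g1 g3)) (wr (conj_elem G g2 g3)))) = \<one> \<and>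
      word_eval K f (wcomm (wl (conj_elem G g1 g3)) (wr (conj_elem G g2 g3))
        @ winv (wconj (wcomm (wl g1) (wr g2)) (wr g3))) = \<one>)"
    unfolding nu_relators_def by blast
  also have "\<dots> \<longleftrightarrow> (\<forall>r\<in>table_relators G. word_eval K f r = \<one>) \<and>
    (\<forall>g1\<in>carrier G. \<forall>g2\<in>carrier G. \<forall>g3\<in>carrier G.
      conj_elem K (?c g1 g2) (f (Inl g3)) = ?d g1 g2 g3 \<and>
      conj_elem K (?c g1 g2) (f (Inr g3)) = ?d g1 g2 g3)"
    by (intro conj_cong HOL.refl ball_cong)
      (auto simp: word_eval_nu_relators eq_one_iff simp del: append.simps)
  finally show ?thesis unfolding table_relators_iff by simp
qed

end

context group
begin

interpretation X: presentation "two_copies G" "X_relators G"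
  rewrites "presented_group (two_copies G) (X_relators G) = X_group G"
    and "pres_gen (two_copies G) (X_relators G) = X_gen G"
  by unfold_locales (simp_all add: relators_in_words X_group_def X_gen_def)

abbreviation (input) nu_gen where "nu_gen \<equiv> pres_gen (two_copies G) (nu_relators G)"

interpretation nu: presentation "two_copies G" "nu_relators G"
  rewrites "presented_group (two_copies G) (nu_relators G) = nu_group G"
  by unfold_locales (simp_all add: relators_in_words nu_group_def)

interpretation X: copies_assignment "X_group G" G "X_gen G"
  by (intro copies_assignment.intro copies_assignment_axioms.intro X.group_presented
      X.pres_gen_closed group_axioms)

interpretation nu: copies_assignment "nu_group G" G nu_gen
  by (intro copies_assignment.intro copies_assignment_axioms.intro nu.group_presented
      nu.pres_gen_closed group_axioms)

interpretation X: double_image "X_group G" G "\<lambda>g. X_gen G (Inl g)" "\<lambda>g. X_gen G (Inr g)"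
  rewrites "X.diff_subgroup = L_subgroup G" and "X.cross_subgroup = D_subgroup G"
proof -
  show *: "double_image (X_group G) G (\<lambda>g. X_gen G (Inl g)) (\<lambda>g. X_gen G (Inr g))"
    using X.word_eval_relator X.X_relators_iff X.presented_generate
    by unfold_locales (simp_all add: image_two_copies)
  show "double_image.diff_subgroup (X_group G) G (\<lambda>g. X_gen G (Inl g)) (\<lambda>g. X_gen G (Inr g)) = L_subgroup G"
    by (simp add: double_image.diff_subgroup_def[OF *] L_subgroup_def)
  show "double_image.cross_subgroup (X_group G) G (\<lambda>g. X_gen G (Inl g)) (\<lambda>g. X_gen G (Inr g)) = D_subgroup G"
    by (simp add: double_image.cross_subgroup_def[OF *] D_subgroup_def)
qed


interpretation W: normal "W_subgroup G" "X_group G"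
  unfolding W_subgroup_def
  by (rule X.K.normal_subgroup_intersect[OF X.diff_normal X.cross_normal])

lemma proj_hom: "group_hom (X_group G) (X_mod_W G) (\<lambda>x. W_subgroup G #>\<^bsub>X_group G\<^esub> x)"
  unfolding X_mod_W_def
  by (intro group_hom.intro group_hom_axioms.intro X.K.group_axioms W.factorgroup_is_group W.r_coset_hom_Mod)

interpretation proj: group_hom "X_group G" "X_mod_W G" "\<lambda>x. W_subgroup G #>\<^bsub>X_group G\<^esub> x"
  by (rule proj_hom)

lemma proj_eq_one_iff:
  assumes "x \<in> carrier (X_group G)"
  shows "W_subgroup G #>\<^bsub>X_group G\<^esub> x = \<one>\<^bsub>X_mod_W G\<^esub> \<longleftrightarrow> x \<in> W_subgroup G"
proof -
  have "W_subgroup G #>\<^bsub>X_group G\<^esub> x = W_subgroup G \<longleftrightarrow> x \<in> W_subgroup G"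
    using X.K.rcos_self[OF assms W.subgroup_axioms] W.rcos_const[OF X.K.group_axioms] by auto
  then show ?thesis by (simp add: X_mod_W_def)
qed

lemma nu_relators_in_W:
  assumes "r \<in> nu_relators G"
  shows "word_eval (X_group G) (X_gen G) r \<in> W_subgroup G"
proof -
  consider "r \<in> table_relators G" | g1 g2 g3 where "g1 \<in> carrier G" "g2 \<in> carrier G" "g3 \<in> carrier G"
      "r = wconj (wcomm (wl g1) (wr g2)) (wl g3)
        @ winv (wcomm (wl (conj_elem G g1 g3)) (wr (conj_elem G g2 g3)))"
    | g1 g2 g3 where "g1 \<in> carrier G" "g2 \<in> carrier G" "g3 \<in> carrier G"
      "r = wcomm (wl (conj_elem G g1 g3)) (wr (conj_elem G g2 g3))
        @ winv (wconj (wcomm (wl g1) (wr g2)) (wr g3))"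
    using assms unfolding nu_relators_def by blast
  then show ?thesis
  proof cases
    case 1
    then have "word_eval (X_group G) (X_gen G) r = \<one>\<^bsub>X_group G\<^esub>"
      using X.word_eval_relator by (simp add: X_relators_def)
    then show ?thesis by simp
  next
    case (2 g1 g2 g3)
    show ?thesis
      unfolding 2(4) X.word_eval_nu_relators(1)[OF 2(1-3)] W_subgroup_def
      by (rule X.nu_relation_in_both(1)[OF 2(1-3)])
  next
    case (3 g1 g2 g3)
    show ?thesis
      unfolding 3(4) X.word_eval_nu_relators(2)[OF 3(1-3)] W_subgroup_def
      by (rule X.nu_relation_in_both(2)[OF 3(1-3)])
  qed
qed

lemma nu_to_X_mod_W_hom_cls:
  "nu_to_X_mod_W G \<in> hom (nu_group G) (X_mod_W G)"
  "w \<in> words (two_copies G) \<Longrightarrow>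
    nu_to_X_mod_W G (nu.cls w) = W_subgroup G #>\<^bsub>X_group G\<^esub> X.cls w"
proof -
  let ?F = "\<lambda>x. W_subgroup G #>\<^bsub>X_group G\<^esub> X_gen G x"
  have F: "?F ` two_copies G \<subseteq> carrier (X_mod_W G)"
    using X.pres_gen_closed proj.hom_closed by blast
  have eval: "word_eval (X_mod_W G) ?F w = W_subgroup G #>\<^bsub>X_group G\<^esub> X.cls w"
    if "w \<in> words (two_copies G)" for w
    using word_eval_hom[OF proj_hom X.pres_gen_closed that] X.word_eval_pres_gen[OF that]
    by (simp add: comp_def)
  have rel: "word_eval (X_mod_W G) ?F r = \<one>\<^bsub>X_mod_W G\<^esub>" if "r \<in> nu_relators G" for r
  proof -
    have r: "r \<in> words (two_copies G)" using that relators_in_words(2) by blast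
    have "X.cls r \<in> W_subgroup G"
      using nu_relators_in_W[OF that] by (simp add: X.word_eval_pres_gen[OF r])
    then show ?thesis using r by (simp add: eval proj_eq_one_iff)
  qed
  show "nu_to_X_mod_W G \<in> hom (nu_group G) (X_mod_W G)"
    unfolding nu_to_X_mod_W_def by (rule nu.pres_hom_hom[OF proj.H.group_axioms F rel])
  show "nu_to_X_mod_W G (nu.cls w) = W_subgroup G #>\<^bsub>X_group G\<^esub> X.cls w"
    if "w \<in> words (two_copies G)"
    unfolding nu_to_X_mod_W_def
    by (rule HOL.trans[OF nu.pres_hom_cls[OF proj.H.group_axioms F _ that] eval[OF that]]) (rule rel)
qed

interpretation nu_X: group_hom "nu_group G" "X_mod_W G" "nu_to_X_mod_W G"
  by (intro group_hom.intro group_hom_axioms.intro nu.group_presented proj.H.group_axioms nu_to_X_mod_W_hom_cls)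

lemma nu_to_X_mod_W_onto: "nu_to_X_mod_W G ` carrier (nu_group G) = carrier (X_mod_W G)"
proof
  show "nu_to_X_mod_W G ` carrier (nu_group G) \<subseteq> carrier (X_mod_W G)" by auto
  show "carrier (X_mod_W G) \<subseteq> nu_to_X_mod_W G ` carrier (nu_group G)"
  proof
    fix y assume "y \<in> carrier (X_mod_W G)"
    then obtain w where "w \<in> words (two_copies G)" "y = W_subgroup G #>\<^bsub>X_group G\<^esub> X.cls w"
      by (auto simp: X_mod_W_def carrier_FactGroup X.carrier_presented)
    then show "y \<in> nu_to_X_mod_W G ` carrier (nu_group G)"
      using nu_to_X_mod_W_hom_cls(2) by (auto simp: nu.carrier_presented)
  qed
qed

text \<open>The assignments that induce the projections of \<open>X(G)\<close> and \<open>\<nu>(G)\<close> to \<open>G\<close>, where the two copies are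
  identified, and to \<open>G \<times> G\<close>, where they commute.\<close>

definition fold_gen :: "'a + 'a \<Rightarrow> 'a" where
  "fold_gen = case_sum (\<lambda>g. g) (\<lambda>g. g)"

definition pair_gen :: "'a + 'a \<Rightarrow> 'a \<times> 'a" where
  "pair_gen = case_sum (\<lambda>g. (g, \<one>)) (\<lambda>g. (\<one>, g))"

lemma gen_simps [simp]:
  "fold_gen (Inl g) = g" "fold_gen (Inr g) = g" "pair_gen (Inl g) = (g, \<one>)" "pair_gen (Inr g) = (\<one>, g)"
  by (simp_all add: fold_gen_def pair_gen_def)

interpretation GG: group "G \<times>\<times> G"
  by (rule DirProd_group[OF group_axioms group_axioms])

interpretation fold: copies_assignment G G fold_gen
  by unfold_locales (auto simp: image_two_copies)

interpretation pair: copies_assignment "G \<times>\<times> G" G pair_gen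
  by unfold_locales (auto simp: image_two_copies)

lemma fold_relators:
  "r \<in> X_relators G \<Longrightarrow> word_eval G fold_gen r = \<one>"
  "r \<in> nu_relators G \<Longrightarrow> word_eval G fold_gen r = \<one>"
  using fold.X_relators_iff fold.nu_relators_iff
  by (auto simp: comm_elem_eq_one_iff conj_elem_comm_elem hom_def)

lemma pair_comm: "g \<in> carrier G \<Longrightarrow> h \<in> carrier G \<Longrightarrow> comm_elem (G \<times>\<times> G) (g, \<one>) (\<one>, h) = (\<one>, \<one>)"
  by (simp add: comm_elem_def inv_DirProd[OF group_axioms group_axioms])

lemma pair_relators:
  "r \<in> X_relators G \<Longrightarrow> word_eval (G \<times>\<times> G) pair_gen r = (\<one>, \<one>)"
  "r \<in> nu_relators G \<Longrightarrow> word_eval (G \<times>\<times> G) pair_gen r = (\<one>, \<one>)"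
proof -
  have "conj_elem (G \<times>\<times> G) (\<one>, \<one>) x = (\<one>, \<one>)" if "x \<in> carrier (G \<times>\<times> G)" for x
    using that GG.l_inv[of x] by (auto simp: conj_elem_def inv_DirProd[OF group_axioms group_axioms])
  then show "r \<in> X_relators G \<Longrightarrow> word_eval (G \<times>\<times> G) pair_gen r = (\<one>, \<one>)"
    "r \<in> nu_relators G \<Longrightarrow> word_eval (G \<times>\<times> G) pair_gen r = (\<one>, \<one>)"
    using pair.X_relators_iff pair.nu_relators_iff by (auto simp: pair_comm hom_def)
qed

text \<open>These are the projections of both groups, as the homomorphism that an assignment of the generators
  induces does not depend on the relators.\<close>

abbreviation "to_G \<equiv> pres_hom G fold_gen"
abbreviation "to_GG \<equiv> pres_hom (G \<times>\<times> G) pair_gen"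

lemma fold_hom: "group_hom (nu_group G) G to_G" "group_hom (X_group G) G to_G"
  by (intro group_hom.intro group_hom_axioms.intro nu.group_presented X.group_presented group_axioms
      nu.pres_hom_hom X.pres_hom_hom fold.f_closed fold_relators; assumption)+

lemma pair_hom: "group_hom (nu_group G) (G \<times>\<times> G) to_GG" "group_hom (X_group G) (G \<times>\<times> G) to_GG"
  using pair_relators
  by (auto intro!: group_hom.intro group_hom_axioms.intro nu.group_presented X.group_presented
      GG.group_axioms nu.pres_hom_hom X.pres_hom_hom pair.f_closed)

interpretation nu: nu_like "nu_group G" G "\<lambda>g. nu_gen (Inl g)" "\<lambda>g. nu_gen (Inr g)" to_G to_GG
proof -
  have rel: "\<forall>r\<in>nu_relators G. word_eval (nu_group G) nu_gen r = \<one>\<^bsub>nu_group G\<^esub>"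
    using nu.word_eval_relator by blast
  have gen: "carrier (nu_group G) = generate (nu_group G)
      ((\<lambda>g. nu_gen (Inl g)) ` carrier G \<union> (\<lambda>g. nu_gen (Inr g)) ` carrier G)"
    using nu.presented_generate by (simp add: image_two_copies)
  have fold: "to_G (nu_gen x) = fold_gen x" if "x \<in> two_copies G" for x
    using fold_relators(2) that by (intro nu.pres_hom_pres_gen fold.f_closed group_axioms)
  have pair: "to_GG (nu_gen x) = pair_gen x" if "x \<in> two_copies G" for x
    using pair_relators(2) that by (intro nu.pres_hom_pres_gen pair.f_closed GG.group_axioms) auto
  have "double_image (nu_group G) G (\<lambda>g. nu_gen (Inl g)) (\<lambda>g. nu_gen (Inr g))"
    using rel gen unfolding nu.nu_relators_iff
    by (intro double_image.intro double_image_axioms.intro nu.group_presented group_axioms) auto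
  then show "nu_like (nu_group G) G (\<lambda>g. nu_gen (Inl g)) (\<lambda>g. nu_gen (Inr g)) to_G to_GG"
    using rel fold_hom(1) pair_hom(1) fold pair unfolding nu.nu_relators_iff
    by (intro nu_like.intro nu_like_axioms.intro) auto
qed

lemma kernel_nu_to_X_mod_W:
  assumes w: "w \<in> carrier (nu_group G)" and "nu_to_X_mod_W G w = \<one>\<^bsub>X_mod_W G\<^esub>"
  shows "to_G w = \<one>" and "to_GG w = (\<one>, \<one>)"
proof -
  interpret f: group_hom "X_group G" G to_G by (rule fold_hom)
  interpret p: group_hom "X_group G" "G \<times>\<times> G" to_GG by (rule pair_hom)
  obtain v where v: "v \<in> words (two_copies G)" "w = nu.cls v"
    using w by (auto simp: nu.carrier_presented)
  have "X.cls v \<in> carrier (X_group G)" using v by (simp add: X.carrier_presented)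
  then have "X.cls v \<in> W_subgroup G"
    using assms(2) v proj_eq_one_iff by (simp add: nu_to_X_mod_W_hom_cls)
  then have LD: "X.cls v \<in> L_subgroup G" "X.cls v \<in> D_subgroup G" by (auto simp: W_subgroup_def)
  have fold: "to_G (X_gen G x) = fold_gen x" if "x \<in> two_copies G" for x
    using fold_relators(1) that by (intro X.pres_hom_pres_gen fold.f_closed group_axioms)
  have pair: "to_GG (X_gen G x) = pair_gen x" if "x \<in> two_copies G" for x
    using pair_relators(1) that by (intro X.pres_hom_pres_gen pair.f_closed GG.group_axioms) auto
  have "L_subgroup G \<subseteq> kernel (X_group G) G to_G"
    unfolding L_subgroup_def
    by (rule X.K.generate_subgroup_incl[OF _ f.subgroup_kernel]) (auto simp: kernel_def fold)
  then have "to_G (X.cls v) = \<one>" using LD(1) by (auto simp: kernel_def)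
  then show "to_G w = \<one>"
    using v fold_relators by (simp add: nu.pres_hom_cls X.pres_hom_cls fold.f_closed group_axioms)
  have "D_subgroup G \<subseteq> kernel (X_group G) (G \<times>\<times> G) to_GG"
    unfolding D_subgroup_def
    by (rule X.K.generate_subgroup_incl[OF _ p.subgroup_kernel])
      (auto simp: kernel_def pair p.hom_comm_elem pair_comm)
  then have "to_GG (X.cls v) = (\<one>, \<one>)" using LD(2) by (auto simp: kernel_def)
  then show "to_GG w = (\<one>, \<one>)"
    using v pair_relators nu.pres_hom_cls[OF GG.group_axioms pair.f_closed _ v(1)]
      X.pres_hom_cls[OF GG.group_axioms pair.f_closed _ v(1)] by simp
qed

lemma kernel_nu_central:
  assumes "w \<in> W0_subgroup G" and "x \<in> carrier (nu_group G)"
  shows "w \<otimes>\<^bsub>nu_group G\<^esub> x = x \<otimes>\<^bsub>nu_group G\<^esub> w"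
  using assms by (intro nu.kernel_central kernel_nu_to_X_mod_W) (auto simp: W0_subgroup_def kernel_def)

lemma character_kernel_nu:
  assumes "w \<in> W0_subgroup G" and "\<chi> \<in> characters (nu_group G)"
  shows "\<chi> w = 0"
proof -
  have "w \<in> nu.cross_subgroup"
    using assms(1) kernel_nu_to_X_mod_W by (intro nu.kernel_in_cross) (auto simp: W0_subgroup_def kernel_def)
  then show ?thesis using nu.additive_cross_eq_0 charactersD(1)[OF assms(2)] by blast
qed

lemma fin_gen_nu:
  assumes "fin_gen_group G"
  shows "fin_gen_group (nu_group G)"
proof -
  obtain A where A: "finite A" "A \<subseteq> carrier G" "generate G A = carrier G"
    using assms by (auto simp: fin_gen_group_def)
  let ?a = "\<lambda>g. nu_gen (Inl g)" and ?b = "\<lambda>g. nu_gen (Inr g)"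
  let ?B = "?a ` A \<union> ?b ` A"
  have B: "?B \<subseteq> carrier (nu_group G)" using A(2) by auto
  have "?a ` carrier G = generate (nu_group G) (?a ` A)" "?b ` carrier G = generate (nu_group G) (?b ` A)"
    using nu.a.generate_img[OF A(2)] nu.b.generate_img[OF A(2)] A(3) by simp_all
  then have "?a ` carrier G \<union> ?b ` carrier G \<subseteq> generate (nu_group G) ?B"
    using nu.K.mono_generate[of "?a ` A" ?B] nu.K.mono_generate[of "?b ` A" ?B] by blast
  then have "carrier (nu_group G) \<subseteq> generate (nu_group G) ?B"
    using nu.generated nu.K.generate_subgroup_incl[OF _ nu.K.generate_is_subgroup[OF B]] by simp
  then show ?thesis
    using A(1) B nu.K.generate_incl[OF B] unfolding fin_gen_group_def
    by (intro exI[of _ ?B]) auto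
qed

interpretation W0: normal "W0_subgroup G" "nu_group G"
  unfolding W0_subgroup_def by (rule nu_X.normal_kernel)

lemma nu_proj_epi: "character_epi (nu_group G) (nu_mod_W0 G) (nu_proj G)"
  and nu_proj_kernel: "w \<in> carrier (nu_group G) \<Longrightarrow> nu_proj G w = \<one>\<^bsub>nu_mod_W0 G\<^esub> \<Longrightarrow> w \<in> W0_subgroup G"
proof -
  have hom: "group_hom (nu_group G) (nu_mod_W0 G) (nu_proj G)"
    unfolding nu_mod_W0_def nu_proj_def
    by (intro group_hom.intro group_hom_axioms.intro nu.group_presented W0.factorgroup_is_group
        W0.r_coset_hom_Mod)
  have onto: "nu_proj G ` carrier (nu_group G) = carrier (nu_mod_W0 G)"
    by (simp add: nu_proj_def nu_mod_W0_def carrier_FactGroup)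
  show ker: "w \<in> W0_subgroup G"
    if "w \<in> carrier (nu_group G)" "nu_proj G w = \<one>\<^bsub>nu_mod_W0 G\<^esub>" for w
    using that nu.K.rcos_self[OF that(1) W0.subgroup_axioms] by (simp add: nu_proj_def nu_mod_W0_def)
  show "character_epi (nu_group G) (nu_mod_W0 G) (nu_proj G)"
    by (intro character_epi.intro character_epi_axioms.intro hom onto)
      (use ker character_kernel_nu in blast)
qed

lemma induced_iso_epi: "character_epi (nu_mod_W0 G) (X_mod_W G) (induced_iso G)"
  and induced_iso_kernel: "w \<in> carrier (nu_mod_W0 G) \<Longrightarrow> induced_iso G w = \<one>\<^bsub>X_mod_W G\<^esub> \<Longrightarrow> w = \<one>\<^bsub>nu_mod_W0 G\<^esub>"
proof -
  have grp: "group (nu_mod_W0 G)" unfolding nu_mod_W0_def by (rule W0.factorgroup_is_group)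
  have iso: "induced_iso G \<in> iso (nu_mod_W0 G) (X_mod_W G)"
    using nu_X.FactGroup_iso_set[OF nu_to_X_mod_W_onto]
    by (simp add: induced_iso_def[abs_def] nu_mod_W0_def W0_subgroup_def)
  interpret i: group_hom "nu_mod_W0 G" "X_mod_W G" "induced_iso G"
    using iso by (intro group_hom.intro group_hom_axioms.intro grp proj.H.group_axioms) (simp add: iso_def)
  show ker: "w = \<one>\<^bsub>nu_mod_W0 G\<^esub>"
    if "w \<in> carrier (nu_mod_W0 G)" "induced_iso G w = \<one>\<^bsub>X_mod_W G\<^esub>" for w
    using iso that i.iso_iff by blast
  show "character_epi (nu_mod_W0 G) (X_mod_W G) (induced_iso G)"
  proof (intro character_epi.intro character_epi_axioms.intro i.group_hom_axioms)
    show "induced_iso G ` carrier (nu_mod_W0 G) = carrier (X_mod_W G)"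
      using iso by (simp add: iso_def bij_betw_def)
    show "\<chi> w = 0" if "\<chi> \<in> characters (nu_mod_W0 G)" "w \<in> carrier (nu_mod_W0 G)"
      "induced_iso G w = \<one>\<^bsub>X_mod_W G\<^esub>" for \<chi> w
      using ker[OF that(2,3)] charactersD(1)[OF that(1), of w w] that(2) by simp
  qed
qed

end

section \<open>The invariants of \<open>\<nu>(G)\<close> and \<open>X(G)/W\<close>\<close>

theorem proposition8p4:
  fixes G :: "('a, 'b) monoid_scheme"
  assumes "group G" and "fin_gen_group G"
  shows "bij_betw (sphere_pullback (nu_group G) (nu_proj G))
           (char_sphere (nu_mod_W0 G)) (char_sphere (nu_group G)) \<and>
         bij_betw (sphere_pullback (nu_mod_W0 G) (induced_iso G))
           (char_sphere (X_mod_W G)) (char_sphere (nu_mod_W0 G)) \<and>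
         Sigma_inv 1 (nu_group G) =
           sphere_pullback (nu_group G) (nu_proj G) `
             (sphere_pullback (nu_mod_W0 G) (induced_iso G) ` Sigma_inv 1 (X_mod_W G))"
proof -
  interpret group G by fact
  interpret p: character_epi "nu_group G" "nu_mod_W0 G" "nu_proj G" by (rule nu_proj_epi)
  interpret i: character_epi "nu_mod_W0 G" "X_mod_W G" "induced_iso G" by (rule induced_iso_epi)
  have nu: "fin_gen_group (nu_group G)" by (rule fin_gen_nu[OF assms(2)])
  have "Sigma_inv 1 (nu_group G) = sphere_pullback (nu_group G) (nu_proj G) ` Sigma_inv 1 (nu_mod_W0 G)"
    using nu_proj_kernel kernel_nu_central by (intro p.Sigma_inv_1_central_extension[OF nu]) blast
  moreover have "Sigma_inv 1 (nu_mod_W0 G) =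
      sphere_pullback (nu_mod_W0 G) (induced_iso G) ` Sigma_inv 1 (X_mod_W G)"
    using induced_iso_kernel
    by (intro i.Sigma_inv_1_central_extension[OF p.fin_gen_image[OF nu]]) fastforce
  ultimately show ?thesis using p.bij_sphere_pullback i.bij_sphere_pullback by simp
qed

end
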